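(* Let $\pi$ be a unitary representation of a group $G$ in a Hilbert space $\mathcal H$. The following conditions are equivalent: (i) the space $C^b_u(\mathbb S_{\mathcal H})$ of all bounded uniformly continuous functions on the unit sphere $\mathbb S_{\mathcal H}$ admits a $G$-invariant mean; (ii) the representation $\pi$ is amenable.
   Context: As usual for unitary representations, Hilbert spaces are complex. $G$ is an abstract group; no topology on $G$ and no continuity of $\pi$ is assumed. $\mathbb S_{\mathcal H}$ is the unit sphere of $\mathcal H$ with the uniform structure given by the norm distance. $C^b_u(\mathbb S_{\mathcal H})$ consists of complex-valued functions and carries the supremum norm. A $G$-invariant mean on $C^b_u(\mathbb S_{\mathcal H})$ is a positive linear functional $\psi$ of norm $1$ with $\psi(1)=1$ and $\psi({}_gf)=\psi(f)$ for all $g\in G$ and $f\in C^b_u(\mathbb S_{\mathcal H})$, where ${}_gf(x)=f(\pi(g)x)$. Amenable representation (Bekka): $\pi$ is amenable if there is a linear functional $\phi\in\mathcal L(\mathcal H)^*$ on the algebra $\mathcal L(\mathcal H)$ of all bounded operators with $\phi\ge 0$, $\phi(\mathbb I)=1$ and $\phi(\pi(g)T\pi(g)^{-1})=\phi(T)$ for all $T\in\mathcal L(\mathcal H)$, $g\in G$. *)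

theory Defs
  imports "HOL-Analysis.Analysis" "HOL-Algebra.Group"
begin

text \<open>
  Complex Hilbert spaces, of arbitrary (possibly zero) dimension, with inner product linear in
  the first argument. Together with conjugate symmetry and the norm axiom of the superclass, the
  last axiom contains positive definiteness; completeness is part of \<^class>\<open>banach\<close>.
\<close>

class complex_hilbert = banach +
  fixes scaleC :: "complex \<Rightarrow> 'a \<Rightarrow> 'a"  (infixr \<open>*\<^sub>C\<close> 75)
    and cinner :: "'a \<Rightarrow> 'a \<Rightarrow> complex"
  assumes scaleC_add_right: "c *\<^sub>C (x + y) = c *\<^sub>C x + c *\<^sub>C y"
    and scaleC_add_left: "(c + d) *\<^sub>C x = c *\<^sub>C x + d *\<^sub>C x"
    and scaleC_scaleC: "c *\<^sub>C d *\<^sub>C x = (c * d) *\<^sub>C x"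
    and scaleR_scaleC: "scaleR r x = complex_of_real r *\<^sub>C x"
    and cinner_commute: "cinner x y = cnj (cinner y x)"
    and cinner_add_left: "cinner (x + y) z = cinner x z + cinner y z"
    and cinner_scaleC_left: "cinner (c *\<^sub>C x) y = c * cinner x y"
    and cinner_self: "cinner x x = complex_of_real ((norm x)\<^sup>2)"


section \<open>Bounded operators and unitary representations\<close>

definition bounded_operators :: "('h::complex_hilbert \<Rightarrow> 'h) set" where
  "bounded_operators = {T. bounded_linear T \<and> (\<forall>c x. T (c *\<^sub>C x) = c *\<^sub>C T x)}"

definition positive_operator :: "('h::complex_hilbert \<Rightarrow> 'h) \<Rightarrow> bool" where
  "positive_operator T \<longleftrightarrow> T \<in> bounded_operators \<and> (\<forall>x. cinner (T x) x \<in> \<real>\<^sub>\<ge>\<^sub>0)"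

definition unitary_operator :: "('h::complex_hilbert \<Rightarrow> 'h) \<Rightarrow> bool" where
  "unitary_operator U \<longleftrightarrow>
     U \<in> bounded_operators \<and> surj U \<and> (\<forall>x y. cinner (U x) (U y) = cinner x y)"

definition unitary_group :: "('h::complex_hilbert \<Rightarrow> 'h) monoid" where
  "unitary_group = \<lparr>carrier = {U. unitary_operator U}, mult = (\<circ>), one = id\<rparr>"

definition unitary_representation ::
  "('g, 'b) monoid_scheme \<Rightarrow> ('g \<Rightarrow> 'h::complex_hilbert \<Rightarrow> 'h) \<Rightarrow> bool" where
  "unitary_representation G \<pi> \<longleftrightarrow> \<pi> \<in> hom G unitary_group"

definition amenable_representation ::
  "('g, 'b) monoid_scheme \<Rightarrow> ('g \<Rightarrow> 'h::complex_hilbert \<Rightarrow> 'h) \<Rightarrow> bool" where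
  "amenable_representation G \<pi> \<longleftrightarrow>
     (\<exists>\<phi> :: ('h \<Rightarrow> 'h) \<Rightarrow> complex.
        (\<forall>S\<in>bounded_operators. \<forall>T\<in>bounded_operators. \<phi> (\<lambda>x. S x + T x) = \<phi> S + \<phi> T) \<and>
        (\<forall>c. \<forall>T\<in>bounded_operators. \<phi> (\<lambda>x. c *\<^sub>C T x) = c * \<phi> T) \<and>
        (\<exists>K. \<forall>T\<in>bounded_operators. cmod (\<phi> T) \<le> K * onorm T) \<and>
        (\<forall>T. positive_operator T \<longrightarrow> \<phi> T \<in> \<real>\<^sub>\<ge>\<^sub>0) \<and>
        \<phi> id = 1 \<and>
        (\<forall>g\<in>carrier G. \<forall>T\<in>bounded_operators. \<phi> (\<pi> g \<circ> T \<circ> inv_into UNIV (\<pi> g)) = \<phi> T))"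


section \<open>Invariant means on the unit sphere\<close>

text \<open>
  A function on the unit sphere is represented by its extension by \<open>0\<close> to the whole space, so
  that distinct elements of the set below are distinct functions on the sphere. Only the
  restriction to the sphere is required to be uniformly continuous.
\<close>

definition Cbu_sphere :: "('h::complex_hilbert \<Rightarrow> complex) set" where
  "Cbu_sphere = {f. bounded (f ` sphere 0 1) \<and> uniformly_continuous_on (sphere 0 1) f \<and>
                    (\<forall>x. x \<notin> sphere 0 1 \<longrightarrow> f x = 0)}"

text \<open>
  Because of the extension by \<open>0\<close>, the supremum over the whole space is the supremum over the
  sphere, and it is \<open>0\<close> if the sphere is empty, i.e. for the zero space.
\<close>

definition sup_norm :: "('h::complex_hilbert \<Rightarrow> complex) \<Rightarrow> real" where
  "sup_norm f = (SUP x. cmod (f x))"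

text \<open>
  Boundedness is stated separately in the following definition since a real \<open>SUP\<close> is meaningful
  only for sets that are bounded above. The constant function 1 on the sphere is the indicator
  function of the sphere.
\<close>

definition invariant_mean ::
  "('g, 'b) monoid_scheme \<Rightarrow> ('g \<Rightarrow> 'h::complex_hilbert \<Rightarrow> 'h) \<Rightarrow>
   (('h \<Rightarrow> complex) \<Rightarrow> complex) \<Rightarrow> bool" where
  "invariant_mean G \<pi> \<psi> \<longleftrightarrow>
     (\<forall>f\<in>Cbu_sphere. \<forall>h\<in>Cbu_sphere. \<psi> (\<lambda>x. f x + h x) = \<psi> f + \<psi> h) \<and>
     (\<forall>c. \<forall>f\<in>Cbu_sphere. \<psi> (\<lambda>x. c * f x) = c * \<psi> f) \<and>
     (\<forall>f\<in>Cbu_sphere. (\<forall>x\<in>sphere 0 1. f x \<in> \<real>\<^sub>\<ge>\<^sub>0) \<longrightarrow> \<psi> f \<in> \<real>\<^sub>\<ge>\<^sub>0) \<and>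
     (\<exists>K. \<forall>f\<in>Cbu_sphere. cmod (\<psi> f) \<le> K * sup_norm f) \<and>
     (SUP f\<in>{f\<in>Cbu_sphere. sup_norm f \<le> 1}. cmod (\<psi> f)) = 1 \<and>
     \<psi> (indicator (sphere 0 1)) = 1 \<and>
     (\<forall>g\<in>carrier G. \<forall>f\<in>Cbu_sphere. \<psi> (\<lambda>x. f (\<pi> g x)) = \<psi> f)"

end

theory Submission
  imports Defs
begin

text \<open>
  An invariant mean \<open>\<psi>\<close> gives the invariant state that maps \<open>T\<close> to the \<open>\<psi>\<close>-mean of
  \<open>x \<mapsto> \<langle>T x, x\<rangle>\<close>.

  Conversely, by Hahn--Banach an invariant mean exists unless some sum of functions
  \<open>h \<circ> \<pi> g - h\<close> is bounded above by a negative constant on the sphere. Hahn--Banach in the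
  predual of the bounded operators turns an invariant state into finite tuples \<open>v\<close> of vectors
  with \<open>\<Sum>\<parallel>v j\<parallel>\<^sup>2 = 1\<close> whose finite-rank operators \<open>\<Sum>|v j\<rangle>\<langle>v j|\<close> are moved arbitrarily
  little in trace norm by finitely many \<open>\<pi> g\<close>. A Powers--Stoermer type inequality then says that
  \<open>\<pi> g \<circ> v\<close> is close in the Hilbert--Schmidt norm to \<open>v\<close> transformed by a unitary matrix. Hence
  the mean \<open>\<Sum>\<parallel>v j\<parallel>\<^sup>2 h (v j / \<parallel>v j\<parallel>)\<close>, averaged over the compact group of unitary matrices
  acting on \<open>v\<close>, is almost invariant, so no such sum can be negative. The average exists by von
  Neumann's argument for almost periodic functions, without Haar measure.
\<close>

section \<open>Complex Hilbert spaces\<close>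

text \<open>The middle of the proof is shaped by an ambiguity. A positive finite-rank operator
  determines a tuple \<open>v\<close>, read as a linear map from C^n to the Hilbert space, only up
  to a unitary matrix on the right, whereas the weighted sum of the values of \<open>h\<close> at
  the normalised entries depends on the choice of \<open>v\<close>. Closeness of operators therefore
  gives closeness of tuples only after a rotation that varies with the group element and is
  otherwise unknown. Averaging over all rotations makes it harmless, since translation by a fixed
  unitary does not change the average. A maximiser over the compact matrix group takes the place of
  a polar decomposition. Trace class operators do not occur as such: a normal functional is recorded
  by its values on contractions. A linear functional on bounded functions of contractions, evaluated
  at rank-one forms, becomes an operator by the Riesz theorem. Sums of functions
  \<open>h \<circ> \<pi> g - h\<close> are the right obstruction because each involves finitely many
  group elements, so approximate invariance under finite sets is enough.\<close>

lemma cinner_add_right: "cinner x (y + z) = cinner x y + cinner x z"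
  by (subst (1 2 3) cinner_commute) (simp add: cinner_add_left)

lemma cinner_scaleC_right: "cinner x (c *\<^sub>C y) = cnj c * cinner x y"
  by (subst (1 2) cinner_commute) (simp add: cinner_scaleC_left)

lemma cinner_scaleR_left: "cinner (scaleR r x) y = complex_of_real r * cinner x y"
  by (simp add: scaleR_scaleC cinner_scaleC_left)

lemma cinner_scaleR_right: "cinner x (scaleR r y) = complex_of_real r * cinner x y"
  by (simp add: scaleR_scaleC cinner_scaleC_right)

lemma cinner_zero_left [simp]: "cinner 0 y = 0"
  using cinner_scaleR_left[of 0 0 y] by simp

lemma cinner_zero_right [simp]: "cinner y 0 = 0"
  using cinner_scaleR_right[of y 0 0] by simp

lemma cinner_minus_left: "cinner (- x) y = - cinner x y"
  using cinner_scaleR_left[of "-1" x y] by simp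

lemma cinner_minus_right: "cinner x (- y) = - cinner x y"
  using cinner_scaleR_right[of x "-1" y] by simp

lemma cinner_diff_left: "cinner (x - y) z = cinner x z - cinner y z"
  using cinner_add_left[of x "- y" z] by (simp add: cinner_minus_left)

lemma cinner_diff_right: "cinner x (y - z) = cinner x y - cinner x z"
  using cinner_add_right[of x y "- z"] by (simp add: cinner_minus_right)

lemma cinner_sum_left: "cinner (\<Sum>i\<in>A. f i) y = (\<Sum>i\<in>A. cinner (f i) y)"
  by (induction A rule: infinite_finite_induct) (auto simp: cinner_add_left)

lemma cinner_sum_right: "cinner y (\<Sum>i\<in>A. f i) = (\<Sum>i\<in>A. cinner y (f i))"
  by (induction A rule: infinite_finite_induct) (auto simp: cinner_add_right)

lemmas cinner_simps = cinner_add_left cinner_add_right cinner_diff_left cinner_diff_right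
  cinner_scaleC_left cinner_scaleC_right cinner_scaleR_left cinner_scaleR_right
  cinner_minus_left cinner_minus_right

lemma Re_cinner_commute: "Re (cinner x y) = Re (cinner y x)"
  by (subst cinner_commute) simp

lemma Re_cinner_self: "Re (cinner x x) = (norm x)\<^sup>2"
  by (simp add: cinner_self)

lemma scaleC_zero_right [simp]: "c *\<^sub>C 0 = 0"
  using scaleC_add_right[of c 0 0] by simp

lemma scaleC_zero_left [simp]: "0 *\<^sub>C x = 0"
  using scaleR_scaleC[of 0 x] by simp

lemma scaleC_one [simp]: "1 *\<^sub>C x = x"
  using scaleR_scaleC[of 1 x] by simp

lemma scaleC_minus_left: "(- c) *\<^sub>C x = - (c *\<^sub>C x)"
  using scaleC_add_left[of c "- c" x] by (simp add: minus_unique)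

lemma scaleC_minus_right: "c *\<^sub>C (- x) = - (c *\<^sub>C x)"
  using scaleC_add_right[of c x "- x"] by (simp add: minus_unique)

lemma scaleC_diff_right: "c *\<^sub>C (x - y) = c *\<^sub>C x - c *\<^sub>C y"
  using scaleC_add_right[of c x "- y"] by (simp add: scaleC_minus_right)

lemma scaleC_sum_right: "c *\<^sub>C (\<Sum>i\<in>A. f i) = (\<Sum>i\<in>A. c *\<^sub>C f i)"
  by (induction A rule: infinite_finite_induct) (auto simp: scaleC_add_right)

lemma scaleC_sum_left: "(\<Sum>i\<in>A. c i) *\<^sub>C x = (\<Sum>i\<in>A. c i *\<^sub>C x)"
  by (induction A rule: infinite_finite_induct) (auto simp: scaleC_add_left)

lemma norm_add_sq: "(norm (x + y))\<^sup>2 = (norm x)\<^sup>2 + (norm y)\<^sup>2 + 2 * Re (cinner x y)"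
proof -
  have "(norm (x + y))\<^sup>2 = Re (cinner (x + y) (x + y))"
    by (simp only: Re_cinner_self)
  also have "\<dots> = Re (cinner x x) + Re (cinner y y) + Re (cinner x y) + Re (cinner y x)"
    by (simp add: cinner_simps)
  finally show ?thesis
    using Re_cinner_commute[of x y] by (simp add: Re_cinner_self)
qed

lemma norm_diff_sq: "(norm (x - y))\<^sup>2 = (norm x)\<^sup>2 + (norm y)\<^sup>2 - 2 * Re (cinner x y)"
  using norm_add_sq[of x "- y"] by (simp add: cinner_minus_right)

lemma norm_scaleC: "norm (c *\<^sub>C x) = cmod c * norm x"
proof -
  have "complex_of_real ((norm (c *\<^sub>C x))\<^sup>2) = c * cnj c * complex_of_real ((norm x)\<^sup>2)"
    by (simp only: flip: cinner_self) (simp add: cinner_simps)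
  also have "\<dots> = complex_of_real ((cmod c * norm x)\<^sup>2)"
    by (simp only: complex_norm_square[symmetric] power_mult_distrib of_real_mult)
  finally have "(norm (c *\<^sub>C x))\<^sup>2 = (cmod c * norm x)\<^sup>2"
    by (simp only: of_real_eq_iff)
  then show ?thesis
    by (simp add: power2_eq_iff_nonneg)
qed

lemma cinner_Cauchy_Schwarz: "cmod (cinner x y) \<le> norm x * norm y"
proof (cases "y = 0")
  case False
  define c where "c = cinner x y / complex_of_real ((norm y)\<^sup>2)"
  have ny: "norm y > 0"
    using False by simp
  have "0 \<le> (norm (x - c *\<^sub>C y))\<^sup>2"
    by simp
  also have "\<dots> = (norm x)\<^sup>2 + (cmod c * norm y)\<^sup>2 - 2 * Re (cnj c * cinner x y)"
    by (simp add: norm_diff_sq norm_scaleC cinner_scaleC_right)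
  also have "cnj c * cinner x y = complex_of_real ((cmod (cinner x y))\<^sup>2 / (norm y)\<^sup>2)"
    by (simp add: c_def mult.commute flip: complex_norm_square)
  also have "(cmod c * norm y)\<^sup>2 = (cmod (cinner x y))\<^sup>2 / (norm y)\<^sup>2"
    using ny by (simp add: c_def norm_divide norm_power power_mult_distrib power_divide)
      (simp add: field_simps power2_eq_square power4_eq_xxxx)
  finally have "(cmod (cinner x y))\<^sup>2 / (norm y)\<^sup>2 \<le> (norm x)\<^sup>2"
    by simp
  then have "(cmod (cinner x y))\<^sup>2 \<le> (norm x * norm y)\<^sup>2"
    using ny by (simp add: divide_simps power_mult_distrib)
  then show ?thesis
    by (meson norm_ge_zero mult_nonneg_nonneg power2_le_imp_le)
qed simp

lemma Re_cinner_le: "\<bar>Re (cinner x y)\<bar> \<le> norm x * norm y"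
  using abs_Re_le_cmod cinner_Cauchy_Schwarz order_trans by blast

lemma Re_cinner_all_zero:
  assumes "\<And>y. Re (cinner x y) = 0"
  shows "x = 0"
  using assms[of x] by (simp add: Re_cinner_self)

lemma Re_cinner_eqI:
  assumes "\<And>z. Re (cinner x z) = Re (cinner y z)"
  shows "x = y"
  using Re_cinner_all_zero[of "x - y"] assms by (simp add: cinner_diff_left)

text \<open>The vector is obtained by minimising \<open>\<parallel>y\<parallel>\<^sup>2 - 2 b y\<close>; minimising sequences are Cauchy by
  the parallelogram law.\<close>

lemma riesz_representation:
  fixes b :: "'h::complex_hilbert \<Rightarrow> real"
  assumes add: "\<And>x y. b (x + y) = b x + b y"
    and scale: "\<And>r x. b (r *\<^sub>R x) = r * b x"
    and bound: "\<And>x. \<bar>b x\<bar> \<le> K * norm x"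
  shows "\<exists>z. \<forall>y. b y = Re (cinner z y)"
proof -
  interpret b: bounded_linear b
    using assms by (intro bounded_linear_intro[of b K]) (auto simp: mult.commute)
  define J where "J y = (norm y)\<^sup>2 - 2 * b y" for y
  define m where "m = (INF y. J y)"
  have lower: "- K\<^sup>2 \<le> J y" for y
  proof -
    have "0 \<le> (norm y - K)\<^sup>2"
      by simp
    then show ?thesis
      using bound[of y] unfolding J_def power2_diff by (simp add: mult.commute)
  qed
  then have bdd: "bdd_below (range J)"
    by (intro bdd_belowI2) auto
  have m_le: "m \<le> J y" for y
    unfolding m_def using bdd by (rule cINF_lower) simp
  have "\<exists>y. J y < m + 1 / real (Suc n)" for n
  proof -
    have "m < m + 1 / real (Suc n)"
      by simp
    then show ?thesis
      unfolding m_def using cINF_less_iff[OF _ bdd] by blast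
  qed
  then obtain Y where Y: "J (Y n) < m + 1 / real (Suc n)" for n
    by metis
  have dist_sq: "(norm (y - z))\<^sup>2 \<le> 2 * (J y - m) + 2 * (J z - m)" for y z
  proof -
    have "4 * m \<le> 4 * J ((1/2) *\<^sub>R (y + z))"
      using m_le by simp
    also have "\<dots> = (norm (y + z))\<^sup>2 - 4 * (b y + b z)"
      unfolding J_def scale add norm_scaleR power_mult_distrib by (simp add: power_divide field_simps)
    also have "\<dots> = 2 * J y + 2 * J z - (norm (y - z))\<^sup>2"
      unfolding J_def norm_add_sq norm_diff_sq by simp
    finally show ?thesis
      by simp
  qed
  have "Cauchy Y"
  proof (rule metric_CauchyI)
    fix e :: real assume "e > 0"
    then obtain N where N: "1 / real (Suc N) < e\<^sup>2 / 4"
      using nat_approx_posE[of "e\<^sup>2 / 4"] by auto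
    have "dist (Y i) (Y j) < e" if "i \<ge> N" "j \<ge> N" for i j
    proof -
      have *: "J (Y k) - m < e\<^sup>2 / 4" if "k \<ge> N" for k
      proof -
        have "1 / real (Suc k) \<le> 1 / real (Suc N)"
          using that by (simp add: frac_le)
        then show ?thesis
          using Y[of k] N by simp
      qed
      have "(norm (Y i - Y j))\<^sup>2 < e\<^sup>2"
        using dist_sq[of "Y i" "Y j"] *[OF that(1)] *[OF that(2)] by simp
      then show ?thesis
        using \<open>e > 0\<close> by (simp add: dist_norm power_less_imp_less_base)
    qed
    then show "\<exists>M. \<forall>i\<ge>M. \<forall>j\<ge>M. dist (Y i) (Y j) < e"
      by blast
  qed
  then obtain z where z: "Y \<longlonglongrightarrow> z"
    using Cauchy_convergent convergent_def by blast
  have "(\<lambda>n. J (Y n)) \<longlonglongrightarrow> J z"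
    unfolding J_def by (intro tendsto_intros z b.tendsto)
  moreover have "(\<lambda>n. m + 1 / real (Suc n)) \<longlonglongrightarrow> m + 0"
    by (intro tendsto_intros LIMSEQ_Suc[OF lim_1_over_n])
  ultimately have Jz: "J z \<le> m"
    using Y by (intro LIMSEQ_le[of "\<lambda>n. J (Y n)" _ "\<lambda>n. m + 1 / real (Suc n)"])
      (auto intro: less_imp_le)
  have "b y = Re (cinner z y)" for y
  proof (rule ccontr)
    define a where "a = Re (cinner z y) - b y"
    assume "b y \<noteq> Re (cinner z y)"
    then have "a \<noteq> 0"
      by (simp add: a_def)
    have *: "0 \<le> t\<^sup>2 * (norm y)\<^sup>2 + 2 * t * a" for t
    proof -
      have "J z \<le> J (z + t *\<^sub>R y)"
        using Jz m_le order_trans by blast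
      then show ?thesis
        unfolding J_def a_def norm_add_sq
        by (simp add: add scale cinner_scaleR_right power_mult_distrib algebra_simps)
    qed
    \<comment> \<open>The added 1 keeps \<open>s\<close> positive even for \<open>y = 0\<close>. The
      value \<open>t = - a / s\<close> nearly minimises the quadratic in \<open>t\<close> and makes
      it negative.\<close>
    define s where "s = (norm y)\<^sup>2 + 1"
    have s: "s > 0"
      by (simp add: s_def add_nonneg_pos)
    have "0 \<le> (- a / s)\<^sup>2 * s + 2 * (- a / s) * a - (a / s)\<^sup>2"
      using *[of "- a / s"] by (simp add: s_def algebra_simps)
    also have "\<dots> = - (a\<^sup>2 / s) - (a / s)\<^sup>2"
      using s by (simp add: field_simps power2_eq_square)
    also have "\<dots> < 0"
      using s \<open>a \<noteq> 0\<close> by (smt (verit) divide_pos_pos zero_less_power2 zero_le_power2)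
    finally show False
      by simp
  qed
  then show ?thesis
    by blast
qed

section \<open>Sublinear functionals\<close>

text \<open>Vector spaces are realised as sets of real functions on an arbitrary set, so that one
  separation theorem serves functions on the sphere as well as functions of an index and a
  contraction.\<close>

definition function_subspace :: "('a \<Rightarrow> real) set \<Rightarrow> bool" where
  "function_subspace X \<longleftrightarrow> (\<lambda>x. 0) \<in> X \<and> (\<forall>f\<in>X. \<forall>g\<in>X. (\<lambda>x. f x + g x) \<in> X) \<and>
     (\<forall>c. \<forall>f\<in>X. (\<lambda>x. c * f x) \<in> X)"

definition sublinear_on :: "('a \<Rightarrow> real) set \<Rightarrow> (('a \<Rightarrow> real) \<Rightarrow> real) \<Rightarrow> bool" where
  "sublinear_on X p \<longleftrightarrow> (\<forall>f\<in>X. \<forall>g\<in>X. p (\<lambda>x. f x + g x) \<le> p f + p g) \<and>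
     (\<forall>c\<ge>0. \<forall>f\<in>X. p (\<lambda>x. c * f x) = c * p f)"

definition linear_functional_on :: "('a \<Rightarrow> real) set \<Rightarrow> (('a \<Rightarrow> real) \<Rightarrow> real) \<Rightarrow> bool" where
  "linear_functional_on X l \<longleftrightarrow> (\<forall>f\<in>X. \<forall>g\<in>X. l (\<lambda>x. f x + g x) = l f + l g) \<and>
     (\<forall>c. \<forall>f\<in>X. l (\<lambda>x. c * f x) = c * l f)"

lemma function_subspaceD:
  assumes "function_subspace X"
  shows "(\<lambda>x. 0) \<in> X"
    and "f \<in> X \<Longrightarrow> g \<in> X \<Longrightarrow> (\<lambda>x. f x + g x) \<in> X"
    and "f \<in> X \<Longrightarrow> (\<lambda>x. c * f x) \<in> X"
    and "f \<in> X \<Longrightarrow> (\<lambda>x. - f x) \<in> X"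
    and "f \<in> X \<Longrightarrow> g \<in> X \<Longrightarrow> (\<lambda>x. f x - g x) \<in> X"
proof -
  show "(\<lambda>x. 0) \<in> X"
    and add: "f \<in> X \<Longrightarrow> g \<in> X \<Longrightarrow> (\<lambda>x. f x + g x) \<in> X"
    and scale: "f \<in> X \<Longrightarrow> (\<lambda>x. c * f x) \<in> X" for f g c
    using assms by (auto simp: function_subspace_def)
  show minus: "f \<in> X \<Longrightarrow> (\<lambda>x. - f x) \<in> X" for f
    using scale[of f "-1"] by simp
  show "f \<in> X \<Longrightarrow> g \<in> X \<Longrightarrow> (\<lambda>x. f x - g x) \<in> X"
    using add[of f "\<lambda>x. - g x"] minus[of g] by simp
qed

lemma sublinear_onD:
  assumes "sublinear_on X p"
  shows "f \<in> X \<Longrightarrow> g \<in> X \<Longrightarrow> p (\<lambda>x. f x + g x) \<le> p f + p g"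
    and "c \<ge> 0 \<Longrightarrow> f \<in> X \<Longrightarrow> p (\<lambda>x. c * f x) = c * p f"
  using assms by (auto simp: sublinear_on_def)

lemma linear_functional_onD:
  assumes "linear_functional_on X l"
  shows "f \<in> X \<Longrightarrow> g \<in> X \<Longrightarrow> l (\<lambda>x. f x + g x) = l f + l g"
    and "f \<in> X \<Longrightarrow> l (\<lambda>x. c * f x) = c * l f"
  using assms by (auto simp: linear_functional_on_def)

lemma sublinear_on_zero:
  assumes "function_subspace X" "sublinear_on X p"
  shows "p (\<lambda>x. 0) = 0"
  using sublinear_onD(2)[OF assms(2), of 0 "\<lambda>x. 0"] function_subspaceD(1)[OF assms(1)] by simp

lemma sublinear_on_minus:
  assumes X: "function_subspace X" and p: "sublinear_on X p" and f: "f \<in> X"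
  shows "- p (\<lambda>x. - f x) \<le> p f"
  using sublinear_onD(1)[OF p f function_subspaceD(4)[OF X f]] sublinear_on_zero[OF X p] by simp

text \<open>The infimum over shifts along \<open>h\<close> pushes \<open>q\<close> down at
  \<open>- h\<close>: the parameter \<open>t = 0\<close> gives domination by \<open>q\<close>, and
  \<open>t = 1\<close> gives the bound at \<open>- h\<close>. Subadditivity survives because
  parameters \<open>t\<close> and \<open>u\<close> of two functions combine to
  \<open>t + u\<close>.\<close>

lemma sublinear_shift:
  assumes X: "function_subspace X" and q: "sublinear_on X q" and h: "h \<in> X"
  defines "s \<equiv> \<lambda>f. INF t\<in>{0..}. q (\<lambda>x. f x + t * h x) - t * q h"
  shows "sublinear_on X s"
    and "f \<in> X \<Longrightarrow> s f \<le> q f"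
    and "s (\<lambda>x. - h x) \<le> - q h"
proof -
  let ?e = "\<lambda>f t. q (\<lambda>x. f x + t * h x) - t * q h"
  note Xc = function_subspaceD[OF X]
  \<comment> \<open>A real \<open>INF\<close> carries information only for sets bounded below;
    subadditivity supplies the bound.\<close>
  have lower: "- q (\<lambda>x. - f x) \<le> ?e f t" if "f \<in> X" "t \<ge> 0" for f t
  proof -
    have "q (\<lambda>x. t * h x) \<le> q (\<lambda>x. f x + t * h x) + q (\<lambda>x. - f x)"
      using sublinear_onD(1)[OF q, of "\<lambda>x. f x + t * h x" "\<lambda>x. - f x"] that h Xc by simp
    then show ?thesis
      using sublinear_onD(2)[OF q that(2) h] by simp
  qed
  have bdd: "bdd_below (?e f ` {0..})" if "f \<in> X" for f
    using lower[OF that] by (intro bdd_belowI2) auto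
  have le: "s f \<le> ?e f t" if "f \<in> X" "t \<ge> 0" for f t
    unfolding s_def using bdd[OF that(1)] by (rule cINF_lower) (use that in simp)
  have ge: "c \<le> s f" if "\<And>t. t \<ge> 0 \<Longrightarrow> c \<le> ?e f t" for c f
    unfolding s_def using that by (intro cINF_greatest) auto
  show "s f \<le> q f" if "f \<in> X" for f
    using le[OF that, of 0] by simp
  have "q (\<lambda>x. 0) = 0"
    using X q by (rule sublinear_on_zero)
  then show "s (\<lambda>x. - h x) \<le> - q h"
    using le[of "\<lambda>x. - h x" 1] Xc(4)[OF h] by simp
  show "sublinear_on X s"
    unfolding sublinear_on_def
  proof (intro conjI ballI allI impI)
    fix f g assume fg: "f \<in> X" "g \<in> X"
    have "s (\<lambda>x. f x + g x) - ?e f t \<le> s g" if "t \<ge> 0" for t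
    proof (rule ge)
      fix u :: real assume "u \<ge> 0"
      have "s (\<lambda>x. f x + g x) \<le> ?e (\<lambda>x. f x + g x) (t + u)"
        using fg Xc that \<open>u \<ge> 0\<close> by (intro le) auto
      also have "(\<lambda>x. f x + g x + (t + u) * h x) = (\<lambda>x. (f x + t * h x) + (g x + u * h x))"
        by (simp add: algebra_simps)
      also have "q \<dots> \<le> q (\<lambda>x. f x + t * h x) + q (\<lambda>x. g x + u * h x)"
        using fg h Xc by (intro sublinear_onD(1)[OF q]) auto
      finally show "s (\<lambda>x. f x + g x) - ?e f t \<le> ?e g u"
        by (simp add: algebra_simps)
    qed
    then have "s (\<lambda>x. f x + g x) - s g \<le> s f"
      by (intro ge) (simp add: algebra_simps)
    then show "s (\<lambda>x. f x + g x) \<le> s f + s g"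
      by simp
  next
    fix c :: real and f assume c: "c \<ge> 0" and f: "f \<in> X"
    show "s (\<lambda>x. c * f x) = c * s f"
    proof (cases "c = 0")
      case True
      have "?e (\<lambda>x. 0) t = 0" if "t \<ge> 0" for t
        using sublinear_onD(2)[OF q that h] by simp
      then have "s (\<lambda>x. 0) = 0"
        unfolding s_def by (simp cong: INF_cong_simp)
      then show ?thesis
        using True by simp
    next
      case False
      then have c: "c > 0"
        using c by simp
      have e: "?e (\<lambda>x. c * f x) (c * t) = c * ?e f t" if "t \<ge> 0" for t
      proof -
        have "q (\<lambda>x. c * (f x + t * h x)) = c * q (\<lambda>x. f x + t * h x)"
          using f h Xc c by (intro sublinear_onD(2)[OF q]) auto
        then show ?thesis
          by (simp add: algebra_simps)
      qed
      have "s (\<lambda>x. c * f x) / c \<le> s f"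
      proof (rule ge)
        fix t :: real assume t: "t \<ge> 0"
        have "s (\<lambda>x. c * f x) \<le> ?e (\<lambda>x. c * f x) (c * t)"
          using f Xc c t by (intro le) auto
        then show "s (\<lambda>x. c * f x) / c \<le> ?e f t"
          unfolding e[OF t] using c by (simp add: field_simps)
      qed
      moreover have "c * s f \<le> s (\<lambda>x. c * f x)"
      proof (rule ge)
        fix t :: real assume t: "t \<ge> 0"
        have "c * s f \<le> c * ?e f (t / c)"
          using le[OF f, of "t / c"] c t by simp
        also have "\<dots> = ?e (\<lambda>x. c * f x) t"
          using e[of "t / c"] c t by simp
        finally show "c * s f \<le> ?e (\<lambda>x. c * f x) t" .
      qed
      ultimately show ?thesis
        using c by (simp add: field_simps)
    qed
  qed
qed

text \<open>A minimal sublinear functional below \<open>p\<close> is linear: otherwise \<open>sublinear_shift\<close> would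
  produce a smaller one.\<close>

theorem hahn_banach:
  assumes X: "function_subspace X" and p: "sublinear_on X p"
  shows "\<exists>l. linear_functional_on X l \<and> (\<forall>f\<in>X. l f \<le> p f)"
proof -
  note Xc = function_subspaceD[OF X]
  \<comment> \<open>Values outside \<open>X\<close> are frozen at 0, so that the pointwise order of
    total functions compares the functionals on \<open>X\<close> and nothing else.\<close>
  define Q where "Q = {q. sublinear_on X q \<and> (\<forall>f\<in>X. q f \<le> p f) \<and> (\<forall>f. f \<notin> X \<longrightarrow> q f = 0)}"
  define restr where "restr q = (\<lambda>f. if f \<in> X then q f else 0)" for q :: "('a \<Rightarrow> real) \<Rightarrow> real"
  have restr: "restr q \<in> Q" if "sublinear_on X q" "\<And>f. f \<in> X \<Longrightarrow> q f \<le> p f" for q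
    using that Xc unfolding Q_def sublinear_on_def restr_def by auto
  have "\<exists>m\<in>Q. \<forall>q\<in>Q. q \<le> m \<longrightarrow> q = m"
  proof (rule predicate_Zorn)
    show "partial_order_on Q (relation_of (\<lambda>q r. r \<le> q) Q)"
      by (rule partial_order_on_relation_ofI) auto
    fix C assume "C \<in> Chains (relation_of (\<lambda>q r. r \<le> q) Q)"
    then have CQ: "C \<subseteq> Q" and chain: "\<And>q r. q \<in> C \<Longrightarrow> r \<in> C \<Longrightarrow> q \<le> r \<or> r \<le> q"
      by (auto simp: Chains_def relation_of_def)
    show "\<exists>u\<in>Q. \<forall>q\<in>C. u \<le> q"
    proof (cases "C = {}")
      case True
      then show ?thesis
        using restr[OF p] by auto
    next
      case False
      define u where "u f = (INF q\<in>C. q f)" for f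
      have sub: "sublinear_on X q" and le_p: "f \<in> X \<Longrightarrow> q f \<le> p f"
        and out: "f \<notin> X \<Longrightarrow> q f = 0" if "q \<in> C" for q f
        using CQ that by (auto simp: Q_def)
      have bdd: "bdd_below ((\<lambda>q. q f) ` C)" if "f \<in> X" for f
      proof (rule bdd_belowI2)
        fix q assume "q \<in> C"
        then show "- p (\<lambda>x. - f x) \<le> q f"
          using sublinear_on_minus[OF X sub that] le_p[OF _ Xc(4)[OF that]] by fastforce
      qed
      have u_le: "u f \<le> q f" if "q \<in> C" "f \<in> X" for q f
        unfolding u_def using bdd[OF that(2)] that(1) by (rule cINF_lower)
      have u_ge: "c \<le> u f" if "\<And>q. q \<in> C \<Longrightarrow> c \<le> q f" for c f
        unfolding u_def using False that by (intro cINF_greatest)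
      have "sublinear_on X u"
        unfolding sublinear_on_def
      proof (intro conjI ballI allI impI)
        fix f g assume fg: "f \<in> X" "g \<in> X"
        have "u (\<lambda>x. f x + g x) - q f \<le> u g" if "q \<in> C" for q
        proof (rule u_ge)
          fix r assume "r \<in> C"
          \<comment> \<open>A common lower bound of two chain members turns two infima into one,
            which is what subadditivity of \<open>u\<close> needs.\<close>
          obtain k where k: "k \<in> C" "k \<le> q" "k \<le> r"
            using chain[OF \<open>q \<in> C\<close> \<open>r \<in> C\<close>] \<open>q \<in> C\<close> \<open>r \<in> C\<close> by auto
          have "u (\<lambda>x. f x + g x) \<le> k (\<lambda>x. f x + g x)"
            using k(1) fg Xc by (intro u_le) auto
          also have "\<dots> \<le> k f + k g"
            using sublinear_onD(1)[OF sub[OF k(1)] fg] .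
          also have "\<dots> \<le> q f + r g"
            using k by (auto simp: le_fun_def intro: add_mono)
          finally show "u (\<lambda>x. f x + g x) - q f \<le> r g"
            by simp
        qed
        then have "u (\<lambda>x. f x + g x) - u g \<le> u f"
          by (intro u_ge) (simp add: algebra_simps)
        then show "u (\<lambda>x. f x + g x) \<le> u f + u g"
          by simp
      next
        fix c :: real and f assume c: "c \<ge> 0" and f: "f \<in> X"
        have eq: "q (\<lambda>x. c * f x) = c * q f" if "q \<in> C" for q
          using sublinear_onD(2)[OF sub[OF that] c f] .
        show "u (\<lambda>x. c * f x) = c * u f"
        proof (cases "c = 0")
          case True
          then show ?thesis
            using eq False unfolding u_def by (subst INF_cong[OF refl, of _ _ "\<lambda>_. 0"]) auto
        next
          case False
          have "u (\<lambda>x. c * f x) / c \<le> u f"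
            using u_le[OF _ Xc(3)[OF f, of c]] eq False c
            by (intro u_ge) (simp add: field_simps)
          moreover have "c * u f \<le> u (\<lambda>x. c * f x)"
            using u_le[OF _ f] c by (intro u_ge) (simp only: eq mult_left_mono)
          ultimately show ?thesis
            using False c by (simp add: field_simps)
        qed
      qed
      moreover have "u f \<le> p f" if "f \<in> X" for f
        using False u_le[OF _ that] le_p[OF _ that] order_trans by blast
      ultimately have "restr u \<in> Q"
        by (rule restr)
      moreover have "restr u \<le> q" if "q \<in> C" for q
        using u_le[OF that] out[OF that] by (simp add: le_fun_def restr_def)
      ultimately show ?thesis
        by blast
    qed
  qed
  then obtain q where q: "q \<in> Q" and min: "\<And>r. r \<in> Q \<Longrightarrow> r \<le> q \<Longrightarrow> r = q"
    by blast
  have sub: "sublinear_on X q" and le_p: "\<And>f. f \<in> X \<Longrightarrow> q f \<le> p f"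
    and out: "\<And>f. f \<notin> X \<Longrightarrow> q f = 0"
    using q by (auto simp: Q_def)
  \<comment> \<open>Oddness is the whole point: applied to \<open>- f\<close> and
    \<open>- g\<close>, it reverses the subadditive inequality.\<close>
  have minus: "q (\<lambda>x. - h x) = - q h" if h: "h \<in> X" for h
  proof -
    define s where "s = (\<lambda>f. INF t\<in>{0..}. q (\<lambda>x. f x + t * h x) - t * q h)"
    have s: "sublinear_on X s" "\<And>f. f \<in> X \<Longrightarrow> s f \<le> q f" "s (\<lambda>x. - h x) \<le> - q h"
      using sublinear_shift[OF X sub h] by (auto simp: s_def)
    have "restr s \<in> Q"
      using restr[OF s(1)] s(2) le_p order_trans by blast
    moreover have "restr s \<le> q"
      using s(2) out by (simp add: le_fun_def restr_def)
    ultimately have "restr s = q"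
      by (rule min)
    then have "q (\<lambda>x. - h x) \<le> - q h"
      using s(3) Xc(4)[OF h] by (metis restr_def)
    then show ?thesis
      using sublinear_on_minus[OF X sub h] by simp
  qed
  have "linear_functional_on X q"
    unfolding linear_functional_on_def
  proof (intro conjI ballI allI)
    fix f g assume fg: "f \<in> X" "g \<in> X"
    have "q (\<lambda>x. - f x + - g x) \<le> q (\<lambda>x. - f x) + q (\<lambda>x. - g x)"
      using fg Xc by (intro sublinear_onD(1)[OF sub]) auto
    then have "q f + q g \<le> q (\<lambda>x. f x + g x)"
      using minus[OF fg(1)] minus[OF fg(2)] minus[OF Xc(2)[OF fg]] by simp
    then show "q (\<lambda>x. f x + g x) = q f + q g"
      using sublinear_onD(1)[OF sub fg] by simp
  next
    fix c :: real and f assume f: "f \<in> X"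
    show "q (\<lambda>x. c * f x) = c * q f"
    proof (cases "c \<ge> 0")
      case True
      then show ?thesis
        using sublinear_onD(2)[OF sub _ f] by simp
    next
      case False
      then show ?thesis
        using sublinear_onD(2)[OF sub _ f, of "- c"] minus[OF Xc(3)[OF f, of "c"]] by simp
    qed
  qed
  then show ?thesis
    using le_p by blast
qed

section \<open>Bounded operators\<close>

lemma bounded_operatorsD:
  assumes "T \<in> bounded_operators"
  shows "T (x + y) = T x + T y" "T (c *\<^sub>C x) = c *\<^sub>C T x" "T (r *\<^sub>R x) = r *\<^sub>R T x"
    "T (x - y) = T x - T y" "T 0 = 0" "T (\<Sum>i\<in>A. f i) = (\<Sum>i\<in>A. T (f i))"
    "norm (T x) \<le> onorm T * norm x"
proof -
  have T: "bounded_linear T"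
    using assms by (simp add: bounded_operators_def)
  then interpret bounded_linear T .
  show "T (x + y) = T x + T y" "T (r *\<^sub>R x) = r *\<^sub>R T x" "T (x - y) = T x - T y" "T 0 = 0"
    "T (\<Sum>i\<in>A. f i) = (\<Sum>i\<in>A. T (f i))"
    by (simp_all add: add scale diff zero sum)
  show "T (c *\<^sub>C x) = c *\<^sub>C T x"
    using assms by (simp add: bounded_operators_def)
  show "norm (T x) \<le> onorm T * norm x"
    by (rule onorm[OF T])
qed

lemma bounded_operatorsI:
  assumes "\<And>x y. T (x + y) = T x + T y" "\<And>c x. T (c *\<^sub>C x) = c *\<^sub>C T x"
    "\<And>x. norm (T x) \<le> K * norm x"
  shows "T \<in> bounded_operators"
  unfolding bounded_operators_def
  using assms by (auto intro!: bounded_linear_intro[of T K] simp: scaleR_scaleC mult.commute)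

text \<open>The unit ball of the bounded operators. Since it is closed under multiplication by
  phases, a bound on the real part of a functional over this set is a bound on its norm, here the
  trace norm.\<close>

definition contractions :: "('h::complex_hilbert \<Rightarrow> 'h) set" where
  "contractions = {T \<in> bounded_operators. \<forall>x. norm (T x) \<le> norm x}"

lemma contractionsI:
  assumes "\<And>x y. T (x + y) = T x + T y" "\<And>c x. T (c *\<^sub>C x) = c *\<^sub>C T x"
    "\<And>x. norm (T x) \<le> norm x"
  shows "T \<in> contractions"
  using bounded_operatorsI[of T 1] assms by (simp add: contractions_def)

lemma contractionsD:
  assumes "T \<in> contractions"
  shows "T \<in> bounded_operators" "norm (T x) \<le> norm x"
  using assms by (auto simp: contractions_def)

section \<open>Tuples of vectors\<close>

text \<open>A tuple \<open>v\<close> is read as the linear map from C^n to the Hilbert space that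
  sends the basis vectors to the \<open>v j\<close>; this is its value at \<open>c\<close>.\<close>

definition comb :: "nat \<Rightarrow> (nat \<Rightarrow> complex) \<Rightarrow> (nat \<Rightarrow> 'h::complex_hilbert) \<Rightarrow> 'h" where
  "comb n c v = (\<Sum>j<n. c j *\<^sub>C v j)"

text \<open>The normal functional of the positive finite-rank operator \<open>\<Sum>j<n. |v j\<rangle>\<langle>v j|\<close>.\<close>

definition tuple_form ::
  "nat \<Rightarrow> (nat \<Rightarrow> 'h::complex_hilbert) \<Rightarrow> ('h \<Rightarrow> 'h) \<Rightarrow> complex" where
  "tuple_form n v T = (\<Sum>j<n. cinner (T (v j)) (v j))"

text \<open>The squared Hilbert--Schmidt norm of the linear map given by \<open>v\<close>, which is
  also the trace of the operator behind \<open>tuple_form\<close>.\<close>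

definition tuple_sq :: "nat \<Rightarrow> (nat \<Rightarrow> 'h::complex_hilbert) \<Rightarrow> real" where
  "tuple_sq n v = (\<Sum>j<n. (norm (v j))\<^sup>2)"

lemma tuple_sq_nonneg: "0 \<le> tuple_sq n v"
  by (simp add: tuple_sq_def sum_nonneg)

lemma tuple_sq_eq_form: "complex_of_real (tuple_sq n v) = tuple_form n v id"
  by (simp add: tuple_sq_def tuple_form_def cinner_self)

lemma comb_add_coeff: "comb n (\<lambda>j. c j + d j) v = comb n c v + comb n d v"
  by (simp add: comb_def scaleC_add_left sum.distrib)

lemma comb_scale_coeff: "comb n (\<lambda>j. a * c j) v = a *\<^sub>C comb n c v"
  by (simp add: comb_def scaleC_sum_right scaleC_scaleC)

lemma comb_add: "comb n c (\<lambda>j. v j + w j) = comb n c v + comb n c w"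
  by (simp add: comb_def scaleC_add_right sum.distrib)

lemma comb_diff: "comb n c (\<lambda>j. v j - w j) = comb n c v - comb n c w"
  by (simp add: comb_def scaleC_diff_right sum_subtractf)

lemma comb_sum_coeff: "comb n (\<lambda>j. \<Sum>k\<in>A. a k * c k j) v = (\<Sum>k\<in>A. a k *\<^sub>C comb n (c k) v)"
  unfolding comb_def scaleC_sum_left scaleC_sum_right scaleC_scaleC by (rule sum.swap)

lemma comb_unit: "i < n \<Longrightarrow> comb n (\<lambda>j. if j = i then 1 else 0) v = v i"
  by (simp add: comb_def if_distrib[of "\<lambda>c. c *\<^sub>C _"] cong: if_cong)

lemma comb_Suc_extend:
  "\<exists>d. comb n c v = comb (Suc n) d v"
  by (rule exI[of _ "\<lambda>j. if j < n then c j else 0"]) (simp add: comb_def)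

text \<open>Dependent vectors contribute nothing, so \<open>m\<close> may be smaller than
  \<open>n\<close>. That the \<open>e k\<close> are combinations of \<open>S\<close> is recorded
  because an operator will be defined by applying the same coefficients to a second tuple.\<close>

lemma gram_schmidt:
  fixes S :: "nat \<Rightarrow> 'h::complex_hilbert"
  shows "\<exists>(m::nat) e. (\<forall>k<m. \<exists>c. e k = comb n c S) \<and>
    (\<forall>k<m. \<forall>l<m. cinner (e k) (e l) = (if k = l then 1 else 0)) \<and>
    (\<forall>i<n. S i = (\<Sum>k<m. cinner (S i) (e k) *\<^sub>C e k))"
proof (induction n)
  case 0
  then show ?case
    by (rule exI[where x = "0::nat"]) simp
next
  case (Suc n)
  then obtain m :: nat and e where "(\<forall>k<m. \<exists>c. e k = comb n c S) \<and>
    (\<forall>k<m. \<forall>l<m. cinner (e k) (e l) = (if k = l then 1 else 0)) \<and>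
    (\<forall>i<n. S i = (\<Sum>k<m. cinner (S i) (e k) *\<^sub>C e k))"
    by (elim exE) (rule that)
  then have span: "\<And>k. k < m \<Longrightarrow> \<exists>c. e k = comb n c S"
    and orth: "\<And>k l. k < m \<Longrightarrow> l < m \<Longrightarrow> cinner (e k) (e l) = (if k = l then 1 else 0)"
    and exp: "\<And>i. i < n \<Longrightarrow> S i = (\<Sum>k<m. cinner (S i) (e k) *\<^sub>C e k)"
    by simp_all
  have span': "\<exists>c. e k = comb (Suc n) c S" if "k < m" for k
    using span[OF that] comb_Suc_extend by metis
  then obtain a where a: "\<And>k. k < m \<Longrightarrow> e k = comb (Suc n) (a k) S"
    by metis
  define r where "r = S n - (\<Sum>k<m. cinner (S n) (e k) *\<^sub>C e k)"
  have r_orth: "cinner r (e l) = 0" if "l < m" for l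
    using that by (simp add: r_def cinner_simps cinner_sum_left orth if_distrib cong: if_cong)
  show ?case
  proof (cases "r = 0")
    case True
    then have "\<forall>i<Suc n. S i = (\<Sum>k<m. cinner (S i) (e k) *\<^sub>C e k)"
      using exp by (auto simp: r_def less_Suc_eq)
    then show ?thesis
      using span' orth by blast
  next
    case False
    define s where "s = complex_of_real (inverse (norm r))"
    define e' where "e' = e(m := s *\<^sub>C r)"
    have r_comb: "r = comb (Suc n) (\<lambda>j. (if j = n then 1 else 0) + (\<Sum>k<m. - cinner (S n) (e k) * a k j)) S"
      by (simp only: comb_add_coeff comb_sum_coeff comb_unit lessI)
        (simp add: r_def a[symmetric] scaleC_minus_left sum_negf)
    have "\<exists>c. s *\<^sub>C r = comb (Suc n) c S"
      by (subst r_comb) (rule exI, rule comb_scale_coeff[symmetric])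
    then have 1: "\<exists>c. e' k = comb (Suc n) c S" if "k < Suc m" for k
      using span' that by (auto simp: e'_def less_Suc_eq)
    have s_r: "cinner (s *\<^sub>C r) (s *\<^sub>C r) = 1"
    proof -
      have "norm (s *\<^sub>C r) = 1"
        using False by (simp add: s_def norm_scaleC norm_inverse)
      then show ?thesis
        by (simp add: cinner_self)
    qed
    have r_orth': "cinner (e l) r = 0" if "l < m" for l
      using r_orth[OF that] cinner_commute[of "e l" r] by simp
    have 2: "cinner (e' k) (e' l) = (if k = l then 1 else 0)" if "k < Suc m" "l < Suc m" for k l
    proof (cases "k = m")
      case True
      then show ?thesis
        using that s_r r_orth by (auto simp: e'_def cinner_scaleC_left less_Suc_eq)
    next
      case False
      then show ?thesis
        using that orth r_orth' by (auto simp: e'_def cinner_scaleC_right less_Suc_eq)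
    qed
    have 3: "S i = (\<Sum>k<Suc m. cinner (S i) (e' k) *\<^sub>C e' k)" if "i < Suc n" for i
    proof (cases "i = n")
      case True
      have "cinner (S n) r = cinner r r"
        by (subst (2) r_def) (simp add: cinner_simps cinner_sum_left r_orth')
      then have "cinner (S n) (s *\<^sub>C r) *\<^sub>C s *\<^sub>C r = r"
        using False by (simp add: cinner_self s_def scaleC_scaleC cinner_simps power2_eq_square
            mult.assoc)
      then show ?thesis
        using True by (simp add: e'_def r_def)
    next
      case False
      then have i: "i < n"
        using that by simp
      have "cinner (S i) r = 0"
        by (subst exp[OF i]) (simp add: cinner_sum_left cinner_simps r_orth')
      then show ?thesis
        using exp[OF i] by (simp add: e'_def cinner_scaleC_right)
    qed
    show ?thesis
      using 1 2 3 by blast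
  qed
qed

text \<open>Domination makes the assignment of \<open>D i\<close> to \<open>S i\<close> well defined
  and contractive on the span of \<open>S\<close>; it is extended by 0 to the orthogonal complement.
  The symmetry \<open>herm\<close> says that this map is symmetric on the span, whence
  \<open>cinner (T (D i)) (S i)\<close> is the squared norm of the projection of \<open>D i\<close>
  to the span.\<close>

lemma dominated_tuple_contraction:
  fixes S D :: "nat \<Rightarrow> 'h::complex_hilbert"
  assumes dom: "\<And>c. norm (comb n c D) \<le> norm (comb n c S)"
    and herm: "\<And>i j. i < n \<Longrightarrow> j < n \<Longrightarrow> cinner (D i) (S j) = cinner (S i) (D j)"
  shows "\<exists>T\<in>contractions. (\<forall>i<n. T (S i) = D i) \<and> (\<forall>i<n. 0 \<le> Re (cinner (T (D i)) (S i)))"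
proof -
  obtain m :: nat and e where "(\<forall>k<m. \<exists>c. e k = comb n c S) \<and>
    (\<forall>k<m. \<forall>l<m. cinner (e k) (e l) = (if k = l then 1 else 0)) \<and>
    (\<forall>i<n. S i = (\<Sum>k<m. cinner (S i) (e k) *\<^sub>C e k))"
    using gram_schmidt[of n S] by (elim exE) (rule that)
  then have span: "\<And>k. k < m \<Longrightarrow> \<exists>c. e k = comb n c S"
    and orth: "\<And>k l. k < m \<Longrightarrow> l < m \<Longrightarrow> cinner (e k) (e l) = (if k = l then 1 else 0)"
    and exp: "\<And>i. i < n \<Longrightarrow> S i = (\<Sum>k<m. cinner (S i) (e k) *\<^sub>C e k)"
    by simp_all
  obtain a where a: "\<And>k. k < m \<Longrightarrow> e k = comb n (a k) S"
    using span by metis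
  \<comment> \<open>The combination \<open>a k\<close> of \<open>S\<close> that yields
    \<open>e k\<close> is applied to \<open>D\<close> instead, after the orthogonal projection
    \<open>P\<close>.\<close>
  define T where "T x = (\<Sum>k<m. cinner x (e k) *\<^sub>C comb n (a k) D)" for x
  define P where "P x = (\<Sum>k<m. cinner x (e k) *\<^sub>C e k)" for x
  have P_le: "norm (P x) \<le> norm x" for x
  proof -
    have "cinner (P x) (P x) = cinner x (P x)"
    proof -
      have "cinner (P x) (P x) = (\<Sum>k<m. cinner x (e k) * (\<Sum>l<m. cnj (cinner x (e l)) * cinner (e k) (e l)))"
        unfolding P_def cinner_sum_left cinner_sum_right cinner_simps sum_distrib_left
        by (subst sum.swap, intro sum.cong refl) (simp add: mult_ac)
      also have "\<dots> = (\<Sum>k<m. cinner x (e k) * cnj (cinner x (e k)))"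
        by (intro sum.cong refl) (simp add: orth if_distrib cong: if_cong)
      also have "\<dots> = cinner x (P x)"
        unfolding P_def by (simp add: cinner_sum_right cinner_simps mult.commute)
      finally show ?thesis .
    qed
    then have "(norm (P x))\<^sup>2 = Re (cinner x (P x))"
      using Re_cinner_self[of "P x"] by simp
    also have "\<dots> \<le> norm x * norm (P x)"
      using Re_cinner_le[of x "P x"] by simp
    finally show ?thesis
      by (cases "P x = 0") (simp_all add: power2_eq_square)
  qed
  have T_comb: "T x = comb n (\<lambda>j. \<Sum>k<m. cinner x (e k) * a k j) D" for x
    by (simp add: T_def comb_sum_coeff)
  have P_comb: "P x = comb n (\<lambda>j. \<Sum>k<m. cinner x (e k) * a k j) S" for x
    by (simp add: P_def comb_sum_coeff a)
  have "T \<in> contractions"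
  proof (rule contractionsI)
    show "norm (T x) \<le> norm x" for x
      using dom[of "\<lambda>j. \<Sum>k<m. cinner x (e k) * a k j"] P_le[of x] by (simp only: T_comb P_comb)
  qed (simp_all add: T_def cinner_simps scaleC_add_left sum.distrib scaleC_sum_right scaleC_scaleC)
  moreover have "T (S i) = D i" if i: "i < n" for i
  proof -
    \<comment> \<open>These coefficients express the trivial relation
      \<open>P (S i) - S i = 0\<close> in terms of \<open>S\<close>. Domination transfers every
      linear relation from \<open>S\<close> to \<open>D\<close>.\<close>
    let ?c = "\<lambda>j. (\<Sum>k<m. cinner (S i) (e k) * a k j) + (-1) * (if j = i then 1 else 0)"
    have "comb n ?c S = P (S i) + (-1) *\<^sub>C S i"
      by (simp only: comb_add_coeff comb_scale_coeff P_comb comb_unit[OF i])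
    also have "\<dots> = 0"
      using exp[OF i] by (simp add: P_def scaleC_minus_left)
    finally have "comb n ?c D = 0"
      using dom[of ?c] by simp
    then have "T (S i) + (-1) *\<^sub>C D i = 0"
      by (simp only: comb_add_coeff comb_scale_coeff T_comb comb_unit[OF i])
    then show ?thesis
      by (simp add: scaleC_minus_left)
  qed
  moreover have "0 \<le> Re (cinner (T (D i)) (S i))" if i: "i < n" for i
  proof -
    have "cinner (comb n (a k) D) (S i) = cinner (e k) (D i)" if "k < m" for k
      unfolding a[OF that] comb_def cinner_sum_left cinner_scaleC_left
      by (intro sum.cong refl) (simp add: herm i)
    then have "cinner (T (D i)) (S i) = (\<Sum>k<m. cinner (D i) (e k) * cnj (cinner (D i) (e k)))"
      unfolding T_def cinner_sum_left cinner_scaleC_left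
      by (intro sum.cong refl) (simp flip: cinner_commute)
    also have "\<dots> = complex_of_real (\<Sum>k<m. (cmod (cinner (D i) (e k)))\<^sup>2)"
      by (simp only: complex_norm_square of_real_sum)
    finally show ?thesis
      by (simp add: sum_nonneg)
  qed
  ultimately show ?thesis
    by blast
qed

section \<open>Unitary matrices acting on tuples\<close>

text \<open>Entries outside the \<open>n\<close> by \<open>n\<close> block are 0, so that equality
  of functions is equality of matrices. Requiring orthonormal rows and orthonormal columns makes
  closure under the adjoint immediate.\<close>

definition unitary_matrices :: "nat \<Rightarrow> (nat \<Rightarrow> nat \<Rightarrow> complex) set" where
  "unitary_matrices n = {U. (\<forall>i j. i \<ge> n \<or> j \<ge> n \<longrightarrow> U i j = 0) \<and>
     (\<forall>i<n. \<forall>j<n. (\<Sum>k<n. U i k * cnj (U j k)) = (if i = j then 1 else 0)) \<and>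
     (\<forall>i<n. \<forall>j<n. (\<Sum>k<n. cnj (U k i) * U k j) = (if i = j then 1 else 0))}"

definition matrix_mult ::
  "nat \<Rightarrow> (nat \<Rightarrow> nat \<Rightarrow> complex) \<Rightarrow> (nat \<Rightarrow> nat \<Rightarrow> complex) \<Rightarrow> nat \<Rightarrow> nat \<Rightarrow> complex" where
  "matrix_mult n A B = (\<lambda>i j. if i < n \<and> j < n then \<Sum>k<n. A i k * B k j else 0)"

definition matrix_one :: "nat \<Rightarrow> nat \<Rightarrow> nat \<Rightarrow> complex" where
  "matrix_one n = (\<lambda>i j. if i < n \<and> j = i then 1 else 0)"

text \<open>Composition of the linear map \<open>v\<close> with the matrix \<open>U\<close> on the
  right. The product of \<open>v\<close> with its adjoint, the operator behind
  \<open>tuple_form\<close>, does not see \<open>U\<close>, and operators acting on the entries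
  commute with the rotation.\<close>

definition rotate_tuple :: "nat \<Rightarrow> (nat \<Rightarrow> 'h::complex_hilbert) \<Rightarrow> (nat \<Rightarrow> nat \<Rightarrow> complex) \<Rightarrow> nat \<Rightarrow> 'h" where
  "rotate_tuple n v U = (\<lambda>i. comb n (\<lambda>j. U j i) v)"

definition matrix_group :: "nat \<Rightarrow> (nat \<Rightarrow> nat \<Rightarrow> complex) monoid" where
  "matrix_group n = \<lparr>carrier = unitary_matrices n, mult = matrix_mult n, one = matrix_one n\<rparr>"

lemma unitary_matricesD:
  assumes "U \<in> unitary_matrices n"
  shows "i \<ge> n \<Longrightarrow> U i j = 0" "j \<ge> n \<Longrightarrow> U i j = 0"
    "i < n \<Longrightarrow> j < n \<Longrightarrow> (\<Sum>k<n. U i k * cnj (U j k)) = (if i = j then 1 else 0)"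
    "i < n \<Longrightarrow> j < n \<Longrightarrow> (\<Sum>k<n. cnj (U k i) * U k j) = (if i = j then 1 else 0)"
  using assms by (auto simp: unitary_matrices_def)

lemma sum_delta_mult_left:
  fixes f :: "nat \<Rightarrow> 'a::semiring_1"
  shows "i < n \<Longrightarrow> (\<Sum>k<n. (if k = i then 1 else 0) * f k) = f i"
    and "i < n \<Longrightarrow> (\<Sum>k<n. (if i = k then 1 else 0) * f k) = f i"
    and "i < n \<Longrightarrow> (\<Sum>k<n. f k * (if k = i then 1 else 0)) = f i"
    and "i < n \<Longrightarrow> (\<Sum>k<n. f k * (if i = k then 1 else 0)) = f i"
  by (simp_all add: if_distrib if_distribR cong: if_cong)

lemma matrix_mult_unitary:
  assumes A: "A \<in> unitary_matrices n" and B: "B \<in> unitary_matrices n"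
  shows "matrix_mult n A B \<in> unitary_matrices n"
proof -
  have 1: "(\<Sum>k<n. matrix_mult n A B i k * cnj (matrix_mult n A B j k)) = (if i = j then 1 else 0)"
    if ij: "i < n" "j < n" for i j
  proof -
    have "(\<Sum>k<n. matrix_mult n A B i k * cnj (matrix_mult n A B j k)) =
      (\<Sum>k<n. \<Sum>p<n. \<Sum>q<n. A i p * cnj (A j q) * (B p k * cnj (B q k)))"
      by (intro sum.cong refl) (simp add: matrix_mult_def ij sum_product,
          intro sum.cong refl, simp add: mult_ac)
    also have "\<dots> = (\<Sum>p<n. \<Sum>q<n. \<Sum>k<n. A i p * cnj (A j q) * (B p k * cnj (B q k)))"
      by (subst sum.swap) (intro sum.cong refl sum.swap)
    also have "\<dots> = (\<Sum>p<n. \<Sum>q<n. A i p * cnj (A j q) * (if p = q then 1 else 0))"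
      by (intro sum.cong refl) (simp add: unitary_matricesD(3)[OF B] flip: sum_distrib_left)
    also have "\<dots> = (\<Sum>p<n. A i p * cnj (A j p))"
      by (intro sum.cong refl sum_delta_mult_left) simp
    finally show ?thesis
      using unitary_matricesD(3)[OF A ij] by simp
  qed
  have 2: "(\<Sum>k<n. cnj (matrix_mult n A B k i) * matrix_mult n A B k j) = (if i = j then 1 else 0)"
    if ij: "i < n" "j < n" for i j
  proof -
    have "(\<Sum>k<n. cnj (matrix_mult n A B k i) * matrix_mult n A B k j) =
      (\<Sum>k<n. \<Sum>p<n. \<Sum>q<n. cnj (B p i) * B q j * (cnj (A k p) * A k q))"
      by (intro sum.cong refl) (simp add: matrix_mult_def ij sum_product,
          intro sum.cong refl, simp add: mult_ac)
    also have "\<dots> = (\<Sum>p<n. \<Sum>q<n. \<Sum>k<n. cnj (B p i) * B q j * (cnj (A k p) * A k q))"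
      by (subst sum.swap) (intro sum.cong refl sum.swap)
    also have "\<dots> = (\<Sum>p<n. \<Sum>q<n. cnj (B p i) * B q j * (if p = q then 1 else 0))"
      by (intro sum.cong refl) (simp add: unitary_matricesD(4)[OF A] flip: sum_distrib_left)
    also have "\<dots> = (\<Sum>p<n. cnj (B p i) * B p j)"
      by (intro sum.cong refl sum_delta_mult_left) simp
    finally show ?thesis
      using unitary_matricesD(4)[OF B ij] by simp
  qed
  show ?thesis
    unfolding unitary_matrices_def using 1 2 by (auto simp: matrix_mult_def)
qed

lemma matrix_one_unitary: "matrix_one n \<in> unitary_matrices n"
  unfolding unitary_matrices_def matrix_one_def
  by (auto simp: if_distrib if_distribR cong: if_cong)

lemma adjoint_unitary:
  assumes "U \<in> unitary_matrices n"
  shows "(\<lambda>i j. cnj (U j i)) \<in> unitary_matrices n"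
  unfolding unitary_matrices_def
  using unitary_matricesD[OF assms] by auto

lemma group_matrix_group: "group (matrix_group n)"
proof (rule groupI)
  fix A B C assume "A \<in> carrier (matrix_group n)" "B \<in> carrier (matrix_group n)"
    "C \<in> carrier (matrix_group n)"
  have "(\<Sum>k<n. (\<Sum>l<n. A i l * B l k) * C k j) = (\<Sum>k<n. A i k * (\<Sum>l<n. B k l * C l j))" for i j
    unfolding sum_distrib_left sum_distrib_right mult.assoc by (rule sum.swap)
  then show "A \<otimes>\<^bsub>matrix_group n\<^esub> B \<otimes>\<^bsub>matrix_group n\<^esub> C =
      A \<otimes>\<^bsub>matrix_group n\<^esub> (B \<otimes>\<^bsub>matrix_group n\<^esub> C)"
    by (auto simp: matrix_group_def matrix_mult_def fun_eq_iff intro!: sum.cong)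
next
  fix A assume "A \<in> carrier (matrix_group n)"
  then have A: "A \<in> unitary_matrices n"
    by (simp add: matrix_group_def)
  have "matrix_mult n (matrix_one n) A i j = A i j" for i j
  proof (cases "i < n \<and> j < n")
    case True
    then have "matrix_mult n (matrix_one n) A i j = (\<Sum>k<n. (if k = i then 1 else 0) * A k j)"
      by (auto simp: matrix_mult_def matrix_one_def intro!: sum.cong)
    then show ?thesis
      using True by (simp only: sum_delta_mult_left)
  next
    case False
    then show ?thesis
      using unitary_matricesD(1,2)[OF A] by (auto simp: matrix_mult_def)
  qed
  then show "\<one>\<^bsub>matrix_group n\<^esub> \<otimes>\<^bsub>matrix_group n\<^esub> A = A"
    by (simp add: matrix_group_def fun_eq_iff)
  have "matrix_mult n (\<lambda>i j. cnj (A j i)) A = matrix_one n"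
    using unitary_matricesD(4)[OF A] by (auto simp: fun_eq_iff matrix_mult_def matrix_one_def)
  then show "\<exists>B\<in>carrier (matrix_group n). B \<otimes>\<^bsub>matrix_group n\<^esub> A = \<one>\<^bsub>matrix_group n\<^esub>"
    using adjoint_unitary[OF A] by (auto simp: matrix_group_def)
qed (auto simp: matrix_group_def matrix_mult_unitary matrix_one_unitary)

lemma rotate_matrix_mult:
  assumes "i < n"
  shows "rotate_tuple n v (matrix_mult n A B) i = rotate_tuple n (rotate_tuple n v A) B i"
proof -
  have "rotate_tuple n v (matrix_mult n A B) i = (\<Sum>j<n. \<Sum>k<n. (A j k * B k i) *\<^sub>C v j)"
    by (simp add: rotate_tuple_def comb_def matrix_mult_def assms scaleC_sum_left)
  also have "\<dots> = (\<Sum>k<n. \<Sum>j<n. (A j k * B k i) *\<^sub>C v j)"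
    by (rule sum.swap)
  also have "\<dots> = rotate_tuple n (rotate_tuple n v A) B i"
    by (simp add: rotate_tuple_def comb_def scaleC_sum_right scaleC_scaleC mult.commute)
  finally show ?thesis .
qed

lemma rotate_diff: "rotate_tuple n (\<lambda>j. v j - w j) U i = rotate_tuple n v U i - rotate_tuple n w U i"
  by (simp add: rotate_tuple_def comb_diff)

lemma bounded_operator_rotate:
  "T \<in> bounded_operators \<Longrightarrow> T (rotate_tuple n v U i) = rotate_tuple n (\<lambda>j. T (v j)) U i"
  by (simp add: rotate_tuple_def comb_def bounded_operatorsD)

text \<open>The Hilbert--Schmidt inner product of tuples is invariant because \<open>U\<close>
  cancels against its adjoint. Invariance of \<open>tuple_form\<close> and of
  \<open>tuple_sq\<close> are both instances.\<close>

lemma cinner_rotate: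
  assumes U: "U \<in> unitary_matrices n"
  shows "(\<Sum>i<n. cinner (rotate_tuple n v U i) (rotate_tuple n w U i)) = (\<Sum>i<n. cinner (v i) (w i))"
proof -
  have "(\<Sum>i<n. cinner (rotate_tuple n v U i) (rotate_tuple n w U i)) =
    (\<Sum>i<n. \<Sum>j<n. \<Sum>k<n. cinner (v j) (w k) * (U j i * cnj (U k i)))"
    unfolding rotate_tuple_def comb_def cinner_sum_left
    by (intro sum.cong refl) (simp add: cinner_sum_right cinner_simps sum_distrib_left mult_ac)
  also have "\<dots> = (\<Sum>j<n. \<Sum>k<n. \<Sum>i<n. cinner (v j) (w k) * (U j i * cnj (U k i)))"
    by (subst sum.swap) (intro sum.cong refl sum.swap)
  also have "\<dots> = (\<Sum>j<n. \<Sum>k<n. cinner (v j) (w k) * (if j = k then 1 else 0))"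
    by (intro sum.cong refl) (simp add: unitary_matricesD(3)[OF U] flip: sum_distrib_left)
  also have "\<dots> = (\<Sum>j<n. cinner (v j) (w j))"
    by (intro sum.cong refl sum_delta_mult_left) simp
  finally show ?thesis .
qed

lemma tuple_form_rotate:
  assumes "U \<in> unitary_matrices n" "T \<in> bounded_operators"
  shows "tuple_form n (rotate_tuple n v U) T = tuple_form n v T"
  unfolding tuple_form_def bounded_operator_rotate[OF assms(2)] by (rule cinner_rotate[OF assms(1)])

lemma tuple_sq_rotate:
  assumes "U \<in> unitary_matrices n"
  shows "tuple_sq n (rotate_tuple n v U) = tuple_sq n v"
proof -
  have "complex_of_real (tuple_sq n (rotate_tuple n v U)) = complex_of_real (tuple_sq n v)"
    unfolding tuple_sq_eq_form tuple_form_def id_apply by (rule cinner_rotate[OF assms])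
  then show ?thesis
    by (simp only: of_real_eq_iff)
qed

section \<open>Compactness of the group of unitary matrices\<close>

lemma compact_function_set:
  fixes S :: "'b::topological_space set"
  assumes "compact S"
  shows "compact {f :: 'a \<Rightarrow> 'b. \<forall>i. f i \<in> S}"
proof -
  have "compactin (product_topology (\<lambda>i::'a. euclidean :: 'b topology) UNIV) (PiE UNIV (\<lambda>_. S))"
    using assms by (simp add: compactin_PiE)
  moreover have "PiE UNIV (\<lambda>_. S) = {f :: 'a \<Rightarrow> 'b. \<forall>i. f i \<in> S}"
    by (auto simp: PiE_def)
  ultimately show ?thesis
    by (simp add: euclidean_product_topology)
qed

lemma continuous_on_entry [continuous_intros]:
  "continuous_on A (\<lambda>U :: nat \<Rightarrow> nat \<Rightarrow> complex. U i j)"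
proof -
  have "continuous_on UNIV (\<lambda>U :: nat \<Rightarrow> nat \<Rightarrow> complex. U i j)"
    by (rule continuous_on_product_then_coordinatewise[OF continuous_on_product_coordinates])
  then show ?thesis
    by (rule continuous_on_subset) simp
qed

lemma unitary_entry_le_1:
  assumes U: "U \<in> unitary_matrices n"
  shows "cmod (U i j) \<le> 1"
proof (cases "i < n \<and> j < n")
  case True
  have "complex_of_real (\<Sum>k<n. (cmod (U i k))\<^sup>2) = 1"
    using unitary_matricesD(3)[OF U, of i i] True by (simp add: complex_norm_square del: of_real_power)
  then have "(\<Sum>k<n. (cmod (U i k))\<^sup>2) = 1"
    using of_real_eq_1_iff by blast
  moreover have "(cmod (U i j))\<^sup>2 \<le> (\<Sum>k<n. (cmod (U i k))\<^sup>2)"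
    using True by (intro member_le_sum) auto
  ultimately show ?thesis
    by (simp add: power2_le_iff_abs_le abs_square_le_1)
next
  case False
  then show ?thesis
    using unitary_matricesD(1,2)[OF U] by (metis linorder_not_less norm_zero zero_le_one)
qed

text \<open>In the product topology each defining equation involves finitely many entries, hence is
  closed. Entries of modulus at most 1 place the set inside a product of discs, compact by Tychonoff
  applied to rows and then to matrices.\<close>

lemma compact_unitary_matrices: "compact (unitary_matrices n)"
proof -
  let ?B = "{U :: nat \<Rightarrow> nat \<Rightarrow> complex. \<forall>i. U i \<in> {f. \<forall>j. f j \<in> cball 0 1}}"
  have "closed (unitary_matrices n)"
    unfolding unitary_matrices_def
    by (intro closed_Collect_conj closed_Collect_all closed_Collect_imp open_Collect_const
        closed_Collect_eq continuous_intros)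
  moreover have "compact ?B"
    by (intro compact_function_set compact_cball)
  moreover have "unitary_matrices n = ?B \<inter> unitary_matrices n"
    using unitary_entry_le_1 by auto
  ultimately show ?thesis
    by (metis compact_Int_closed)
qed

lemma continuous_on_scaleC [continuous_intros]:
  fixes v :: "'h::complex_hilbert"
  assumes "continuous_on S f"
  shows "continuous_on S (\<lambda>x. f x *\<^sub>C v)"
proof -
  have "bounded_linear (\<lambda>c. c *\<^sub>C v)"
    by (rule bounded_linear_intro[of _ "norm v"])
      (simp_all add: scaleC_add_left scaleR_scaleC scaleC_scaleC norm_scaleC scaleR_conv_of_real)
  then show ?thesis
    using assms by (rule bounded_linear.continuous_on)
qed

text \<open>The unitary \<open>1 + (\<theta> - 1) c c\<^sup>*\<close>, for a unit vector \<open>c\<close> of \<open>\<complex>\<^sup>n\<close>.\<close>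

definition phase_matrix :: "nat \<Rightarrow> complex \<Rightarrow> (nat \<Rightarrow> complex) \<Rightarrow> nat \<Rightarrow> nat \<Rightarrow> complex" where
  "phase_matrix n \<theta> c = (\<lambda>i j. if i < n \<and> j < n
     then (if i = j then 1 else 0) + (\<theta> - 1) * c i * cnj (c j) else 0)"

text \<open>The cross terms add up to \<open>(\<theta> - 1) + cnj (\<theta> - 1) + (\<theta> - 1) *
  cnj (\<theta> - 1)\<close>, which is \<open>\<theta> * cnj \<theta> - 1 = 0\<close>.\<close>

lemma phase_matrix_unitary:
  assumes c: "(\<Sum>k<n. cnj (c k) * c k) = 1" and \<theta>: "cmod \<theta> = 1"
  shows "phase_matrix n \<theta> c \<in> unitary_matrices n"
proof -
  have \<theta>': "\<theta> * cnj \<theta> = 1"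
    using \<theta> by (simp flip: complex_norm_square)
  have 1: "(\<Sum>k<n. phase_matrix n \<theta> c i k * cnj (phase_matrix n \<theta> c j k)) = (if i = j then 1 else 0)"
    if ij: "i < n" "j < n" for i j
  proof -
    have "(\<Sum>k<n. phase_matrix n \<theta> c i k * cnj (phase_matrix n \<theta> c j k)) =
      (\<Sum>k<n. (if i = k then 1 else 0) * (if j = k then 1 else 0) +
        (cnj (\<theta> - 1) * cnj (c j) * c k) * (if i = k then 1 else 0) +
        ((\<theta> - 1) * c i * cnj (c k)) * (if j = k then 1 else 0) +
        ((\<theta> - 1) * cnj (\<theta> - 1) * c i * cnj (c j)) * (cnj (c k) * c k))"
      using ij by (intro sum.cong refl) (auto simp: phase_matrix_def algebra_simps)
    also have "\<dots> = (if j = i then 1 else 0) + cnj (\<theta> - 1) * cnj (c j) * c i +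
        (\<theta> - 1) * c i * cnj (c j) + (\<theta> - 1) * cnj (\<theta> - 1) * c i * cnj (c j)"
      unfolding sum.distrib sum_distrib_left[symmetric] c
      by (simp only: sum_delta_mult_left[OF ij(1)] sum_delta_mult_left[OF ij(2)] mult_1_right)
    also have "\<dots> = (if j = i then 1 else 0) + (\<theta> * cnj \<theta> - 1) * c i * cnj (c j)"
      by (simp add: algebra_simps)
    finally show ?thesis
      by (auto simp: \<theta>')
  qed
  have 2: "(\<Sum>k<n. cnj (phase_matrix n \<theta> c k i) * phase_matrix n \<theta> c k j) = (if i = j then 1 else 0)"
    if ij: "i < n" "j < n" for i j
  proof -
    have "(\<Sum>k<n. cnj (phase_matrix n \<theta> c k i) * phase_matrix n \<theta> c k j) =
      (\<Sum>k<n. (if i = k then 1 else 0) * (if j = k then 1 else 0) +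
        ((\<theta> - 1) * cnj (c j) * c k) * (if i = k then 1 else 0) +
        (cnj (\<theta> - 1) * c i * cnj (c k)) * (if j = k then 1 else 0) +
        ((\<theta> - 1) * cnj (\<theta> - 1) * c i * cnj (c j)) * (cnj (c k) * c k))"
      using ij by (intro sum.cong refl) (auto simp: phase_matrix_def algebra_simps)
    also have "\<dots> = (if j = i then 1 else 0) + (\<theta> - 1) * cnj (c j) * c i +
        cnj (\<theta> - 1) * c i * cnj (c j) + (\<theta> - 1) * cnj (\<theta> - 1) * c i * cnj (c j)"
      unfolding sum.distrib sum_distrib_left[symmetric] c
      by (simp only: sum_delta_mult_left[OF ij(1)] sum_delta_mult_left[OF ij(2)] mult_1_right)
    also have "\<dots> = (if j = i then 1 else 0) + (\<theta> * cnj \<theta> - 1) * c i * cnj (c j)"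
      by (simp add: algebra_simps)
    finally show ?thesis
      by (auto simp: \<theta>')
  qed
  show ?thesis
    unfolding unitary_matrices_def using 1 2 by (auto simp: phase_matrix_def)
qed

lemma rotate_phase_matrix:
  assumes "i < n"
  shows "rotate_tuple n v (phase_matrix n \<theta> c) i = v i + ((\<theta> - 1) * cnj (c i)) *\<^sub>C comb n c v"
proof -
  have "rotate_tuple n v (phase_matrix n \<theta> c) i =
      comb n (\<lambda>j. (if j = i then 1 else 0) + ((\<theta> - 1) * cnj (c i)) * c j) v"
    unfolding rotate_tuple_def comb_def
    using assms by (intro sum.cong refl) (auto simp: phase_matrix_def algebra_simps)
  then show ?thesis
    by (simp only: comb_add_coeff comb_scale_coeff comb_unit[OF assms])
qed

text \<open>At a maximum over all rotations, the adjoint of \<open>w\<close> times \<open>v\<close>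
  is a positive matrix, as in a polar decomposition. To see this, maximality is tested against phase
  matrices in the direction \<open>c\<close>: they change the pairing by
  \<open>(\<theta> - 1) * z\<close> with \<open>z\<close> the inner product in question.\<close>

lemma nonneg_cinner_comb:
  assumes max: "\<And>U. U \<in> unitary_matrices n \<Longrightarrow>
    Re (\<Sum>i<n. cinner (rotate_tuple n v U i) (w i)) \<le> Re (\<Sum>i<n. cinner (v i) (w i))"
  shows "cinner (comb n c v) (comb n c w) \<in> \<real>\<^sub>\<ge>\<^sub>0"
proof -
  have unit: "cinner (comb n c v) (comb n c w) \<in> \<real>\<^sub>\<ge>\<^sub>0"
    if c: "(\<Sum>k<n. cnj (c k) * c k) = 1" for c
  proof -
    define z where "z = cinner (comb n c v) (comb n c w)"
    have *: "Re ((\<theta> - 1) * z) \<le> 0" if "cmod \<theta> = 1" for \<theta>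
    proof -
      have "(\<Sum>i<n. cinner (rotate_tuple n v (phase_matrix n \<theta> c) i) (w i)) =
        (\<Sum>i<n. cinner (v i) (w i)) + (\<Sum>i<n. (\<theta> - 1) * cinner (comb n c v) (c i *\<^sub>C w i))"
        unfolding sum.distrib[symmetric]
        by (intro sum.cong refl) (simp add: rotate_phase_matrix cinner_simps mult_ac)
      also have "(\<Sum>i<n. (\<theta> - 1) * cinner (comb n c v) (c i *\<^sub>C w i)) = (\<theta> - 1) * z"
        by (simp add: z_def comb_def[of n c w] cinner_sum_right sum_distrib_left)
      finally show ?thesis
        using max[OF phase_matrix_unitary[OF c that]] by simp
    qed
    have "z \<in> \<real>\<^sub>\<ge>\<^sub>0"
    proof (cases "z = 0")
      case False
      \<comment> \<open>The phase that rotates \<open>z\<close> to its modulus. Maximality then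
        gives \<open>cmod z \<le> Re z\<close>, which forces \<open>z\<close> to be real and
        nonnegative.\<close>
      then have "cmod (cnj z / cmod z) = 1"
        by (simp add: norm_divide)
      from *[OF this] have "Re (cnj z / cmod z * z) \<le> Re z"
        by (simp add: algebra_simps)
      also have "cnj z / cmod z * z = complex_of_real (cmod z)"
        using False by (simp add: complex_norm_square[symmetric] mult.commute field_simps power2_eq_square
            flip: of_real_mult)
      finally have "cmod z \<le> Re z"
        by simp
      then have "(Re z)\<^sup>2 + (Im z)\<^sup>2 \<le> (Re z)\<^sup>2"
        using power_mono[of "cmod z" "Re z" 2] by (simp add: cmod_power2)
      then show ?thesis
        using order_trans[OF norm_ge_zero \<open>cmod z \<le> Re z\<close>] by (simp add: complex_nonneg_Reals_iff)
    qed simp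
    then show ?thesis
      by (simp add: z_def)
  qed
  show ?thesis
  proof (cases "\<forall>k<n. c k = 0")
    case True
    then show ?thesis
      by (simp add: comb_def)
  next
    case False
    define s where "s = sqrt (\<Sum>k<n. (cmod (c k))\<^sup>2)"
    have s: "s > 0"
      unfolding s_def real_sqrt_gt_0_iff using False by (auto intro!: sum_pos2)
    then have s2: "s\<^sup>2 = (\<Sum>k<n. (cmod (c k))\<^sup>2)"
      by (simp add: s_def sum_nonneg)
    define d where "d k = complex_of_real (1 / s) * c k" for k
    have "(\<Sum>k<n. cnj (d k) * d k) = complex_of_real ((1 / s)\<^sup>2 * (\<Sum>k<n. (cmod (c k))\<^sup>2))"
      by (simp only: d_def of_real_mult of_real_sum complex_norm_square sum_distrib_left)
        (simp add: mult_ac power2_eq_square)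
    also have "\<dots> = 1"
      using s by (simp add: s2[symmetric] power_divide)
    finally have "cinner (comb n d v) (comb n d w) \<in> \<real>\<^sub>\<ge>\<^sub>0"
      by (rule unit)
    then have "complex_of_real (s\<^sup>2) * cinner (comb n d v) (comb n d w) \<in> \<real>\<^sub>\<ge>\<^sub>0"
      by (intro nonneg_Reals_mult_I) (simp_all del: of_real_power)
    also have "complex_of_real (s\<^sup>2) * cinner (comb n d v) (comb n d w) =
        cinner (comb n c v) (comb n c w)"
      using s unfolding d_def comb_scale_coeff by (simp add: cinner_simps power2_eq_square)
    finally show ?thesis .
  qed
qed

text \<open>Polarisation: a sesquilinear form that is real on the diagonal is Hermitian. Testing on
  \<open>v i + a v j\<close> with \<open>a = 1\<close> and \<open>a = \<i>\<close> separates the two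
  off-diagonal entries of the defect \<open>d\<close>.\<close>

lemma hermitian_form_symmetric:
  assumes real: "\<And>c. cinner (comb n c v) (comb n c w) \<in> \<real>" and ij: "i < n" "j < n"
  shows "cinner (v i) (w j) = cinner (w i) (v j)"
proof -
  define d where "d i j = cinner (v i) (w j) - cinner (w i) (v j)" for i j
  have d: "d j i = - cnj (d i j)" for i j
    by (simp add: d_def) (metis cinner_commute complex_cnj_cnj)
  have *: "d i i + a * d j i + cnj a * d i j + a * cnj a * d j j = 0"
    if ij: "i < n" "j < n" for a i j
  proof -
    let ?x = "\<lambda>v. v i + a *\<^sub>C v j"
    have "comb n (\<lambda>k. (if k = i then 1 else 0) + a * (if k = j then 1 else 0)) u = ?x u"
      for u :: "nat \<Rightarrow> 'a"
      by (simp only: comb_add_coeff comb_scale_coeff comb_unit ij)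
    then have "cinner (?x v) (?x w) \<in> \<real>"
      using real[of "\<lambda>k. (if k = i then 1 else 0) + a * (if k = j then 1 else 0)"] by simp
    then have "cinner (?x v) (?x w) = cinner (?x w) (?x v)"
      by (subst (2) cinner_commute) (simp add: Reals_cnj_iff)
    then show ?thesis
      by (simp add: d_def cinner_simps algebra_simps)
  qed
  have diag: "d k k = 0" if "k < n" for k
    using *[OF that that, of 0] by simp
  have "d j i + d i j = 0" "\<i> * d j i - \<i> * d i j = 0"
    using *[OF ij, of 1] *[OF ij, of \<i>] diag ij by auto
  then have "d i j = 0"
    by (auto simp: complex_eq_iff)
  then show ?thesis
    by (simp add: d_def)
qed

text \<open>An inequality of Powers--Stoermer type. With \<open>U\<close> maximising \<open>Re (\<Sum>i<n. \<langle>(vU) i, w i\<rangle>)\<close>,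
  the two functionals are compared on the contraction that sends \<open>vU + w\<close> to \<open>vU - w\<close>.\<close>

lemma tuple_alignment:
  fixes v w :: "nat \<Rightarrow> 'h::complex_hilbert"
  assumes close: "\<And>T. T \<in> contractions \<Longrightarrow> Re (tuple_form n v T - tuple_form n w T) \<le> d"
  shows "\<exists>U\<in>unitary_matrices n. tuple_sq n (\<lambda>i. rotate_tuple n v U i - w i) \<le> 2 * d"
proof -
  have "\<exists>U\<in>unitary_matrices n. \<forall>V\<in>unitary_matrices n.
    Re (\<Sum>i<n. cinner (rotate_tuple n v V i) (w i)) \<le> Re (\<Sum>i<n. cinner (rotate_tuple n v U i) (w i))"
  proof (rule continuous_attains_sup[OF compact_unitary_matrices])
    show "unitary_matrices n \<noteq> {}"
      using matrix_one_unitary by blast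
    show "continuous_on (unitary_matrices n) (\<lambda>U. Re (\<Sum>i<n. cinner (rotate_tuple n v U i) (w i)))"
      unfolding rotate_tuple_def comb_def cinner_sum_left cinner_scaleC_left
      by (intro continuous_intros)
  qed
  then obtain U where U: "U \<in> unitary_matrices n"
    and max: "\<And>V. V \<in> unitary_matrices n \<Longrightarrow>
      Re (\<Sum>i<n. cinner (rotate_tuple n v V i) (w i)) \<le> Re (\<Sum>i<n. cinner (rotate_tuple n v U i) (w i))"
    by blast
  define u where "u = rotate_tuple n v U"
  have nonneg: "cinner (comb n c u) (comb n c w) \<in> \<real>\<^sub>\<ge>\<^sub>0" for c
  proof (rule nonneg_cinner_comb)
    fix V assume V: "V \<in> unitary_matrices n"
    have "(\<Sum>i<n. cinner (rotate_tuple n u V i) (w i)) =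
        (\<Sum>i<n. cinner (rotate_tuple n v (matrix_mult n U V) i) (w i))"
      by (intro sum.cong refl) (simp add: rotate_matrix_mult u_def)
    then show "Re (\<Sum>i<n. cinner (rotate_tuple n u V i) (w i)) \<le> Re (\<Sum>i<n. cinner (u i) (w i))"
      using max[OF matrix_mult_unitary[OF U V]] by (simp add: u_def)
  qed
  have sym: "cinner (u i) (w j) = cinner (w i) (u j)" if "i < n" "j < n" for i j
    using nonneg nonneg_Reals_subset_Reals by (intro hermitian_form_symmetric[OF _ that]) blast
  define S where "S i = u i + w i" for i
  define D where "D i = u i - w i" for i
  have "\<exists>T\<in>contractions. (\<forall>i<n. T (S i) = D i) \<and> (\<forall>i<n. 0 \<le> Re (cinner (T (D i)) (S i)))"
  proof (rule dominated_tuple_contraction)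
    show "norm (comb n c D) \<le> norm (comb n c S)" for c
    proof -
      \<comment> \<open>The two sides differ by four times the real part of the nonnegative number
        \<open>cinner (comb n c u) (comb n c w)\<close>.\<close>
      have "(norm (comb n c D))\<^sup>2 \<le> (norm (comb n c S))\<^sup>2"
        using nonneg[of c] unfolding S_def D_def comb_add comb_diff norm_add_sq norm_diff_sq
        by (simp add: complex_nonneg_Reals_iff)
      then show ?thesis
        by (simp add: power2_le_iff_abs_le)
    qed
    show "cinner (D i) (S j) = cinner (S i) (D j)" if "i < n" "j < n" for i j
      using sym[OF that] by (simp add: S_def D_def cinner_simps)
  qed
  then obtain T where T: "T \<in> contractions" and TS: "\<And>i. i < n \<Longrightarrow> T (S i) = D i"
    and TD: "\<And>i. i < n \<Longrightarrow> 0 \<le> Re (cinner (T (D i)) (S i))"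
    by blast
  note Tb = contractionsD(1)[OF T]
  have "tuple_sq n D \<le> (\<Sum>i<n. 2 * (Re (cinner (T (u i)) (u i)) - Re (cinner (T (w i)) (w i))))"
    unfolding tuple_sq_def
  proof (rule sum_mono)
    fix i assume "i \<in> {..<n}"
    then have i: "i < n"
      by simp
    \<comment> \<open>On the right, \<open>T (S i) = D i\<close> turns the second term into the
      squared norm of \<open>D i\<close>, and the first has nonnegative real part. The factor 2 on
      the left is the one in the conclusion.\<close>
    have "2 * (cinner (T (u i)) (u i) - cinner (T (w i)) (w i)) =
        cinner (T (D i)) (S i) + cinner (T (S i)) (D i)"
      by (simp add: S_def D_def bounded_operatorsD[OF Tb] cinner_simps)
    then have "Re (2 * (cinner (T (u i)) (u i) - cinner (T (w i)) (w i))) =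
        Re (cinner (T (D i)) (S i)) + (norm (D i))\<^sup>2"
      by (simp add: TS[OF i] Re_cinner_self)
    then show "(norm (D i))\<^sup>2 \<le> 2 * (Re (cinner (T (u i)) (u i)) - Re (cinner (T (w i)) (w i)))"
      using TD[OF i] by simp
  qed
  also have "\<dots> = 2 * Re (tuple_form n u T - tuple_form n w T)"
    by (simp add: tuple_form_def sum_subtractf sum_distrib_left[symmetric])
  also have "\<dots> \<le> 2 * d"
    using close[OF T] unfolding u_def tuple_form_rotate[OF U Tb] by simp
  finally show ?thesis
    using U unfolding D_def u_def by blast
qed

section \<open>Averages of almost periodic functions\<close>

text \<open>Uniform weights suffice because the averaging operators can be composed.\<close>

inductive_set averages :: "('k, 'c) monoid_scheme \<Rightarrow> (('k \<Rightarrow> real) \<Rightarrow> 'k \<Rightarrow> real) set"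
  for K (structure) where
    id: "(\<lambda>F. F) \<in> averages K"
  | translate: "\<Lambda> \<in> averages K \<Longrightarrow> N > 0 \<Longrightarrow> (\<And>i. i < N \<Longrightarrow> k i \<in> carrier K) \<Longrightarrow>
      (\<lambda>F x. (\<Sum>i<N. \<Lambda> F (x \<otimes> k i)) / real N) \<in> averages K"

text \<open>Almost periodicity in the sense of von Neumann: the left translates of \<open>F\<close>
  have a finite \<open>\<eta>\<close>-net in the supremum norm.\<close>

definition almost_periodic :: "('k, 'c) monoid_scheme \<Rightarrow> ('k \<Rightarrow> real) \<Rightarrow> bool" where
  "almost_periodic K F \<longleftrightarrow> (\<exists>M. \<forall>x\<in>carrier K. \<bar>F x\<bar> \<le> M) \<and>
     (\<forall>\<eta>>0. \<exists>A. finite A \<and> A \<subseteq> carrier K \<and>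
        (\<forall>k\<in>carrier K. \<exists>h\<in>A. \<forall>u\<in>carrier K. \<bar>F (k \<otimes>\<^bsub>K\<^esub> u) - F (h \<otimes>\<^bsub>K\<^esub> u)\<bar> \<le> \<eta>))"

lemma averages_compose:
  assumes "\<Lambda> \<in> averages K" "\<Lambda>' \<in> averages K"
  shows "(\<lambda>F. \<Lambda> (\<Lambda>' F)) \<in> averages K"
  using assms
proof (induction rule: averages.induct)
  case (translate \<Lambda> N k)
  then show ?case
    using averages.translate[of "\<lambda>F. \<Lambda> (\<Lambda>' F)" K N k] by simp
qed simp

context group
begin

lemma averages_linear:
  assumes "\<Lambda> \<in> averages G"
  shows "\<Lambda> (\<lambda>x. F x + H x) x = \<Lambda> F x + \<Lambda> H x"
    and "\<Lambda> (\<lambda>x. c * F x) x = c * \<Lambda> F x"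
  using assms
  by (induction arbitrary: x rule: averages.induct)
    (simp_all add: sum.distrib add_divide_distrib sum_distrib_left)

lemma averages_le:
  assumes "\<Lambda> \<in> averages G" "x \<in> carrier G" "\<And>x. x \<in> carrier G \<Longrightarrow> F x \<le> b"
  shows "\<Lambda> F x \<le> b"
  using assms(1,2)
proof (induction arbitrary: x rule: averages.induct)
  case (translate \<Lambda> N k)
  have "(\<Sum>i<N. \<Lambda> F (x \<otimes> k i)) \<le> (\<Sum>i<N. b)"
    using translate by (intro sum_mono) auto
  then show ?case
    using translate by (simp add: field_simps)
qed (rule assms(3))

lemma averages_uminus:
  assumes "\<Lambda> \<in> averages G"
  shows "\<Lambda> (\<lambda>x. - F x) x = - \<Lambda> F x"
  using averages_linear(2)[OF assms, of "-1" F x] by simp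

lemma averages_diff:
  assumes "\<Lambda> \<in> averages G"
  shows "\<Lambda> (\<lambda>x. F x - H x) x = \<Lambda> F x - \<Lambda> H x"
  using averages_linear(1)[OF assms, of F "\<lambda>x. - H x" x] averages_uminus[OF assms] by simp

lemma averages_ge:
  assumes "\<Lambda> \<in> averages G" "x \<in> carrier G" "\<And>x. x \<in> carrier G \<Longrightarrow> b \<le> F x"
  shows "b \<le> \<Lambda> F x"
  using averages_le[OF assms(1,2), of "\<lambda>x. - F x" "- b"] assms(3) averages_uminus[OF assms(1)]
  by simp

lemma averages_sum:
  fixes m :: nat
  assumes "\<Lambda> \<in> averages G"
  shows "\<Lambda> (\<lambda>x. \<Sum>i<m. F i x) x = (\<Sum>i<m. \<Lambda> (F i) x)"
proof (induction m)
  case 0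
  show ?case
    using averages_linear(2)[OF assms, of 0 "\<lambda>_. 0" x] by simp
next
  case (Suc m)
  then show ?case
    using averages_linear(1)[OF assms, of "\<lambda>x. \<Sum>i<m. F i x" "F m" x] by simp
qed

text \<open>Averages are built from right translations. These commute with left translations, so a
  uniform bound between two left translates of \<open>F\<close> passes to the average; in particular
  the same finite nets serve \<open>\<Lambda> F\<close>.\<close>

lemma averages_close:
  assumes "\<Lambda> \<in> averages G" "k \<in> carrier G" "h \<in> carrier G" "u \<in> carrier G"
    and "\<And>u. u \<in> carrier G \<Longrightarrow> \<bar>F (k \<otimes> u) - F (h \<otimes> u)\<bar> \<le> \<eta>"
  shows "\<bar>\<Lambda> F (k \<otimes> u) - \<Lambda> F (h \<otimes> u)\<bar> \<le> \<eta>"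
  using assms(1,4)
proof (induction arbitrary: u rule: averages.induct)
  case (translate \<Lambda> N a)
  have "\<bar>(\<Sum>i<N. \<Lambda> F (k \<otimes> u \<otimes> a i)) - (\<Sum>i<N. \<Lambda> F (h \<otimes> u \<otimes> a i))\<bar> \<le>
      (\<Sum>i<N. \<bar>\<Lambda> F (k \<otimes> (u \<otimes> a i)) - \<Lambda> F (h \<otimes> (u \<otimes> a i))\<bar>)"
    unfolding sum_subtractf[symmetric]
    using sum_abs[of "\<lambda>i. \<Lambda> F (k \<otimes> u \<otimes> a i) - \<Lambda> F (h \<otimes> u \<otimes> a i)" "{..<N}"]
      translate assms(2,3) by (simp add: m_assoc)
  also have "\<dots> \<le> (\<Sum>i<N. \<eta>)"
    using translate by (intro sum_mono) auto
  finally show ?case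
    using translate by (simp add: diff_divide_distrib[symmetric] field_simps)
qed (rule assms(5))

lemma averages_left_translate:
  assumes "\<Lambda> \<in> averages G" "U \<in> carrier G" "x \<in> carrier G"
  shows "\<Lambda> (\<lambda>k. F (U \<otimes> k)) x = \<Lambda> F (U \<otimes> x)"
  using assms(1,3)
proof (induction arbitrary: x rule: averages.induct)
  case (translate \<Lambda> N k)
  have "\<Lambda> (\<lambda>k. F (U \<otimes> k)) (x \<otimes> k i) = \<Lambda> F (U \<otimes> x \<otimes> k i)" if "i < N" for i
    using translate that assms(2) by (simp add: m_assoc)
  then show ?case
    by simp
qed simp

lemma almost_periodic_average:
  assumes F: "almost_periodic G F" and \<Lambda>: "\<Lambda> \<in> averages G"
  shows "almost_periodic G (\<Lambda> F)"
proof -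
  obtain M where M: "\<And>x. x \<in> carrier G \<Longrightarrow> \<bar>F x\<bar> \<le> M"
    using F unfolding almost_periodic_def by blast
  then have M': "F x \<le> M" "- M \<le> F x" if "x \<in> carrier G" for x
    using that by (fastforce simp: abs_le_iff)+
  have "\<bar>\<Lambda> F x\<bar> \<le> M" if "x \<in> carrier G" for x
  proof -
    have "\<Lambda> F x \<le> M"
      by (rule averages_le[OF \<Lambda> that M'(1)])
    moreover have "- M \<le> \<Lambda> F x"
      by (rule averages_ge[OF \<Lambda> that M'(2)])
    ultimately show ?thesis
      by (simp add: abs_le_iff)
  qed
  moreover have "\<exists>A. finite A \<and> A \<subseteq> carrier G \<and>
        (\<forall>k\<in>carrier G. \<exists>h\<in>A. \<forall>u\<in>carrier G. \<bar>\<Lambda> F (k \<otimes> u) - \<Lambda> F (h \<otimes> u)\<bar> \<le> \<eta>)" if \<eta>: "\<eta> > 0" for \<eta>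
  proof -
    obtain A where A: "finite A" "A \<subseteq> carrier G"
      "\<forall>k\<in>carrier G. \<exists>h\<in>A. \<forall>u\<in>carrier G. \<bar>F (k \<otimes> u) - F (h \<otimes> u)\<bar> \<le> \<eta>"
      using F \<eta> unfolding almost_periodic_def by (meson that)
    have "\<exists>h\<in>A. \<forall>u\<in>carrier G. \<bar>\<Lambda> F (k \<otimes> u) - \<Lambda> F (h \<otimes> u)\<bar> \<le> \<eta>" if k: "k \<in> carrier G" for k
    proof -
      obtain h where h: "h \<in> A" "\<forall>u\<in>carrier G. \<bar>F (k \<otimes> u) - F (h \<otimes> u)\<bar> \<le> \<eta>"
        using A(3) k by blast
      then have "\<bar>\<Lambda> F (k \<otimes> u) - \<Lambda> F (h \<otimes> u)\<bar> \<le> \<eta>" if "u \<in> carrier G" for u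
        using that A(2) by (intro averages_close[OF \<Lambda> k]) auto
      then show ?thesis
        using h(1) by blast
    qed
    then show ?thesis
      using A by blast
  qed
  ultimately show ?thesis
    unfolding almost_periodic_def by blast
qed

text \<open>Averaging over the translates that carry each point close to a minimum point lowers the
  oscillation by a definite amount, so the infimal oscillation of an average is \<open>0\<close>.\<close>

lemma almost_periodic_flatten:
  assumes F: "almost_periodic G F" and "\<tau> > 0"
  shows "\<exists>\<Lambda>\<in>averages G. \<forall>x\<in>carrier G. \<forall>y\<in>carrier G. \<Lambda> F x - \<Lambda> F y \<le> \<tau>"
proof (rule ccontr)
  assume not: "\<not> ?thesis"
  \<comment> \<open>All upper bounds for the oscillation of some average. By assumption they are at
    least \<open>\<tau>\<close>, so the infimum \<open>r\<close> is positive and can serve as a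
    scale.\<close>
  define Osc where "Osc = {s. \<exists>\<Lambda>\<in>averages G. \<forall>x\<in>carrier G. \<forall>y\<in>carrier G. \<Lambda> F x - \<Lambda> F y \<le> s}"
  have lower: "\<tau> \<le> s" if s: "s \<in> Osc" for s
  proof (rule ccontr)
    assume "\<not> \<tau> \<le> s"
    moreover obtain \<Lambda> where "\<Lambda> \<in> averages G"
      "\<And>x y. x \<in> carrier G \<Longrightarrow> y \<in> carrier G \<Longrightarrow> \<Lambda> F x - \<Lambda> F y \<le> s"
      using s unfolding Osc_def by blast
    ultimately show False
      using not by (meson linear order.trans)
  qed
  obtain M where M: "\<And>x. x \<in> carrier G \<Longrightarrow> \<bar>F x\<bar> \<le> M"
    using F unfolding almost_periodic_def by blast
  have "F x - F y \<le> 2 * M" if "x \<in> carrier G" "y \<in> carrier G" for x y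
    using M[OF that(1)] M[OF that(2)] by linarith
  then have "2 * M \<in> Osc"
    unfolding Osc_def by (intro CollectI bexI[OF _ averages.id]) blast
  then have ne: "Osc \<noteq> {}"
    by blast
  have bdd: "bdd_below Osc"
    using lower by (rule bdd_belowI)
  define r where "r = Inf Osc"
  have r: "r \<ge> \<tau>"
    unfolding r_def using ne lower by (rule cInf_greatest)
  then have r0: "r > 0"
    using \<open>\<tau> > 0\<close> by simp
  obtain A where A: "finite A" "A \<subseteq> carrier G"
    "\<And>k. k \<in> carrier G \<Longrightarrow> \<exists>h\<in>A. \<forall>u\<in>carrier G. \<bar>F (k \<otimes> u) - F (h \<otimes> u)\<bar> \<le> r / 8"
    using F r0 unfolding almost_periodic_def by (metis divide_pos_pos zero_less_numeral)
  define N where "N = card A"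
  have "A \<noteq> {}"
    using A(3)[OF one_closed] by blast
  then have N: "N > 0"
    using A(1) by (simp add: N_def card_gt_0_iff)
  obtain a where a: "bij_betw a {..<N} A"
    using ex_bij_betw_nat_finite[OF A(1)] by (auto simp: N_def atLeast0LessThan)
  then have aA: "a i \<in> A" and aG: "a i \<in> carrier G" if "i < N" for i
    using that A(2) by (auto simp: bij_betw_def)
  \<comment> \<open>The slack \<open>r / (4 * real N)\<close> is incurred by \<open>N - 1\<close>
    summands, hence costs at most \<open>r / 4\<close> in total. The one good summand loses another
    \<open>r / 4\<close> but saves a full \<open>r\<close>.\<close>
  have "Inf Osc < r + r / (4 * real N)"
    using r0 N by (simp add: r_def)
  then obtain s where s: "s \<in> Osc" "s < r + r / (4 * real N)"
    using cInf_less_iff[OF ne bdd] by blast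
  then obtain \<Lambda> where \<Lambda>: "\<Lambda> \<in> averages G"
    and osc: "\<And>x y. x \<in> carrier G \<Longrightarrow> y \<in> carrier G \<Longrightarrow> \<Lambda> F x - \<Lambda> F y \<le> s"
    by (auto simp: Osc_def)
  let ?H = "\<Lambda> F"
  define m where "m = (INF x\<in>carrier G. ?H x)"
  have bddH: "bdd_below (?H ` carrier G)"
  proof (rule bdd_belowI2)
    show "?H \<one> - s \<le> ?H x" if "x \<in> carrier G" for x
      using osc[OF one_closed that] by simp
  qed
  have m_le: "m \<le> ?H x" if "x \<in> carrier G" for x
    unfolding m_def using bddH that by (rule cINF_lower)
  have "m < m + r / 8"
    using r0 by simp
  then obtain x0 where x0: "x0 \<in> carrier G" "?H x0 < m + r / 8"
    unfolding m_def using cINF_less_iff[OF _ bddH] one_closed by blast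
  have le_s: "?H x \<le> m + s" if "x \<in> carrier G" for x
  proof -
    have "?H x - s \<le> m"
      unfolding m_def using osc[OF that] one_closed by (intro cINF_greatest) (auto simp: algebra_simps)
    then show ?thesis
      by simp
  qed
  \<comment> \<open>If the translates of \<open>F\<close> by \<open>x\<close> and \<open>a j\<close>
    are close, then the value of \<open>\<Lambda> F\<close> at
    \<open>x \<otimes> (inv (a j) \<otimes> x0)\<close> is close to its value at the near-minimum
    \<open>x0\<close>. So at every point one summand is small.\<close>
  define \<Lambda>' where "\<Lambda>' F x = (\<Sum>i<N. \<Lambda> F (x \<otimes> (inv (a i) \<otimes> x0))) / real N" for F x
  have k: "inv (a i) \<otimes> x0 \<in> carrier G" if "i < N" for i
    using aG[OF that] x0 by simp
  have "\<Lambda>' \<in> averages G"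
    unfolding \<Lambda>'_def[abs_def] by (rule averages.translate[OF \<Lambda> N k])
  moreover have "\<Lambda>' F x - \<Lambda>' F y \<le> ((real N - 1) * s + r / 4) / real N"
    if x: "x \<in> carrier G" and y: "y \<in> carrier G" for x y
  proof -
    obtain h where h: "h \<in> A" "\<forall>u\<in>carrier G. \<bar>F (x \<otimes> u) - F (h \<otimes> u)\<bar> \<le> r / 8"
      using A(3)[OF x] by blast
    then obtain j where j: "j < N" "h = a j"
      using a by (auto simp: bij_betw_def)
    let ?f = "\<lambda>i. ?H (x \<otimes> (inv (a i) \<otimes> x0))"
    have "\<bar>?f j - ?H (a j \<otimes> (inv (a j) \<otimes> x0))\<bar> \<le> r / 8"
      using h(2) j aG by (intro averages_close[OF \<Lambda> x _ k]) auto
    moreover have "a j \<otimes> (inv (a j) \<otimes> x0) = x0"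
      using aG[OF j(1)] x0(1) by (simp flip: m_assoc)
    ultimately have fj: "?f j \<le> m + r / 4"
      using x0(2) by (simp only:)
    \<comment> \<open>The summand \<open>j\<close> is at most \<open>m + r / 4\<close>, with
      \<open>r / 8\<close> from the net and \<open>r / 8\<close> from the choice of
      \<open>x0\<close>; the others are bounded by \<open>m + s\<close> only.\<close>
    have "(\<Sum>i<N. ?f i) = ?f j + (\<Sum>i\<in>{..<N} - {j}. ?f i)"
      using j(1) by (simp add: sum.remove)
    also have "\<dots> \<le> (m + r / 4) + (\<Sum>i\<in>{..<N} - {j}. m + s)"
      using fj le_s k x by (intro add_mono sum_mono) auto
    also have "\<dots> = (m + r / 4) + (real N - 1) * (m + s)"
      using j(1) by (simp add: of_nat_diff)
    finally have "(\<Sum>i<N. ?f i) \<le> real N * m + ((real N - 1) * s + r / 4)"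
      by (simp add: algebra_simps)
    then have 1: "\<Lambda>' F x \<le> m + ((real N - 1) * s + r / 4) / real N"
      unfolding \<Lambda>'_def using N by (simp add: field_simps)
    have "real N * m \<le> (\<Sum>i<N. ?H (y \<otimes> (inv (a i) \<otimes> x0)))"
      using sum_mono[of "{..<N}" "\<lambda>_. m" "\<lambda>i. ?H (y \<otimes> (inv (a i) \<otimes> x0))"] m_le k y by simp
    then have "m \<le> \<Lambda>' F y"
      unfolding \<Lambda>'_def using N by (simp add: field_simps)
    then show ?thesis
      using 1 by simp
  qed
  ultimately have "((real N - 1) * s + r / 4) / real N \<in> Osc"
    unfolding Osc_def by blast
  then have "r \<le> ((real N - 1) * s + r / 4) / real N"
    unfolding r_def using bdd by (rule cInf_lower)
  then have "real N * r \<le> (real N - 1) * s + r / 4"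
    using N by (simp add: field_simps)
  also have "(real N - 1) * s \<le> (real N - 1) * (r + r / (4 * real N))"
    using s(2) N by (intro mult_left_mono) auto
  also have "\<dots> \<le> (real N - 1) * r + r / 4"
    using N r0 by (simp add: field_simps)
  finally show False
    using r0 by (simp add: algebra_simps)
qed

text \<open>The next function is flattened after the averaging already found. The earlier ones stay
  flat, since averaging takes values between the bounds of the function averaged and so cannot
  increase oscillation.\<close>

lemma almost_periodic_flatten_family:
  fixes m :: nat
  assumes F: "\<And>i. i < m \<Longrightarrow> almost_periodic G (F i)" and "\<tau> > 0"
  shows "\<exists>\<Lambda>\<in>averages G. \<forall>i<m. \<forall>x\<in>carrier G. \<forall>y\<in>carrier G. \<Lambda> (F i) x - \<Lambda> (F i) y \<le> \<tau>"
  using F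
proof (induction m)
  case 0
  then show ?case
    using averages.id by blast
next
  case (Suc m)
  then obtain \<Lambda> where \<Lambda>: "\<Lambda> \<in> averages G"
    and flat: "\<And>i x y. i < m \<Longrightarrow> x \<in> carrier G \<Longrightarrow> y \<in> carrier G \<Longrightarrow> \<Lambda> (F i) x - \<Lambda> (F i) y \<le> \<tau>"
    by (metis less_Suc_eq)
  obtain \<Lambda>' where \<Lambda>': "\<Lambda>' \<in> averages G"
    and flat': "\<And>x y. x \<in> carrier G \<Longrightarrow> y \<in> carrier G \<Longrightarrow> \<Lambda>' (\<Lambda> (F m)) x - \<Lambda>' (\<Lambda> (F m)) y \<le> \<tau>"
    using almost_periodic_flatten[OF almost_periodic_average[OF Suc.prems[OF lessI] \<Lambda>] \<open>\<tau> > 0\<close>] by blast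
  have "\<Lambda>' (\<Lambda> (F i)) x - \<Lambda>' (\<Lambda> (F i)) y \<le> \<tau>"
    if "i < Suc m" and x: "x \<in> carrier G" and y: "y \<in> carrier G" for i x y
  proof (cases "i = m")
    case False
    then have i: "i < m"
      using that by simp
    have "\<Lambda>' (\<Lambda> (F i)) x - \<tau> \<le> \<Lambda> (F i) z" if z: "z \<in> carrier G" for z
      using averages_le[OF \<Lambda>' x, of "\<Lambda> (F i)" "\<Lambda> (F i) z + \<tau>"] flat[OF i _ z] by (simp add: algebra_simps)
    then have "\<Lambda>' (\<Lambda> (F i)) x - \<tau> \<le> \<Lambda>' (\<Lambda> (F i)) y"
      by (rule averages_ge[OF \<Lambda>' y])
    then show ?thesis
      by simp
  qed (use flat' x y in simp)
  then show ?case
    by (intro bexI[OF _ averages_compose[OF \<Lambda>' \<Lambda>]]) simp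
qed

end

section \<open>Quadratic extension of functions on the sphere\<close>

text \<open>Because of the weight \<open>\<parallel>x\<parallel>\<^sup>2\<close>, summation over the entries of a tuple \<open>v\<close> with
  \<open>tuple_sq n v = 1\<close> is a mean on the sphere, and small entries need no separate treatment.\<close>

definition quadratic_extension :: "('h::complex_hilbert \<Rightarrow> real) \<Rightarrow> 'h \<Rightarrow> real" where
  "quadratic_extension h x = (norm x)\<^sup>2 * h (sgn x)"

definition tuple_integral :: "('h::complex_hilbert \<Rightarrow> real) \<Rightarrow> nat \<Rightarrow> (nat \<Rightarrow> 'h) \<Rightarrow> real" where
  "tuple_integral h n v = (\<Sum>j<n. quadratic_extension h (v j))"

text \<open>The rescaled difference of directions splits into a difference of lengths along
  \<open>sgn x\<close> and the vector \<open>x - y\<close>; each has norm at most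
  \<open>norm (x - y)\<close>.\<close>

lemma dist_sgn_le:
  fixes x y :: "'a::real_normed_vector"
  assumes "x \<noteq> 0" "y \<noteq> 0"
  shows "norm y * dist (sgn x) (sgn y) \<le> 2 * norm (x - y)"
proof -
  have "norm y *\<^sub>R (sgn x - sgn y) = (norm y - norm x) *\<^sub>R sgn x + (x - y)"
    using assms by (simp add: sgn_div_norm algebra_simps)
  then have "norm y * dist (sgn x) (sgn y) = norm ((norm y - norm x) *\<^sub>R sgn x + (x - y))"
    by (metis abs_norm_cancel dist_norm norm_scaleR)
  also have "\<dots> \<le> \<bar>norm y - norm x\<bar> + norm (x - y)"
    using assms norm_triangle_ineq[of "(norm y - norm x) *\<^sub>R sgn x" "x - y"] by (simp add: norm_sgn)
  also have "\<dots> \<le> 2 * norm (x - y)"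
    using norm_triangle_ineq3[of x y] by (simp add: abs_minus_commute)
  finally show ?thesis .
qed

lemma quadratic_extension_bound:
  assumes "\<And>x. x \<in> sphere 0 1 \<Longrightarrow> \<bar>h x\<bar> \<le> M"
  shows "\<bar>quadratic_extension h x\<bar> \<le> M * (norm x)\<^sup>2"
proof (cases "x = 0")
  case False
  then have "\<bar>h (sgn x)\<bar> \<le> M"
    by (intro assms) (simp add: norm_sgn)
  then show ?thesis
    by (simp add: quadratic_extension_def abs_mult mult_right_mono mult.commute)
qed (simp add: quadratic_extension_def)

text \<open>A modulus of continuity in a form that can be summed over the entries of tuples: the
  first term becomes the squared Hilbert--Schmidt distance, and the error is \<open>\<tau>\<close>
  times the total mass, independent of the length.\<close>

lemma quadratic_extension_continuity:
  fixes h :: "'h::complex_hilbert \<Rightarrow> real"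
  assumes uc: "uniformly_continuous_on (sphere 0 1) h"
    and M: "\<And>x. x \<in> sphere 0 1 \<Longrightarrow> \<bar>h x\<bar> \<le> M" and "\<tau> > 0"
  shows "\<exists>C\<ge>0. \<forall>x y. \<bar>quadratic_extension h x - quadratic_extension h y\<bar> \<le>
    C * (norm (x - y))\<^sup>2 + \<tau> * ((norm x)\<^sup>2 + (norm y)\<^sup>2)"
proof -
  obtain \<delta> where \<delta>: "\<delta> > 0" "\<And>x y. x \<in> sphere 0 1 \<Longrightarrow> y \<in> sphere 0 1 \<Longrightarrow> dist x y < \<delta> \<Longrightarrow>
      \<bar>h x - h y\<bar> < \<tau> / 2"
    using uc \<open>\<tau> > 0\<close> unfolding uniformly_continuous_on_def by (metis dist_real_def half_gt_zero)
  \<comment> \<open>\<open>M\<close> itself may be negative if the sphere is empty.\<close>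
  define M' where "M' = \<bar>M\<bar> + 1"
  have "M' > 0"
    by (simp add: M'_def)
  moreover have "\<bar>h x\<bar> \<le> M'" if "x \<in> sphere 0 1" for x
    using M[OF that] by (simp add: M'_def)
  ultimately have M': "M' > 0" "\<And>x. x \<in> sphere 0 1 \<Longrightarrow> \<bar>h x\<bar> \<le> M'"
    by blast+
  \<comment> \<open>The three summands serve the case of a zero vector, Young's inequality for the
    change of the weight, and directions that are at least \<open>\<delta>\<close> apart.\<close>
  define C where "C = M' + M'\<^sup>2 / (\<tau> / 2) + 8 * M' / \<delta>\<^sup>2"
  have C: "C \<ge> M'" "C \<ge> 0"
    unfolding C_def using M'(1) \<delta>(1) \<open>\<tau> > 0\<close> by (auto intro!: add_nonneg_nonneg)
  note ext_le = quadratic_extension_bound[of h M', OF M'(2)]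
  have "\<bar>quadratic_extension h x - quadratic_extension h y\<bar> \<le>
      C * (norm (x - y))\<^sup>2 + \<tau> * ((norm x)\<^sup>2 + (norm y)\<^sup>2)" for x y
  proof (cases "x = 0 \<or> y = 0")
    case True
    then have "\<bar>quadratic_extension h x - quadratic_extension h y\<bar> \<le> M' * (norm (x - y))\<^sup>2"
      using ext_le[of x] ext_le[of y] by (auto simp: quadratic_extension_def)
    also have "\<dots> \<le> C * (norm (x - y))\<^sup>2"
      using C(1) by (rule mult_right_mono) simp
    finally show ?thesis
      using \<open>\<tau> > 0\<close> by (smt (verit) mult_nonneg_nonneg zero_le_power2)
  next
    case False
    define d where "d = norm (x - y)"
    have xy: "sgn x \<in> sphere 0 1" "sgn y \<in> sphere 0 1"
      using False by (auto simp: norm_sgn)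
    have "quadratic_extension h x - quadratic_extension h y =
        ((norm x)\<^sup>2 - (norm y)\<^sup>2) * h (sgn x) + (norm y)\<^sup>2 * (h (sgn x) - h (sgn y))"
      by (simp add: quadratic_extension_def algebra_simps)
    then have "\<bar>quadratic_extension h x - quadratic_extension h y\<bar> \<le>
        \<bar>(norm x)\<^sup>2 - (norm y)\<^sup>2\<bar> * \<bar>h (sgn x)\<bar> + (norm y)\<^sup>2 * \<bar>h (sgn x) - h (sgn y)\<bar>"
      using abs_triangle_ineq[of "((norm x)\<^sup>2 - (norm y)\<^sup>2) * h (sgn x)"
          "(norm y)\<^sup>2 * (h (sgn x) - h (sgn y))"] by (simp only: abs_mult abs_power2)
    moreover have "\<bar>(norm x)\<^sup>2 - (norm y)\<^sup>2\<bar> * \<bar>h (sgn x)\<bar> \<le>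
        M'\<^sup>2 / (\<tau> / 2) * d\<^sup>2 + \<tau> / 2 * ((norm x)\<^sup>2 + (norm y)\<^sup>2)"
    proof -
      have "\<bar>(norm x)\<^sup>2 - (norm y)\<^sup>2\<bar> = \<bar>norm x - norm y\<bar> * (norm x + norm y)"
        by (simp add: power2_eq_square square_diff_square_factored abs_mult)
      also have "\<dots> \<le> d * (norm x + norm y)"
        unfolding d_def by (intro mult_right_mono norm_triangle_ineq3) simp
      finally have "\<bar>(norm x)\<^sup>2 - (norm y)\<^sup>2\<bar> * \<bar>h (sgn x)\<bar> \<le> d * (norm x + norm y) * M'"
        using M'(2)[OF xy(1)] by (intro mult_mono) (auto simp: d_def)
      also have "\<dots> \<le> M'\<^sup>2 / (\<tau> / 2) * d\<^sup>2 + \<tau> / 2 * ((norm x + norm y) / 2)\<^sup>2"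
      proof -
        define p q where "p = norm x + norm y" and "q = \<tau> / 2"
        have "q > 0"
          using \<open>\<tau> > 0\<close> by (simp add: q_def)
        have "0 \<le> (M' * d - q * p / 2)\<^sup>2 / q"
          using \<open>q > 0\<close> by simp
        also have "\<dots> = M'\<^sup>2 / q * d\<^sup>2 + q * (p / 2)\<^sup>2 - d * p * M'"
          using \<open>q > 0\<close> by (simp add: power2_eq_square field_simps)
        finally show ?thesis
          by (simp add: p_def q_def)
      qed
      also have "((norm x + norm y) / 2)\<^sup>2 \<le> (norm x)\<^sup>2 + (norm y)\<^sup>2"
      proof -
        have "0 \<le> ((norm x - norm y)\<^sup>2 + 2 * (norm x)\<^sup>2 + 2 * (norm y)\<^sup>2) / 4"
          by simp
        also have "\<dots> = (norm x)\<^sup>2 + (norm y)\<^sup>2 - ((norm x + norm y) / 2)\<^sup>2"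
          by (simp add: power2_eq_square field_simps)
        finally show ?thesis
          by simp
      qed
      finally show ?thesis
        using \<open>\<tau> > 0\<close> by (simp add: mult_left_mono)
    qed
    moreover have "(norm y)\<^sup>2 * \<bar>h (sgn x) - h (sgn y)\<bar> \<le>
        8 * M' / \<delta>\<^sup>2 * d\<^sup>2 + \<tau> / 2 * (norm y)\<^sup>2"
    proof (cases "dist (sgn x) (sgn y) < \<delta>")
      case True
      then have "(norm y)\<^sup>2 * \<bar>h (sgn x) - h (sgn y)\<bar> \<le> (norm y)\<^sup>2 * (\<tau> / 2)"
        using \<delta>(2)[OF xy] by (intro mult_left_mono) auto
      moreover have "0 \<le> 8 * M' / \<delta>\<^sup>2 * d\<^sup>2"
        using M'(1) by simp
      ultimately show ?thesis
        by (simp add: mult.commute)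
    next
      \<comment> \<open>If the directions are far apart, then \<open>norm y\<close> is at most
        \<open>2 * d / \<delta>\<close>, so the crude bound \<open>2 * M'\<close> for the values is
        absorbed by \<open>d\<^sup>2\<close>.\<close>
      case False
      have "norm y * \<delta> \<le> norm y * dist (sgn x) (sgn y)"
        using False by (intro mult_left_mono) auto
      also have "\<dots> \<le> 2 * d"
        unfolding d_def using \<open>\<not> (x = 0 \<or> y = 0)\<close> by (intro dist_sgn_le) auto
      finally have "(norm y * \<delta>)\<^sup>2 \<le> (2 * d)\<^sup>2"
        using \<delta>(1) by (intro power_mono) auto
      then have "(norm y)\<^sup>2 \<le> 4 * d\<^sup>2 / \<delta>\<^sup>2"
        using \<delta>(1) by (simp add: field_simps power_mult_distrib)
      moreover have "\<bar>h (sgn x) - h (sgn y)\<bar> \<le> 2 * M'"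
        using M'(2)[OF xy(1)] M'(2)[OF xy(2)] by simp
      ultimately have "(norm y)\<^sup>2 * \<bar>h (sgn x) - h (sgn y)\<bar> \<le> 4 * d\<^sup>2 / \<delta>\<^sup>2 * (2 * M')"
        by (intro mult_mono) auto
      moreover have "0 \<le> \<tau> / 2 * (norm y)\<^sup>2"
        using \<open>\<tau> > 0\<close> by simp
      ultimately show ?thesis
        by (simp add: mult_ac)
    qed
    moreover have "M'\<^sup>2 / (\<tau> / 2) * d\<^sup>2 + 8 * M' / \<delta>\<^sup>2 * d\<^sup>2 \<le> C * d\<^sup>2"
      unfolding C_def distrib_right using M'(1) by simp
    moreover have "\<tau> / 2 * ((norm x)\<^sup>2 + (norm y)\<^sup>2) + \<tau> / 2 * (norm y)\<^sup>2 \<le>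
        \<tau> * ((norm x)\<^sup>2 + (norm y)\<^sup>2)"
      using \<open>\<tau> > 0\<close> by (simp add: algebra_simps)
    ultimately show ?thesis
      unfolding d_def by linarith
  qed
  then show ?thesis
    using C(2) by blast
qed

section \<open>Separation from a cone\<close>

text \<open>An element \<open>(c, t)\<close> demands that the functional be at least
  \<open>t\<close> at \<open>c\<close>. The infimum over the cone of \<open>sup (a + c) - t\<close>
  is sublinear in \<open>a\<close>, and \<open>C_le\<close> keeps it finite; a linear functional
  below it meets all demands at once.\<close>

lemma cone_separation:
  fixes C :: "(('a \<Rightarrow> real) \<times> real) set"
  assumes X: "function_subspace X" and Z: "Z \<noteq> {}"
    and bdd: "\<And>a. a \<in> X \<Longrightarrow> \<exists>M. \<forall>z\<in>Z. \<bar>a z\<bar> \<le> M"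
    and CX: "\<And>c t. (c, t) \<in> C \<Longrightarrow> c \<in> X"
    and C_le: "\<And>c t. (c, t) \<in> C \<Longrightarrow> t \<le> (SUP z\<in>Z. c z)"
    and C_add: "\<And>c t d s. (c, t) \<in> C \<Longrightarrow> (d, s) \<in> C \<Longrightarrow> ((\<lambda>z. c z + d z), t + s) \<in> C"
    and C_scale: "\<And>r c t. r > 0 \<Longrightarrow> (c, t) \<in> C \<Longrightarrow> ((\<lambda>z. r * c z), r * t) \<in> C"
    and C_zero: "((\<lambda>z. 0), 0) \<in> C"
  shows "\<exists>l. linear_functional_on X l \<and> (\<forall>a\<in>X. l a \<le> (SUP z\<in>Z. a z)) \<and> (\<forall>(c, t)\<in>C. t \<le> l c)"
proof -
  note Xc = function_subspaceD[OF X]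
  define S where "S a = (SUP z\<in>Z. a z)" for a :: "'a \<Rightarrow> real"
  have S_upper: "a z \<le> S a" if "a \<in> X" "z \<in> Z" for a z
  proof -
    obtain M where "\<And>z. z \<in> Z \<Longrightarrow> \<bar>a z\<bar> \<le> M"
      using bdd[OF \<open>a \<in> X\<close>] by blast
    then have "bdd_above (a ` Z)"
      by (intro bdd_aboveI2[of _ _ M]) (simp add: abs_le_iff)
    then show ?thesis
      unfolding S_def using \<open>z \<in> Z\<close> by (intro cSUP_upper)
  qed
  have S_least: "S a \<le> M" if "\<And>z. z \<in> Z \<Longrightarrow> a z \<le> M" for a M
    unfolding S_def using Z that by (rule cSUP_least)
  have S_add: "S (\<lambda>z. a z + b z) \<le> S a + S b" if "a \<in> X" "b \<in> X" for a b
    using S_upper that by (intro S_least add_mono) auto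
  have S_scale: "S (\<lambda>z. r * a z) = r * S a" if a: "a \<in> X" and r: "r > 0" for a r
  proof (rule antisym)
    show "S (\<lambda>z. r * a z) \<le> r * S a"
      using S_upper[OF a] r by (intro S_least) simp
    have "a z \<le> S (\<lambda>z. r * a z) / r" if "z \<in> Z" for z
      using S_upper[OF Xc(3)[OF a, of r] that] r by (simp add: field_simps)
    then have "S a \<le> S (\<lambda>z. r * a z) / r"
      by (rule S_least)
    then show "r * S a \<le> S (\<lambda>z. r * a z)"
      using r by (simp add: field_simps)
  qed
  have S_zero: "S (\<lambda>z. 0) = 0"
    unfolding S_def using Z by simp
  define e where "e a x = S (\<lambda>z. a z + fst x z) - snd x" for a and x :: "('a \<Rightarrow> real) \<times> real"
  define p where "p a = (INF x\<in>C. e a x)" for a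
  have lower: "- S (\<lambda>z. - a z) \<le> e a x" if a: "a \<in> X" and x: "x \<in> C" for a x
  proof -
    obtain c t where ct: "x = (c, t)"
      by (cases x)
    have c: "c \<in> X" "t \<le> S c"
      using CX C_le x unfolding ct S_def by auto
    have "S (\<lambda>z. (a z + c z) + - a z) \<le> S (\<lambda>z. a z + c z) + S (\<lambda>z. - a z)"
      using a c Xc by (intro S_add) auto
    then show ?thesis
      using c by (simp add: e_def ct)
  qed
  have p_le: "p a \<le> e a x" if "a \<in> X" "x \<in> C" for a x
    unfolding p_def using lower[OF that(1)] that(2) by (intro cINF_lower bdd_belowI2) auto
  have p_ge: "m \<le> p a" if "\<And>x. x \<in> C \<Longrightarrow> m \<le> e a x" for m a
    unfolding p_def using C_zero that by (intro cINF_greatest) auto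
  have "sublinear_on X p"
    unfolding sublinear_on_def
  proof (intro conjI ballI allI impI)
    fix a b assume ab: "a \<in> X" "b \<in> X"
    have "p (\<lambda>z. a z + b z) - e a x \<le> p b" if x: "x \<in> C" for x
    proof (rule p_ge)
      fix y assume y: "y \<in> C"
      obtain c t d s where xy: "x = (c, t)" "y = (d, s)"
        by (cases x; cases y)
      have cd: "c \<in> X" "d \<in> X"
        using CX x y unfolding xy by auto
      have "p (\<lambda>z. a z + b z) \<le> e (\<lambda>z. a z + b z) ((\<lambda>z. c z + d z), t + s)"
        using ab x y Xc C_add unfolding xy by (intro p_le) auto
      also have "\<dots> = S (\<lambda>z. (a z + c z) + (b z + d z)) - t - s"
        by (simp add: e_def algebra_simps)
      also have "\<dots> \<le> e a x + e b y"
        using S_add[of "\<lambda>z. a z + c z" "\<lambda>z. b z + d z"] ab cd Xc by (simp add: e_def xy)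
      finally show "p (\<lambda>z. a z + b z) - e a x \<le> e b y"
        by simp
    qed
    then have "p (\<lambda>z. a z + b z) - p b \<le> p a"
      by (intro p_ge) (simp add: algebra_simps)
    then show "p (\<lambda>z. a z + b z) \<le> p a + p b"
      by simp
  next
    fix r :: real and a assume r: "r \<ge> 0" and a: "a \<in> X"
    show "p (\<lambda>z. r * a z) = r * p a"
    proof (cases "r = 0")
      case True
      have "0 \<le> p (\<lambda>z. 0)"
        using C_le by (intro p_ge) (auto simp: e_def S_def)
      moreover have "p (\<lambda>z. 0) \<le> 0"
        using p_le[OF Xc(1) C_zero] by (simp add: e_def S_zero)
      ultimately show ?thesis
        using True by simp
    next
      case False
      then have r: "r > 0"
        using r by simp
      have e_scale: "e (\<lambda>z. s * b z) ((\<lambda>z. s * c z), s * t) = s * e b (c, t)"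
        if "(c, t) \<in> C" "b \<in> X" "s > 0" for b c s t
        using S_scale[of "\<lambda>z. b z + c z" s] that CX Xc by (simp add: e_def algebra_simps)
      have "p (\<lambda>z. r * a z) / r \<le> p a"
      proof (rule p_ge)
        fix x assume x: "x \<in> C"
        obtain c t where ct: "x = (c, t)"
          by (cases x)
        have "p (\<lambda>z. r * a z) \<le> r * e a x"
          using p_le[OF Xc(3)[OF a] C_scale[OF r]] e_scale[OF _ a r] x unfolding ct by metis
        then show "p (\<lambda>z. r * a z) / r \<le> e a x"
          using r by (simp add: field_simps)
      qed
      moreover have "r * p a \<le> p (\<lambda>z. r * a z)"
      proof (rule p_ge)
        fix x assume x: "x \<in> C"
        obtain c t where ct: "x = (c, t)"
          by (cases x)
        have "p a \<le> e a ((\<lambda>z. 1 / r * c z), 1 / r * t)"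
          using x r unfolding ct by (intro p_le[OF a] C_scale) auto
        also have "\<dots> = e (\<lambda>z. 1 / r * (r * a z)) ((\<lambda>z. 1 / r * c z), 1 / r * t)"
          using r by simp
        also have "\<dots> = 1 / r * e (\<lambda>z. r * a z) x"
          using x r unfolding ct by (intro e_scale Xc(3)[OF a]) auto
        finally show "r * p a \<le> e (\<lambda>z. r * a z) x"
          using r by (simp add: field_simps)
      qed
      ultimately show ?thesis
        using r by (simp add: field_simps)
    qed
  qed
  then obtain l where l: "linear_functional_on X l" and lp: "\<And>a. a \<in> X \<Longrightarrow> l a \<le> p a"
    using hahn_banach[OF X] by blast
  have "l a \<le> S a" if "a \<in> X" for a
    using lp[OF that] p_le[OF that C_zero] by (simp add: e_def)
  moreover have "t \<le> l c" if ct: "(c, t) \<in> C" for c t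
  proof -
    have c: "c \<in> X"
      using CX[OF ct] .
    have "l (\<lambda>z. -1 * c z) = -1 * l c"
      using l c by (rule linear_functional_onD)
    \<comment> \<open>At \<open>- c\<close> the cone element \<open>(c, t)\<close> itself leaves the
      supremum of 0, minus \<open>t\<close>.\<close>
    moreover have "l (\<lambda>z. - c z) \<le> e (\<lambda>z. - c z) (c, t)"
      using lp[OF Xc(4)[OF c]] p_le[OF Xc(4)[OF c] ct] by simp
    ultimately show ?thesis
      by (simp add: e_def S_zero)
  qed
  ultimately show ?thesis
    using l unfolding S_def by blast
qed

section \<open>Almost invariant tuples\<close>

lemma unitary_operatorD:
  assumes "unitary_operator u"
  shows "u \<in> bounded_operators" "cinner (u x) (u y) = cinner x y" "norm (u x) = norm x"
    "u (inv_into UNIV u x) = x" "inv_into UNIV u (u x) = x"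
proof -
  show bop: "u \<in> bounded_operators" and inn: "cinner (u x) (u y) = cinner x y" for x y
    using assms by (auto simp: unitary_operator_def)
  show n: "norm (u x) = norm x" for x
  proof -
    have "(norm (u x))\<^sup>2 = (norm x)\<^sup>2"
      using inn[of x x] by (simp only: flip: Re_cinner_self)
    then show ?thesis
      by simp
  qed
  show "u (inv_into UNIV u x) = x"
    using assms by (auto simp: unitary_operator_def intro: surj_f_inv_f)
  have "inj u"
  proof (rule injI)
    fix x y assume "u x = u y"
    then have "norm (u (x - y)) = 0"
      by (simp add: bounded_operatorsD[OF bop])
    then show "x = y"
      by (simp add: n)
  qed
  then show "inv_into UNIV u (u x) = x"
    by simp
qed

lemma unitary_operator_inv:
  assumes u: "unitary_operator u"
  shows "unitary_operator (inv_into UNIV u)"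
proof -
  let ?v = "inv_into UNIV u"
  note uD = unitary_operatorD[OF u] and bop = bounded_operatorsD[OF unitary_operatorD(1)[OF u]]
  have inner: "cinner (?v x) (?v y) = cinner x y" for x y
    using uD(2)[of "?v x" "?v y"] by (simp add: uD(4))
  have "?v \<in> bounded_operators"
  proof (rule bounded_operatorsI)
    show "?v (x + y) = ?v x + ?v y" for x y
      using bop(1)[of "?v x" "?v y"] uD(4,5) by metis
    show "?v (c *\<^sub>C x) = c *\<^sub>C ?v x" for c x
      using bop(2)[of c "?v x"] uD(4,5) by metis
    show "norm (?v x) \<le> 1 * norm x" for x
      using uD(3)[of "?v x"] by (simp add: uD(4))
  qed
  moreover have "surj ?v"
    using uD(5) by (metis surjI)
  ultimately show ?thesis
    using inner by (simp add: unitary_operator_def)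
qed

lemma bounded_operators_closed:
  shows "S \<in> bounded_operators \<Longrightarrow> T \<in> bounded_operators \<Longrightarrow> (\<lambda>x. S x + T x) \<in> bounded_operators"
    and "T \<in> bounded_operators \<Longrightarrow> (\<lambda>x. c *\<^sub>C T x) \<in> bounded_operators"
    and "S \<in> bounded_operators \<Longrightarrow> T \<in> bounded_operators \<Longrightarrow> S \<circ> T \<in> bounded_operators"
    and "id \<in> bounded_operators"
    and "(\<lambda>x. 0) \<in> bounded_operators"
proof -
  show "(\<lambda>x. S x + T x) \<in> bounded_operators" if "S \<in> bounded_operators" "T \<in> bounded_operators"
  proof (rule bounded_operatorsI)
    show "norm (S x + T x) \<le> (onorm S + onorm T) * norm x" for x
      using bounded_operatorsD(7)[OF that(1), of x] bounded_operatorsD(7)[OF that(2), of x]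
        norm_triangle_ineq[of "S x" "T x"] by (simp add: distrib_right)
  qed (simp_all add: bounded_operatorsD[OF that(1)] bounded_operatorsD[OF that(2)] scaleC_add_right)
  show "(\<lambda>x. c *\<^sub>C T x) \<in> bounded_operators" if "T \<in> bounded_operators"
  proof (rule bounded_operatorsI)
    show "norm (c *\<^sub>C T x) \<le> (cmod c * onorm T) * norm x" for x
      using bounded_operatorsD(7)[OF that, of x] by (simp add: norm_scaleC mult_left_mono mult.assoc)
  qed (simp_all add: bounded_operatorsD[OF that] scaleC_add_right scaleC_scaleC mult.commute)
  show "S \<circ> T \<in> bounded_operators" if "S \<in> bounded_operators" "T \<in> bounded_operators"
  proof (rule bounded_operatorsI)
    show "norm ((S \<circ> T) x) \<le> (onorm S * onorm T) * norm x" for x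
    proof -
      have "0 \<le> onorm S"
        using that(1) by (simp add: bounded_operators_def onorm_pos_le)
      then have "onorm S * norm (T x) \<le> onorm S * (onorm T * norm x)"
        by (intro mult_left_mono bounded_operatorsD(7)[OF that(2)])
      then show ?thesis
        using bounded_operatorsD(7)[OF that(1), of "T x"] by (simp add: mult.assoc)
    qed
  qed (simp_all add: bounded_operatorsD[OF that(1)] bounded_operatorsD[OF that(2)])
  show "id \<in> bounded_operators"
    by (rule bounded_operatorsI[of _ 1]) simp_all
  show "(\<lambda>x. 0) \<in> bounded_operators"
    by (rule bounded_operatorsI[of _ 0]) simp_all
qed

definition operator_state :: "(('h::complex_hilbert \<Rightarrow> 'h) \<Rightarrow> complex) \<Rightarrow> bool" where
  "operator_state \<phi> \<longleftrightarrow>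
     (\<forall>S\<in>bounded_operators. \<forall>T\<in>bounded_operators. \<phi> (\<lambda>x. S x + T x) = \<phi> S + \<phi> T) \<and>
     (\<forall>c. \<forall>T\<in>bounded_operators. \<phi> (\<lambda>x. c *\<^sub>C T x) = c * \<phi> T) \<and>
     (\<forall>T. positive_operator T \<longrightarrow> \<phi> T \<in> \<real>\<^sub>\<ge>\<^sub>0) \<and> \<phi> id = 1"

lemma operator_stateD:
  assumes "operator_state \<phi>"
  shows "S \<in> bounded_operators \<Longrightarrow> T \<in> bounded_operators \<Longrightarrow> \<phi> (\<lambda>x. S x + T x) = \<phi> S + \<phi> T"
    and "T \<in> bounded_operators \<Longrightarrow> \<phi> (\<lambda>x. c *\<^sub>C T x) = c * \<phi> T"
    and "positive_operator T \<Longrightarrow> \<phi> T \<in> \<real>\<^sub>\<ge>\<^sub>0" and "\<phi> id = 1"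
  using assms by (auto simp: operator_state_def)

lemma operator_state_sum:
  fixes m :: nat
  assumes \<phi>: "operator_state \<phi>" and T: "\<And>i. i < m \<Longrightarrow> T i \<in> bounded_operators"
  shows "(\<lambda>x. \<Sum>i<m. T i x) \<in> bounded_operators \<and> \<phi> (\<lambda>x. \<Sum>i<m. T i x) = (\<Sum>i<m. \<phi> (T i))"
  using T
proof (induction m)
  case 0
  show ?case
    using operator_stateD(2)[OF \<phi> bounded_operators_closed(5), of 0] bounded_operators_closed(5) by simp
next
  case (Suc m)
  then show ?case
    using operator_stateD(1)[OF \<phi>, of "\<lambda>x. \<Sum>i<m. T i x" "T m"]
      bounded_operators_closed(1)[of "\<lambda>x. \<Sum>i<m. T i x" "T m"] by simp
qed

lemma sum_concat:
  fixes n k :: nat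
  shows "(\<Sum>j<n + k. f (if j < n then v j else w (j - n))) = (\<Sum>j<n. f (v j)) + (\<Sum>j<k. f (w j))"
  by (induction k) (simp_all add: add.assoc)

lemma linear_functional_on_sum:
  fixes m :: nat
  assumes X: "function_subspace X" and l: "linear_functional_on X l"
    and f: "\<And>i. i < m \<Longrightarrow> f i \<in> X"
  shows "(\<lambda>z. \<Sum>i<m. f i z) \<in> X \<and> l (\<lambda>z. \<Sum>i<m. f i z) = (\<Sum>i<m. l (f i))"
  using f
proof (induction m)
  case 0
  have "l (\<lambda>z. 0 * 0) = 0 * l (\<lambda>z. 0)"
    using l function_subspaceD(1)[OF X] by (rule linear_functional_onD)
  then show ?case
    using function_subspaceD(1)[OF X] by simp
next
  case (Suc m)
  then have IH: "(\<lambda>z. \<Sum>i<m. f i z) \<in> X" "l (\<lambda>z. \<Sum>i<m. f i z) = (\<Sum>i<m. l (f i))" and fm: "f m \<in> X"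
    by auto
  have "l (\<lambda>z. (\<Sum>i<m. f i z) + f m z) = l (\<lambda>z. \<Sum>i<m. f i z) + l (f m)"
    using l IH(1) fm by (rule linear_functional_onD)
  then show ?case
    using IH(2) function_subspaceD(2)[OF X IH(1) fm] by simp
qed

text \<open>The form \<open>q\<close> is symmetrised so that its Riesz representation is self-adjoint.\<close>

lemma operator_of_functional:
  fixes J :: "('i \<times> ('h::complex_hilbert \<Rightarrow> 'h)) set"
  defines "X \<equiv> {a :: 'i \<times> ('h \<Rightarrow> 'h) \<Rightarrow> real. \<exists>M. \<forall>z. \<bar>a z\<bar> \<le> M}"
  assumes J: "\<And>i T. (i, T) \<in> J \<Longrightarrow> T \<in> contractions"
    and l: "linear_functional_on X l" and bound: "\<And>a M. a \<in> X \<Longrightarrow> (\<And>z. a z \<le> M) \<Longrightarrow> l a \<le> M"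
  defines "q \<equiv> \<lambda>i x y (j, T). if j = i \<and> (j, T) \<in> J
     then (Re (cinner (T x) y) + Re (cinner (T y) x)) / 2 else 0"
  shows "\<exists>A\<in>bounded_operators. \<forall>x. cinner (A x) x = complex_of_real (l (q i x x))"
    and "q i x y \<in> X"
proof -
  have half: "\<bar>(a + b) / 2\<bar> \<le> d" if "\<bar>a\<bar> \<le> d" "\<bar>b\<bar> \<le> d" for a b d :: real
    using that unfolding abs_le_iff by (auto simp: field_simps)
  have q_le: "\<bar>q i x y z\<bar> \<le> norm x * norm y" for x y z
  proof (cases z)
    case (Pair j T)
    have "\<bar>Re (cinner (T x) y)\<bar> \<le> norm x * norm y" "\<bar>Re (cinner (T y) x)\<bar> \<le> norm x * norm y"
      if "(j, T) \<in> J"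
    proof -
      note T = contractionsD(2)[OF J[OF that]]
      show "\<bar>Re (cinner (T x) y)\<bar> \<le> norm x * norm y"
        by (rule order.trans[OF Re_cinner_le mult_right_mono[OF T norm_ge_zero]])
      have "\<bar>Re (cinner (T y) x)\<bar> \<le> norm y * norm x"
        by (rule order.trans[OF Re_cinner_le mult_right_mono[OF T norm_ge_zero]])
      then show "\<bar>Re (cinner (T y) x)\<bar> \<le> norm x * norm y"
        by (simp add: mult.commute)
    qed
    then have "\<bar>(Re (cinner (T x) y) + Re (cinner (T y) x)) / 2\<bar> \<le> norm x * norm y" if "(j, T) \<in> J"
      by (rule half) (use that in auto)
    then show ?thesis
      unfolding Pair q_def by auto
  qed
  then show qX: "q i x y \<in> X" for x y
    unfolding X_def by blast
  note l_add = linear_functional_onD(1)[OF l] and l_scale = linear_functional_onD(2)[OF l]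
  have Jb: "T \<in> bounded_operators" if "(j, T) \<in> J" for j T
    using contractionsD(1)[OF J[OF that]] .
  have q_add: "q i x (y + y') = (\<lambda>z. q i x y z + q i x y' z)" for x y y'
    unfolding q_def fun_eq_iff by (auto simp: bounded_operatorsD[OF Jb] cinner_simps add_divide_distrib)
  have q_scale: "q i x (r *\<^sub>R y) = (\<lambda>z. r * q i x y z)" for x y r
    unfolding q_def fun_eq_iff
    by (auto simp: bounded_operatorsD[OF Jb] cinner_simps algebra_simps add_divide_distrib)
  have q_commute: "q i x y = q i y x" for x y
    unfolding q_def by (auto simp: fun_eq_iff)
  \<comment> \<open>The Riesz vector depends on \<open>x\<close> only through real parts; moving the
    scalar to the other argument recovers complex homogeneity of \<open>A\<close>.\<close>
  have q_scaleC: "q i (c *\<^sub>C x) y = q i x (cnj c *\<^sub>C y)" for c x y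
    unfolding q_def fun_eq_iff by (auto simp: bounded_operatorsD[OF Jb] cinner_simps)
  have l_le: "\<bar>l (q i x y)\<bar> \<le> norm x * norm y" for x y
  proof -
    have "l (q i x y) \<le> norm x * norm y"
      using q_le by (intro bound qX) (auto simp: abs_le_iff)
    moreover have "l (\<lambda>z. -1 * q i x y z) \<le> norm x * norm y"
    proof (rule bound)
      show "(\<lambda>z. -1 * q i x y z) \<in> X"
        using qX[of x y] by (simp add: X_def)
      show "-1 * q i x y z \<le> norm x * norm y" for z
        using q_le[of x y z] by (simp add: abs_le_iff)
    qed
    then have "- l (q i x y) \<le> norm x * norm y"
      using l_scale[OF qX, of "-1"] by simp
    ultimately show ?thesis
      by (simp add: abs_le_iff)
  qed
  have "\<exists>z. \<forall>y. l (q i x y) = Re (cinner z y)" for x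
    by (rule riesz_representation[of _ "norm x"]) (simp_all add: q_add q_scale l_add l_scale qX l_le)
  then obtain A where A: "\<And>x y. l (q i x y) = Re (cinner (A x) y)"
    by metis
  have "A \<in> bounded_operators"
  proof (rule bounded_operatorsI)
    show "A (x + x') = A x + A x'" for x x'
      by (rule Re_cinner_eqI) (simp add: cinner_simps flip: A, simp add: q_commute[of "x + x'"] q_add
          l_add qX q_commute)
    show "A (c *\<^sub>C x) = c *\<^sub>C A x" for c x
    proof (rule Re_cinner_eqI)
      fix y
      have "Re (cinner (A (c *\<^sub>C x)) y) = Re (cinner (A x) (cnj c *\<^sub>C y))"
        by (simp only: q_scaleC flip: A)
      then show "Re (cinner (A (c *\<^sub>C x)) y) = Re (cinner (c *\<^sub>C A x) y)"
        by (simp add: cinner_simps)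
    qed
    show "norm (A x) \<le> 1 * norm x" for x
    proof (cases "A x = 0")
      case False
      have "norm (A x) * norm (A x) \<le> norm x * norm (A x)"
        using l_le[of x "A x"] by (simp add: A Re_cinner_self power2_eq_square)
      then show ?thesis
        using False by simp
    qed simp
  qed
  moreover have "cinner (A x) x = complex_of_real (l (q i x x))" for x
  proof -
    \<comment> \<open>\<open>Re (cinner (A x) (\<i> *\<^sub>C x))\<close> is the imaginary part of
      \<open>cinner (A x) x\<close>; symmetrisation makes it vanish.\<close>
    have "q i x (\<i> *\<^sub>C x) = (\<lambda>z. 0 * q i x x z)"
      unfolding q_def fun_eq_iff by (auto simp: bounded_operatorsD[OF Jb] cinner_simps)
    then have "Re (cinner (A x) (\<i> *\<^sub>C x)) = 0"
      using l_scale[OF qX, of 0 x x] by (simp only: flip: A)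
    then show ?thesis
      by (simp add: A complex_eq_iff cinner_simps)
  qed
  ultimately show "\<exists>A\<in>bounded_operators. \<forall>x. cinner (A x) x = complex_of_real (l (q i x x))"
    by blast
qed

lemma tuple_form_bound:
  assumes "T \<in> contractions"
  shows "\<bar>Re (tuple_form n v T)\<bar> \<le> tuple_sq n v"
proof -
  have "\<bar>Re (cinner (T x) x)\<bar> \<le> (norm x)\<^sup>2" for x
    using order.trans[OF Re_cinner_le mult_right_mono[OF contractionsD(2)[OF assms] norm_ge_zero]]
    by (simp add: power2_eq_square)
  then show ?thesis
    unfolding tuple_form_def tuple_sq_def Re_sum by (intro order.trans[OF sum_abs] sum_mono) auto
qed

lemma tuple_scale:
  assumes "T \<in> bounded_operators"
  shows "tuple_form n (\<lambda>j. r *\<^sub>R v j) T = complex_of_real (r\<^sup>2) * tuple_form n v T"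
    and "tuple_sq n (\<lambda>j. r *\<^sub>R w j) = r\<^sup>2 * tuple_sq n w"
proof -
  show "tuple_form n (\<lambda>j. r *\<^sub>R v j) T = complex_of_real (r\<^sup>2) * tuple_form n v T"
    by (simp add: tuple_form_def bounded_operatorsD[OF assms] cinner_simps
        sum_distrib_left power2_eq_square mult_ac)
  show "tuple_sq n (\<lambda>j. r *\<^sub>R w j) = r\<^sup>2 * tuple_sq n w"
    by (simp add: tuple_sq_def power_mult_distrib sum_distrib_left)
qed

text \<open>Pulling a quadratic form back along \<open>u\<close> conjugates its operator by the
  inverse of \<open>u\<close>, opposite to the conjugation in the definition of amenability.\<close>

lemma unitary_conjugate_invariant:
  assumes u: "unitary_operator u" and T: "T \<in> bounded_operators"
    and inv: "\<And>T. T \<in> bounded_operators \<Longrightarrow> \<phi> (u \<circ> T \<circ> inv_into UNIV u) = \<phi> T"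
  shows "\<phi> (inv_into UNIV u \<circ> T \<circ> u) = \<phi> T"
proof -
  note uD = unitary_operatorD[OF u]
  have "inv_into UNIV u \<circ> T \<circ> u \<in> bounded_operators"
    using unitary_operatorD(1)[OF unitary_operator_inv[OF u]] uD(1) T
    by (intro bounded_operators_closed)
  from inv[OF this] show ?thesis
    by (simp add: comp_def uD(4))
qed

text \<open>Otherwise the functionals \<open>tuple_form n (u i \<circ> v) - tuple_form n v\<close> form a cone that can be
  separated from \<open>0\<close> in the predual of the operators. The separating functional consists of
  self-adjoint operators \<open>A i\<close> with \<open>\<Sum>i<m. u i\<^sup>-\<^sup>1 \<circ> A i \<circ> u i - A i \<ge> \<delta>\<close>, while the
  invariant state vanishes on the left-hand side.\<close>

lemma almost_invariant_tuple:
  fixes u :: "nat \<Rightarrow> 'h::complex_hilbert \<Rightarrow> 'h"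
  assumes \<phi>: "operator_state \<phi>" and u: "\<And>i. i < m \<Longrightarrow> unitary_operator (u i)"
    and inv: "\<And>i T. i < m \<Longrightarrow> T \<in> bounded_operators \<Longrightarrow> \<phi> (u i \<circ> T \<circ> inv_into UNIV (u i)) = \<phi> T"
    and \<delta>: "\<delta> > 0"
  shows "\<exists>n v. tuple_sq n v = 1 \<and> (\<forall>i<m. \<forall>T\<in>contractions.
    Re (tuple_form n (\<lambda>j. u i (v j)) T - tuple_form n v T) \<le> \<delta>)"
proof -
  let ?d = "\<lambda>i n v T. Re (tuple_form n (\<lambda>j. u i (v j)) T - tuple_form n v T)"
  have d_scale: "?d i n (\<lambda>j. r *\<^sub>R v j) T = r\<^sup>2 * ?d i n v T"
    if "i < m" "T \<in> contractions" for i n v T r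
    using tuple_scale(1)[OF contractionsD(1)[OF that(2)], of n r]
    by (simp add: bounded_operatorsD(3)[OF unitary_operatorD(1)[OF u[OF that(1)]]] right_diff_distrib)
  \<comment> \<open>The homogeneous form of the claim is the one suited to a cone; the tuple is
    normalised at the very end.\<close>
  have "\<exists>n v. tuple_sq n v > 0 \<and> (\<forall>i<m. \<forall>T\<in>contractions. ?d i n v T \<le> \<delta> * tuple_sq n v)"
  proof (rule ccontr)
    assume not: "\<not> ?thesis"
    have sep: "\<exists>i<m. \<exists>T\<in>contractions. \<delta> * tuple_sq n v < ?d i n v T" if "tuple_sq n v > 0" for n v
      using not that by (meson not_le)
    \<comment> \<open>A pair \<open>(i, T)\<close> tests the functional of the \<open>i\<close>-th
      unitary at \<open>T\<close>, so a supremum over \<open>J\<close> is the largest of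
      \<open>m\<close> trace norms.\<close>
    define J :: "(nat \<times> ('h \<Rightarrow> 'h)) set" where "J = {(i, T). i < m \<and> T \<in> contractions}"
    define X where "X = {a :: nat \<times> ('h \<Rightarrow> 'h) \<Rightarrow> real. \<exists>M. \<forall>z. \<bar>a z\<bar> \<le> M}"
    define c where "c n v = (\<lambda>(i, T). if (i, T) \<in> J then ?d i n v T else 0)" for n v
    define C where "C = {(c n v, \<delta> * tuple_sq n v) | n v. True}"
    have X: "function_subspace X"
      unfolding function_subspace_def
    proof (intro conjI ballI allI)
      show "(\<lambda>x. 0) \<in> X"
        by (auto simp: X_def)
      fix f assume "f \<in> X"
      then obtain M where M: "\<And>z. \<bar>f z\<bar> \<le> M"
        by (auto simp: X_def)
      show "(\<lambda>x. r * f x) \<in> X" for r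
        unfolding X_def
        by (intro CollectI exI[of _ "\<bar>r\<bar> * M"] allI) (simp add: abs_mult mult_left_mono M)
      fix g assume "g \<in> X"
      then obtain M' where M': "\<And>z. \<bar>g z\<bar> \<le> M'"
        by (auto simp: X_def)
      show "(\<lambda>x. f x + g x) \<in> X"
        unfolding X_def
        by (intro CollectI exI[of _ "M + M'"] allI order.trans[OF abs_triangle_ineq] add_mono M M')
    qed
    have c_le: "\<bar>c n v z\<bar> \<le> 2 * tuple_sq n v" for n v z
    proof (cases z)
      case (Pair i T)
      have "\<bar>?d i n v T\<bar> \<le> 2 * tuple_sq n v" if "(i, T) \<in> J"
      proof -
        have T: "T \<in> contractions" and i: "i < m"
          using that by (auto simp: J_def)
        have "tuple_sq n (\<lambda>j. u i (v j)) = tuple_sq n v"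
          using unitary_operatorD(3)[OF u[OF i]] by (simp add: tuple_sq_def)
        then show ?thesis
          using tuple_form_bound[OF T, of n v]
            tuple_form_bound[OF T, of n "\<lambda>j. u i (v j)"] by (simp only: minus_complex.sel)
      qed
      then show ?thesis
        by (simp add: Pair c_def tuple_sq_nonneg)
    qed
    have cX: "c n v \<in> X" for n v
      using c_le unfolding X_def by blast
    \<comment> \<open>On the zero space \<open>id\<close> is the zero operator, contrary to
      \<open>\<phi> id = 1\<close>. A nonzero vector is needed to see that \<open>J\<close> is not
      empty, in particular that \<open>m > 0\<close>.\<close>
    have "\<exists>x :: 'h. x \<noteq> 0"
    proof (rule ccontr)
      assume "\<not> ?thesis"
      then have "id = (\<lambda>x :: 'h. 0 *\<^sub>C id x)"
        by (metis ext)
      then have "\<phi> id = 0 * \<phi> id"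
        using operator_stateD(2)[OF \<phi> bounded_operators_closed(4)] by metis
      then show False
        using operator_stateD(4)[OF \<phi>] by simp
    qed
    then obtain x0 :: 'h where "x0 \<noteq> 0"
      by blast
    then have "tuple_sq 1 (\<lambda>_. x0) > 0"
      by (simp add: tuple_sq_def)
    from sep[OF this] obtain z0 where z0: "z0 \<in> J"
      unfolding J_def by auto
    have c_upper: "c n v z \<le> (SUP z\<in>J. c n v z)" if "z \<in> J" for n v z
      using that c_le by (intro cSUP_upper bdd_aboveI2[of _ _ "2 * tuple_sq n v"]) (auto simp: abs_le_iff)
    have "\<exists>l. linear_functional_on X l \<and> (\<forall>a\<in>X. l a \<le> (SUP z\<in>J. a z)) \<and> (\<forall>(c, t)\<in>C. t \<le> l c)"
    proof (rule cone_separation[OF X])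
      show "J \<noteq> {}"
        using z0 by blast
      show "\<exists>M. \<forall>z\<in>J. \<bar>a z\<bar> \<le> M" if "a \<in> X" for a
        using that unfolding X_def by blast
      show "a \<in> X" if "(a, t) \<in> C" for a t
        using that cX by (auto simp: C_def)
      show "t \<le> (SUP z\<in>J. a z)" if at: "(a, t) \<in> C" for a t
      proof -
        obtain n v where nv: "a = c n v" "t = \<delta> * tuple_sq n v"
          using at by (auto simp: C_def)
        show ?thesis
        proof (cases "tuple_sq n v > 0")
          case True
          from sep[OF this] obtain i T where "i < m" "T \<in> contractions" "\<delta> * tuple_sq n v < ?d i n v T"
            by blast
          then show ?thesis
            using c_upper[of "(i, T)" n v] by (simp add: nv c_def J_def)
        next
          case False
          then have "tuple_sq n v = 0"
            using tuple_sq_nonneg[of n v] by simp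
          then show ?thesis
            using c_upper[OF z0, of n v] c_le[of n v z0] by (simp add: nv)
        qed
      qed
      show "((\<lambda>z. a z + b z), t + s) \<in> C" if ab: "(a, t) \<in> C" "(b, s) \<in> C" for a t b s
      proof -
        obtain n v k w where nv: "a = c n v" "t = \<delta> * tuple_sq n v" "b = c k w" "s = \<delta> * tuple_sq k w"
          using ab by (auto simp: C_def)
        \<comment> \<open>Adding functionals is concatenating tuples, which is why the length of the
          tuple cannot be fixed in advance.\<close>
        define vw where "vw j = (if j < n then v j else w (j - n))" for j
        have form: "tuple_form (n + k) (\<lambda>j. f (vw j)) T = tuple_form n (\<lambda>j. f (v j)) T + tuple_form k (\<lambda>j. f (w j)) T"
          for f :: "'h \<Rightarrow> 'h" and T
          unfolding tuple_form_def vw_def by (rule sum_concat)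
        have "tuple_sq (n + k) vw = tuple_sq n v + tuple_sq k w"
          unfolding tuple_sq_def vw_def by (rule sum_concat)
        moreover have "c (n + k) vw = (\<lambda>z. c n v z + c k w z)"
          using form form[of "\<lambda>x. x"] by (auto simp: c_def fun_eq_iff)
        ultimately show ?thesis
          unfolding C_def nv by (auto simp: distrib_left intro!: exI[of _ "n + k"] exI[of _ vw])
      qed
      show "((\<lambda>z. r * a z), r * t) \<in> C" if r: "r > 0" and a: "(a, t) \<in> C" for r a t
      proof -
        obtain n v where nv: "a = c n v" "t = \<delta> * tuple_sq n v"
          using a by (auto simp: C_def)
        \<comment> \<open>Forms are quadratic in the tuple, hence the square root.\<close>
        have "c n (\<lambda>j. sqrt r *\<^sub>R v j) = (\<lambda>z. r * c n v z)"
          using d_scale[of _ _ n "sqrt r" v] r by (auto simp: c_def fun_eq_iff J_def)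
        moreover have "tuple_sq n (\<lambda>j. sqrt r *\<^sub>R v j) = r * tuple_sq n v"
          using tuple_scale(2)[OF bounded_operators_closed(4), of n "sqrt r" v] r by simp
        ultimately show ?thesis
          unfolding C_def nv by (auto simp: mult_ac intro!: exI[of _ n] exI[of _ "\<lambda>j. sqrt r *\<^sub>R v j"])
      qed
      have "c 0 (\<lambda>_. 0) = (\<lambda>z. 0)" "tuple_sq 0 (\<lambda>_. 0 :: 'h) = 0"
        by (auto simp: c_def tuple_form_def tuple_sq_def)
      then show "((\<lambda>z. 0), 0) \<in> C"
        unfolding C_def by (metis (mono_tags, lifting) CollectI mult_zero_right)
    qed
    then obtain l where l: "linear_functional_on X l"
      and l_le: "\<And>a. a \<in> X \<Longrightarrow> l a \<le> (SUP z\<in>J. a z)" and l_cone: "\<forall>(c, t)\<in>C. t \<le> l c"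
      by blast
    have l_C: "\<delta> * tuple_sq n v \<le> l (c n v)" for n v
      using l_cone by (auto simp: C_def)
    define q where "q i x y = (\<lambda>(j, T). if j = i \<and> (j, T) \<in> J
        then (Re (cinner (T x) y) + Re (cinner (T y) x)) / 2 else 0)" for i x y
    have JT: "T \<in> contractions" if "(i, T) \<in> J" for i T
      using that by (simp add: J_def)
    have bound: "l a \<le> M" if "a \<in> X" "\<And>z. a z \<le> M" for a M
      using l_le[OF that(1)] cSUP_least[of J a M] z0 that(2) by fastforce
    have qX: "q i x y \<in> X" for i x y
      unfolding X_def q_def
      by (rule operator_of_functional(2)[where J = J and l = l])
        (erule JT, rule l[unfolded X_def], rule bound[unfolded X_def], simp_all)
    have "\<exists>A\<in>bounded_operators. \<forall>x. cinner (A x) x = complex_of_real (l (q i x x))" for i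
      unfolding q_def
      by (rule operator_of_functional(1)[where J = J and l = l])
        (erule JT, rule l[unfolded X_def], rule bound[unfolded X_def], simp_all)
    then obtain A where A: "\<And>i. A i \<in> bounded_operators"
      and Aq: "\<And>i x. cinner (A i x) x = complex_of_real (l (q i x x))"
      by metis
    let ?B = "\<lambda>i x. (inv_into UNIV (u i) \<circ> A i \<circ> u i) x + (-1) *\<^sub>C A i x"
    define P where "P x = (\<Sum>i<m. ?B i x) + complex_of_real (- \<delta>) *\<^sub>C id x" for x
    have conj: "inv_into UNIV (u i) \<circ> A i \<circ> u i \<in> bounded_operators" if "i < m" for i
      using unitary_operatorD(1)[OF unitary_operator_inv[OF u[OF that]]] unitary_operatorD(1)[OF u[OF that]] A
      by (intro bounded_operators_closed)
    have B: "?B i \<in> bounded_operators" if "i < m" for i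
      by (intro bounded_operators_closed conj that A)
    note sumB = operator_state_sum[OF \<phi>, of m ?B, OF B]
    have "\<phi> (?B i) = 0" if i: "i < m" for i
    proof -
      have "\<phi> (?B i) = \<phi> (inv_into UNIV (u i) \<circ> A i \<circ> u i) + (-1) * \<phi> (A i)"
        using operator_stateD(1)[OF \<phi> conj[OF i] bounded_operators_closed(2)[OF A]]
          operator_stateD(2)[OF \<phi> A] by metis
      then show ?thesis
        using unitary_conjugate_invariant[where \<phi> = \<phi>, OF u[OF i] A[of i] inv[OF i]] by simp
    qed
    then have "\<phi> P = complex_of_real (- \<delta>)"
      unfolding P_def[abs_def]
      using operator_stateD(1)[OF \<phi> conjunct1[OF sumB] bounded_operators_closed(2)[OF bounded_operators_closed(4)]]
        operator_stateD(2)[OF \<phi> bounded_operators_closed(4)] operator_stateD(4)[OF \<phi>] sumB by simp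
    moreover have "positive_operator P"
      unfolding positive_operator_def
    proof (intro conjI allI)
      show "P \<in> bounded_operators"
        unfolding P_def[abs_def] using sumB by (intro bounded_operators_closed) auto
      fix x
      define f where "f i = (\<lambda>z. q i (u i x) (u i x) z + (-1) * q i x x z)" for i
      have fX: "f i \<in> X" for i
        unfolding f_def by (intro function_subspaceD(2,3)[OF X] qX)
      have lf: "l (f i) = l (q i (u i x) (u i x)) - l (q i x x)" for i
        unfolding f_def using linear_functional_onD(1)[OF l qX function_subspaceD(3)[OF X qX], of i "u i x" "u i x" "-1" i x x]
          linear_functional_onD(2)[OF l qX, of "-1" i x x] by simp
      \<comment> \<open>At \<open>(j, T)\<close> only the summand \<open>i = j\<close> survives.
        This decomposes the functional of a single vector into the forms \<open>q i\<close> that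
        define the operators \<open>A i\<close>.\<close>
      have "c 1 (\<lambda>_. x) z = (\<Sum>i<m. f i z)" for z
      proof (cases z)
        case (Pair j T)
        have "(\<Sum>i<m. f i (j, T)) = (\<Sum>i<m. if i = j then c 1 (\<lambda>_. x) (j, T) else 0)"
          by (intro sum.cong refl) (auto simp: f_def q_def c_def tuple_form_def)
        also have "\<dots> = c 1 (\<lambda>_. x) (j, T)"
          by (auto simp: c_def J_def)
        finally show ?thesis
          by (simp add: Pair)
      qed
      then have "c 1 (\<lambda>_. x) = (\<lambda>z. \<Sum>i<m. f i z)"
        by blast
      then have "\<delta> * (norm x)\<^sup>2 \<le> (\<Sum>i<m. l (f i))"
        using l_C[of 1 "\<lambda>_. x"] linear_functional_on_sum[OF X l, of m f] fX by (simp add: tuple_sq_def)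
      moreover have "cinner (?B i x) x = complex_of_real (l (f i))" if i: "i < m" for i
      proof -
        have "cinner (inv_into UNIV (u i) y) x = cinner y (u i x)" for y
          using unitary_operatorD(2)[OF u[OF i], of "inv_into UNIV (u i) y" x]
          by (simp add: unitary_operatorD(4)[OF u[OF i]])
        then show ?thesis
          by (simp add: cinner_simps Aq lf)
      qed
      then have "cinner (P x) x = complex_of_real ((\<Sum>i<m. l (f i)) - \<delta> * (norm x)\<^sup>2)"
        by (simp add: P_def cinner_add_left cinner_sum_left cinner_scaleC_left cinner_self)
      ultimately show "cinner (P x) x \<in> \<real>\<^sub>\<ge>\<^sub>0"
        by (simp only: nonneg_Reals_of_real_iff)
    qed
    ultimately have "complex_of_real (- \<delta>) \<in> \<real>\<^sub>\<ge>\<^sub>0"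
      using operator_stateD(3)[OF \<phi>] by metis
    then show False
      using \<delta> by (simp only: nonneg_Reals_of_real_iff)
  qed
  then obtain n v where pos: "tuple_sq n v > 0"
    and nv: "\<And>i T. i < m \<Longrightarrow> T \<in> contractions \<Longrightarrow> ?d i n v T \<le> \<delta> * tuple_sq n v"
    by blast
  define r where "r = 1 / sqrt (tuple_sq n v)"
  have r: "r\<^sup>2 * tuple_sq n v = 1"
    using pos by (simp add: r_def power_divide)
  have "tuple_sq n (\<lambda>j. r *\<^sub>R v j) = 1"
    using tuple_scale(2)[OF bounded_operators_closed(4), of n r v] r by simp
  moreover have "?d i n (\<lambda>j. r *\<^sub>R v j) T \<le> \<delta>" if "i < m" "T \<in> contractions" for i T
  proof -
    have "?d i n (\<lambda>j. r *\<^sub>R v j) T \<le> r\<^sup>2 * (\<delta> * tuple_sq n v)"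
      unfolding d_scale[OF that] by (intro mult_left_mono nv that) simp
    also have "\<dots> = \<delta>"
      using r by (metis mult.left_commute mult.right_neutral)
    finally show ?thesis .
  qed
  ultimately show ?thesis
    by blast
qed

section \<open>Tuple integrals as almost periodic functions of the rotation\<close>

lemma tuple_integral_close:
  assumes "\<And>x y. \<bar>quadratic_extension h x - quadratic_extension h y\<bar> \<le>
    C * (norm (x - y))\<^sup>2 + \<tau> * ((norm x)\<^sup>2 + (norm y)\<^sup>2)"
  shows "\<bar>tuple_integral h n v - tuple_integral h n w\<bar> \<le>
    C * tuple_sq n (\<lambda>j. v j - w j) + \<tau> * (tuple_sq n v + tuple_sq n w)"
proof -
  have "\<bar>tuple_integral h n v - tuple_integral h n w\<bar> \<le>
      (\<Sum>j<n. C * (norm (v j - w j))\<^sup>2 + \<tau> * ((norm (v j))\<^sup>2 + (norm (w j))\<^sup>2))"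
    unfolding tuple_integral_def sum_subtractf[symmetric]
    by (intro order.trans[OF sum_abs] sum_mono assms)
  then show ?thesis
    by (simp add: tuple_sq_def sum.distrib sum_distrib_left distrib_left)
qed

lemma tuple_sq_cong: "(\<And>j. j < n \<Longrightarrow> v j = w j) \<Longrightarrow> tuple_sq n v = tuple_sq n w"
  by (simp add: tuple_sq_def)

text \<open>A common right factor is an isometry in the Hilbert--Schmidt norm and cancels. This
  makes closeness of two rotations uniform under all further rotations.\<close>

lemma tuple_sq_rotate_diff:
  assumes "u \<in> unitary_matrices n"
  shows "tuple_sq n (\<lambda>i. rotate_tuple n w (matrix_mult n k u) i - rotate_tuple n v u i) =
    tuple_sq n (\<lambda>i. rotate_tuple n w k i - v i)"
proof -
  have "tuple_sq n (\<lambda>i. rotate_tuple n w (matrix_mult n k u) i - rotate_tuple n v u i) =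
      tuple_sq n (rotate_tuple n (\<lambda>i. rotate_tuple n w k i - v i) u)"
    by (intro tuple_sq_cong) (simp add: rotate_matrix_mult rotate_diff)
  then show ?thesis
    by (simp add: tuple_sq_rotate[OF assms])
qed

text \<open>If \<open>k\<close> and \<open>a\<close> rotate \<open>w\<close> to nearby tuples, so do
  their products with any \<open>u\<close> on the right. A finite subcover of the compact group
  therefore gives a finite net of translates.\<close>

lemma almost_periodic_tuple_integral:
  fixes h :: "'h::complex_hilbert \<Rightarrow> real"
  assumes uc: "uniformly_continuous_on (sphere 0 1) h"
    and M: "\<And>x. x \<in> sphere 0 1 \<Longrightarrow> \<bar>h x\<bar> \<le> M"
  shows "almost_periodic (matrix_group n) (\<lambda>k. tuple_integral h n (rotate_tuple n w k))"
proof -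
  let ?K = "unitary_matrices n" and ?F = "\<lambda>k. tuple_integral h n (rotate_tuple n w k)"
  have "\<bar>?F k\<bar> \<le> M * tuple_sq n w" if "k \<in> ?K" for k
  proof -
    have "\<bar>?F k\<bar> \<le> (\<Sum>j<n. M * (norm (rotate_tuple n w k j))\<^sup>2)"
      unfolding tuple_integral_def
      by (intro order.trans[OF sum_abs] sum_mono quadratic_extension_bound M)
    also have "\<dots> = M * tuple_sq n (rotate_tuple n w k)"
      by (simp add: tuple_sq_def sum_distrib_left)
    finally show ?thesis
      by (simp add: tuple_sq_rotate[OF that])
  qed
  moreover have "\<exists>A. finite A \<and> A \<subseteq> ?K \<and>
      (\<forall>k\<in>?K. \<exists>a\<in>A. \<forall>u\<in>?K. \<bar>?F (matrix_mult n k u) - ?F (matrix_mult n a u)\<bar> \<le> \<eta>)" if \<eta>: "\<eta> > 0" for \<eta>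
  proof -
    define L where "L = tuple_sq n w"
    define \<tau> where "\<tau> = \<eta> / (4 * (L + 1))"
    have L: "L \<ge> 0"
      by (simp add: L_def tuple_sq_nonneg)
    have \<tau>: "\<tau> > 0" "\<tau> * (L + L) \<le> \<eta> / 2"
      using L \<eta> by (simp_all add: \<tau>_def field_simps)
    obtain C where C: "C \<ge> 0" "\<And>x y. \<bar>quadratic_extension h x - quadratic_extension h y\<bar> \<le>
        C * (norm (x - y))\<^sup>2 + \<tau> * ((norm x)\<^sup>2 + (norm y)\<^sup>2)"
      using quadratic_extension_continuity[OF uc M \<tau>(1)] by blast
    define \<epsilon> where "\<epsilon> = \<eta> / (2 * (C + 1))"
    have \<epsilon>: "\<epsilon> > 0" "C * \<epsilon> \<le> \<eta> / 2"
      using C(1) \<eta> by (simp_all add: \<epsilon>_def field_simps)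
    \<comment> \<open>Neighbourhoods are measured on the rotated tuples rather than on the matrices,
      since the estimates concern tuples.\<close>
    define N where "N a = {k. tuple_sq n (\<lambda>i. rotate_tuple n w k i - rotate_tuple n w a i) < \<epsilon>}" for a
    have "open (N a)" for a
      unfolding N_def tuple_sq_def rotate_tuple_def comb_def
      by (intro open_Collect_less continuous_intros)
    moreover have "?K \<subseteq> (\<Union>a\<in>?K. N a)"
      using \<epsilon>(1) by (force simp: N_def tuple_sq_def)
    ultimately obtain A where A: "A \<subseteq> ?K" "finite A" "?K \<subseteq> (\<Union>a\<in>A. N a)"
      using compactE_image[OF compact_unitary_matrices, of ?K N] by metis
    have "\<bar>?F (matrix_mult n k u) - ?F (matrix_mult n a u)\<bar> \<le> \<eta>"
      if k: "k \<in> ?K" "a \<in> A" "k \<in> N a" and u: "u \<in> ?K" for k a u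
    proof -
      have a: "a \<in> ?K"
        using A(1) k(2) by blast
      have "tuple_sq n (\<lambda>i. rotate_tuple n w (matrix_mult n k u) i - rotate_tuple n w (matrix_mult n a u) i)
          = tuple_sq n (\<lambda>i. rotate_tuple n w (matrix_mult n k u) i - rotate_tuple n (rotate_tuple n w a) u i)"
        by (intro tuple_sq_cong) (simp add: rotate_matrix_mult)
      also have "\<dots> < \<epsilon>"
        using k(3) by (simp add: tuple_sq_rotate_diff[OF u] N_def)
      finally have "C * tuple_sq n (\<lambda>i. rotate_tuple n w (matrix_mult n k u) i -
          rotate_tuple n w (matrix_mult n a u) i) \<le> \<eta> / 2"
        using \<epsilon>(2) C(1) by (meson less_imp_le mult_left_mono order.trans)
      then show ?thesis
        using tuple_integral_close[OF C(2), of n "rotate_tuple n w (matrix_mult n k u)"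
            "rotate_tuple n w (matrix_mult n a u)"] \<tau>(2)
          tuple_sq_rotate[OF matrix_mult_unitary[OF k(1) u], of w]
          tuple_sq_rotate[OF matrix_mult_unitary[OF a u], of w] by (simp add: L_def)
    qed
    then have "\<exists>a\<in>A. \<forall>u\<in>?K. \<bar>?F (matrix_mult n k u) - ?F (matrix_mult n a u)\<bar> \<le> \<eta>"
      if k: "k \<in> ?K" for k
      using subsetD[OF A(3) k] k by (elim UN_E) (intro bexI ballI, auto)
    then show ?thesis
      by (intro exI[of _ A] conjI ballI A)
  qed
  ultimately show ?thesis
    unfolding almost_periodic_def matrix_group_def by auto
qed

section \<open>Invariant means on the sphere\<close>

text \<open>Unitaries preserve norms and commute with normalisation, so the inequality on the sphere
  extends to all vectors with weight \<open>(norm x)\<^sup>2\<close> and can be summed.\<close>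

lemma tuple_integral_le:
  fixes u :: "nat \<Rightarrow> 'h::complex_hilbert \<Rightarrow> 'h" and h :: "nat \<Rightarrow> 'h \<Rightarrow> real"
  assumes u: "\<And>i. i < m \<Longrightarrow> unitary_operator (u i)"
    and neg: "\<And>x. x \<in> sphere 0 1 \<Longrightarrow> (\<Sum>i<m. h i (u i x) - h i x) \<le> - \<epsilon>"
  shows "(\<Sum>i<m. tuple_integral (h i) n (\<lambda>j. u i (w j)) - tuple_integral (h i) n w) \<le> - \<epsilon> * tuple_sq n w"
proof -
  have "(\<Sum>i<m. quadratic_extension (h i) (u i x) - quadratic_extension (h i) x) \<le> - \<epsilon> * (norm x)\<^sup>2" for x
  proof (cases "x = 0")
    case True
    have "u i 0 = 0" if "i < m" for i
      by (rule bounded_operatorsD(5)[OF unitary_operatorD(1)[OF u[OF that]]])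
    then show ?thesis
      using True by (simp add: quadratic_extension_def)
  next
    case False
    have eq: "quadratic_extension (h i) (u i x) - quadratic_extension (h i) x =
        (norm x)\<^sup>2 * (h i (u i (sgn x)) - h i (sgn x))" if "i < m" for i
      using unitary_operatorD(3)[OF u[OF that], of x] bounded_operatorsD(3)[OF unitary_operatorD(1)[OF u[OF that]]]
      by (simp add: quadratic_extension_def sgn_div_norm right_diff_distrib)
    have "(\<Sum>i<m. quadratic_extension (h i) (u i x) - quadratic_extension (h i) x) =
        (norm x)\<^sup>2 * (\<Sum>i<m. h i (u i (sgn x)) - h i (sgn x))"
      unfolding sum_distrib_left by (intro sum.cong refl eq) simp
    also have "\<dots> \<le> (norm x)\<^sup>2 * (- \<epsilon>)"
      using False by (intro mult_left_mono neg) (simp_all add: norm_sgn)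
    finally show ?thesis
      by (simp add: mult.commute)
  qed
  then have "(\<Sum>j<n. \<Sum>i<m. quadratic_extension (h i) (u i (w j)) - quadratic_extension (h i) (w j)) \<le>
      (\<Sum>j<n. - \<epsilon> * (norm (w j))\<^sup>2)"
    by (intro sum_mono)
  then show ?thesis
    unfolding tuple_integral_def tuple_sq_def sum_subtractf[symmetric] sum_distrib_left
    by (subst sum.swap)
qed

lemma coboundary_not_negative:
  fixes u :: "nat \<Rightarrow> 'h::complex_hilbert \<Rightarrow> 'h" and h :: "nat \<Rightarrow> 'h \<Rightarrow> real"
  assumes \<phi>: "operator_state \<phi>" and u: "\<And>i. i < m \<Longrightarrow> unitary_operator (u i)"
    and inv: "\<And>i T. i < m \<Longrightarrow> T \<in> bounded_operators \<Longrightarrow> \<phi> (u i \<circ> T \<circ> inv_into UNIV (u i)) = \<phi> T"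
    and uc: "\<And>i. i < m \<Longrightarrow> uniformly_continuous_on (sphere 0 1) (h i)"
    and bdd: "\<And>i. i < m \<Longrightarrow> \<exists>M. \<forall>x\<in>sphere 0 1. \<bar>h i x\<bar> \<le> M"
    and neg: "\<And>x. x \<in> sphere 0 1 \<Longrightarrow> (\<Sum>i<m. h i (u i x) - h i x) \<le> - \<epsilon>"
  shows "\<epsilon> \<le> 0"
proof (rule ccontr)
  assume "\<not> \<epsilon> \<le> 0"
  \<comment> \<open>Each index will cost \<open>4 * \<tau>\<close>: one from the distance of the
    tuples, two from their masses, one from the flatness of the average.\<close>
  define \<tau> where "\<tau> = \<epsilon> / (4 * (real m + 1))"
  have \<tau>: "\<tau> > 0" "real m * (4 * \<tau>) < \<epsilon>"
    using \<open>\<not> \<epsilon> \<le> 0\<close> by (simp_all add: \<tau>_def field_simps)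
  have "\<exists>C\<ge>0. \<forall>x y. \<bar>quadratic_extension (h i) x - quadratic_extension (h i) y\<bar> \<le>
      C * (norm (x - y))\<^sup>2 + \<tau> * ((norm x)\<^sup>2 + (norm y)\<^sup>2)" if i: "i < m" for i
    using bdd[OF i] quadratic_extension_continuity[OF uc[OF i] _ \<tau>(1)] by metis
  then obtain C where C: "\<And>i. i < m \<Longrightarrow> C i \<ge> 0"
    "\<And>i x y. i < m \<Longrightarrow> \<bar>quadratic_extension (h i) x - quadratic_extension (h i) y\<bar> \<le>
      C i * (norm (x - y))\<^sup>2 + \<tau> * ((norm x)\<^sup>2 + (norm y)\<^sup>2)"
    by metis
  define D where "D = (\<Sum>i<m. C i)"
  have D: "D \<ge> 0" "\<And>i. i < m \<Longrightarrow> C i \<le> D"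
    unfolding D_def using C(1) by (auto intro: sum_nonneg member_le_sum)
  \<comment> \<open>Alignment turns the trace-norm bound \<open>\<delta>\<close> into the squared
    distance \<open>2 * \<delta>\<close>, which \<open>D\<close> multiplies in the continuity
    estimate.\<close>
  define \<delta> where "\<delta> = \<tau> / (2 * (D + 1))"
  have \<delta>: "\<delta> > 0" "D * (2 * \<delta>) \<le> \<tau>"
    using D(1) \<tau>(1) by (simp_all add: \<delta>_def field_simps)
  obtain n v where v: "tuple_sq n v = 1"
    and close: "\<And>i T. i < m \<Longrightarrow> T \<in> contractions \<Longrightarrow>
      Re (tuple_form n (\<lambda>j. u i (v j)) T - tuple_form n v T) \<le> \<delta>"
  proof -
    have "\<exists>n v. tuple_sq n v = 1 \<and> (\<forall>i<m. \<forall>T\<in>contractions.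
        Re (tuple_form n (\<lambda>j. u i (v j)) T - tuple_form n v T) \<le> \<delta>)"
      using \<phi> u inv \<delta>(1) by (rule almost_invariant_tuple)
    then show ?thesis
      using that by blast
  qed
  interpret K: group "matrix_group n"
    by (rule group_matrix_group)
  have K: "carrier (matrix_group n) = unitary_matrices n" "mult (matrix_group n) = matrix_mult n"
    by (simp_all add: matrix_group_def)
  \<comment> \<open>\<open>E i\<close> belongs to the tuple moved by \<open>u i\<close>,
    \<open>F i\<close> to the original one. Only the \<open>E i\<close> need to be
    flattened.\<close>
  define E where "E i k = tuple_integral (h i) n (rotate_tuple n (\<lambda>j. u i (v j)) k)" for i k
  define F where "F i k = tuple_integral (h i) n (rotate_tuple n v k)" for i k
  have "almost_periodic (matrix_group n) (E i)" if i: "i < m" for i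
    using bdd[OF i] almost_periodic_tuple_integral[OF uc[OF i]] unfolding E_def by metis
  then obtain \<Lambda> where \<Lambda>: "\<Lambda> \<in> averages (matrix_group n)"
    and flat: "\<And>i x y. i < m \<Longrightarrow> x \<in> unitary_matrices n \<Longrightarrow> y \<in> unitary_matrices n \<Longrightarrow>
      \<Lambda> (E i) x - \<Lambda> (E i) y \<le> \<tau>"
    using K.almost_periodic_flatten_family[of m E \<tau>] \<tau>(1) unfolding K by blast
  let ?e = "\<one>\<^bsub>matrix_group n\<^esub>"
  have "\<Lambda> (F i) ?e - \<Lambda> (E i) ?e \<le> 4 * \<tau>" if i: "i < m" for i
  proof -
    obtain U where U: "U \<in> unitary_matrices n"
      and dist: "tuple_sq n (\<lambda>j. rotate_tuple n (\<lambda>j. u i (v j)) U j - v j) \<le> 2 * \<delta>"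
      using tuple_alignment[OF close[OF i]] by blast
    have uv: "tuple_sq n (\<lambda>j. u i (v j)) = 1"
      using v unitary_operatorD(3)[OF u[OF i]] by (simp add: tuple_sq_def)
    have "F i k - E i (matrix_mult n U k) \<le> 3 * \<tau>" if k: "k \<in> unitary_matrices n" for k
    proof -
      have "\<bar>E i (matrix_mult n U k) - F i k\<bar> \<le>
          C i * tuple_sq n (\<lambda>j. rotate_tuple n (\<lambda>j. u i (v j)) (matrix_mult n U k) j - rotate_tuple n v k j)
          + \<tau> * (tuple_sq n (rotate_tuple n (\<lambda>j. u i (v j)) (matrix_mult n U k)) + tuple_sq n (rotate_tuple n v k))"
        unfolding E_def F_def by (rule tuple_integral_close[OF C(2)[OF i]])
      also have "\<dots> = C i * tuple_sq n (\<lambda>j. rotate_tuple n (\<lambda>j. u i (v j)) U j - v j) + \<tau> * (1 + 1)"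
        by (simp only: tuple_sq_rotate_diff[OF k] tuple_sq_rotate[OF k]
            tuple_sq_rotate[OF matrix_mult_unitary[OF U k]] uv v)
      also have "\<dots> \<le> D * (2 * \<delta>) + \<tau> * (1 + 1)"
        using dist D C(1)[OF i] i by (intro add_right_mono mult_mono tuple_sq_nonneg) auto
      finally show ?thesis
        using \<delta>(2) by simp
    qed
    then have "\<Lambda> (\<lambda>k. F i k - E i (matrix_mult n U k)) ?e \<le> 3 * \<tau>"
      by (intro K.averages_le[OF \<Lambda> K.one_closed]) (simp add: K)
    \<comment> \<open>Left translation by \<open>U\<close> moves out of the average and only changes
      the point of evaluation.\<close>
    moreover have "\<Lambda> (\<lambda>k. E i (matrix_mult n U k)) ?e = \<Lambda> (E i) U"
      using K.averages_left_translate[OF \<Lambda> _ K.one_closed, of U "E i"] U K.r_one[of U] by (simp add: K)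
    moreover have "\<Lambda> (E i) U - \<Lambda> (E i) ?e \<le> \<tau>"
      using K.one_closed by (intro flat[OF i U]) (simp add: K)
    ultimately show ?thesis
      by (simp only: K.averages_diff[OF \<Lambda>])
  qed
  then have "(\<Sum>i<m. \<Lambda> (F i) ?e - \<Lambda> (E i) ?e) \<le> (\<Sum>i<m. 4 * \<tau>)"
    by (intro sum_mono) auto
  then have "- (real m * (4 * \<tau>)) \<le> (\<Sum>i<m. \<Lambda> (E i) ?e - \<Lambda> (F i) ?e)"
    by (simp add: sum_subtractf)
  also have "\<dots> = \<Lambda> (\<lambda>k. \<Sum>i<m. E i k - F i k) ?e"
    by (simp add: K.averages_sum[OF \<Lambda>] K.averages_diff[OF \<Lambda>])
  also have "\<dots> \<le> - \<epsilon>"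
  proof (rule K.averages_le[OF \<Lambda> K.one_closed])
    fix k assume "k \<in> carrier (matrix_group n)"
    then have k: "k \<in> unitary_matrices n"
      by (simp add: K)
    have "rotate_tuple n (\<lambda>j. u i (v j)) k = (\<lambda>j. u i (rotate_tuple n v k j))" if "i < m" for i
      using bounded_operator_rotate[OF unitary_operatorD(1)[OF u[OF that]], of n v k] by (simp add: fun_eq_iff)
    then have "(\<Sum>i<m. E i k - F i k) = (\<Sum>i<m. tuple_integral (h i) n (\<lambda>j. u i (rotate_tuple n v k j)) -
        tuple_integral (h i) n (rotate_tuple n v k))"
      unfolding E_def F_def by (intro sum.cong refl) simp
    also have "\<dots> \<le> - \<epsilon> * tuple_sq n (rotate_tuple n v k)"
      by (rule tuple_integral_le[OF u neg])
    finally show "(\<Sum>i<m. E i k - F i k) \<le> - \<epsilon>"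
      by (simp add: tuple_sq_rotate[OF k] v)
  qed
  finally show False
    using \<tau>(2) by simp
qed

section \<open>Bounded uniformly continuous functions on the sphere\<close>

lemma Cbu_sphereD:
  assumes "f \<in> Cbu_sphere"
  shows "uniformly_continuous_on (sphere 0 1) f" "x \<notin> sphere 0 1 \<Longrightarrow> f x = 0"
    "\<exists>M. \<forall>x. cmod (f x) \<le> M" "cmod (f x) \<le> sup_norm f"
proof -
  show "uniformly_continuous_on (sphere 0 1) f" and zero: "x \<notin> sphere 0 1 \<Longrightarrow> f x = 0" for x
    using assms by (auto simp: Cbu_sphere_def)
  obtain M where "\<And>x. x \<in> sphere 0 1 \<Longrightarrow> cmod (f x) \<le> M"
    using assms unfolding Cbu_sphere_def bounded_iff by blast
  then have M: "cmod (f x) \<le> max M 0" for x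
    using zero[of x] by (cases "x \<in> sphere 0 1") (auto simp: le_max_iff_disj)
  then show "\<exists>M. \<forall>x. cmod (f x) \<le> M"
    by blast
  show "cmod (f x) \<le> sup_norm f"
    unfolding sup_norm_def using M by (intro cSUP_upper bdd_aboveI2) auto
qed

lemma Cbu_sphereI:
  assumes "uniformly_continuous_on (sphere 0 1) f" "\<And>x. x \<notin> sphere 0 1 \<Longrightarrow> f x = 0"
    "\<And>x. x \<in> sphere 0 1 \<Longrightarrow> cmod (f x) \<le> M"
  shows "f \<in> Cbu_sphere"
  using assms unfolding Cbu_sphere_def bounded_iff by blast

lemma sup_norm_le:
  assumes "\<And>x. cmod (f x) \<le> M"
  shows "sup_norm f \<le> M"
  unfolding sup_norm_def using assms by (intro cSUP_least) auto

lemma Cbu_sphere_closed: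
  assumes f: "f \<in> Cbu_sphere"
  shows "h \<in> Cbu_sphere \<Longrightarrow> (\<lambda>x. f x + h x) \<in> Cbu_sphere"
    and "(\<lambda>x. c * f x) \<in> Cbu_sphere"
    and "(\<lambda>x. complex_of_real (Re (f x))) \<in> Cbu_sphere"
    and "(\<lambda>x. complex_of_real (Im (f x))) \<in> Cbu_sphere"
    and "unitary_operator u \<Longrightarrow> (\<lambda>x. f (u x)) \<in> Cbu_sphere"
proof -
  note fD = Cbu_sphereD(1,2)[OF f]
  obtain M where M: "\<And>x. cmod (f x) \<le> M"
    using Cbu_sphereD(3)[OF f] by blast
  show "(\<lambda>x. f x + h x) \<in> Cbu_sphere" if h: "h \<in> Cbu_sphere"
  proof -
    note hD = Cbu_sphereD(1,2)[OF h]
    obtain M' where M': "\<And>x. cmod (h x) \<le> M'"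
      using Cbu_sphereD(3)[OF h] by blast
    show ?thesis
      using fD(2) hD(2)
      by (intro Cbu_sphereI[where M = "M + M'"] uniformly_continuous_on_add fD(1) hD(1)
          order.trans[OF norm_triangle_ineq] add_mono M M') auto
  qed
  show "(\<lambda>x. c * f x) \<in> Cbu_sphere"
    using fD(2)
    by (intro Cbu_sphereI[where M = "cmod c * M"]
        bounded_linear.uniformly_continuous_on[OF bounded_linear_mult_right] fD(1))
      (auto simp: norm_mult mult_left_mono M)
  have Re: "uniformly_continuous_on (sphere 0 1) (\<lambda>x. complex_of_real (Re (f x)))"
    and Im: "uniformly_continuous_on (sphere 0 1) (\<lambda>x. complex_of_real (Im (f x)))"
    by (intro bounded_linear.uniformly_continuous_on[OF bounded_linear_of_real]
        bounded_linear.uniformly_continuous_on[OF bounded_linear_Re]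
        bounded_linear.uniformly_continuous_on[OF bounded_linear_Im] fD(1))+
  show "(\<lambda>x. complex_of_real (Re (f x))) \<in> Cbu_sphere" "(\<lambda>x. complex_of_real (Im (f x))) \<in> Cbu_sphere"
    using fD(2) order.trans[OF abs_Re_le_cmod M] order.trans[OF abs_Im_le_cmod M]
    by (auto intro!: Cbu_sphereI[where M = M] Re Im)
  show "(\<lambda>x. f (u x)) \<in> Cbu_sphere" if u: "unitary_operator u"
  proof (rule Cbu_sphereI)
    have iso: "u x \<in> sphere 0 1 \<longleftrightarrow> x \<in> sphere 0 1" for x
      using unitary_operatorD(3)[OF u, of x] by simp
    have "bounded_linear u"
      using unitary_operatorD(1)[OF u] by (simp add: bounded_operators_def)
    then have "uniformly_continuous_on (sphere 0 1) u"
      by (rule bounded_linear.uniformly_continuous_on[OF _ uniformly_continuous_on_id])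
    moreover have "uniformly_continuous_on (u ` sphere 0 1) f"
    proof -
      have "u ` sphere 0 1 \<subseteq> sphere 0 1"
        using iso by blast
      then show ?thesis
        using fD(1) unfolding uniformly_continuous_on_def by (meson subsetD)
    qed
    ultimately show "uniformly_continuous_on (sphere 0 1) (\<lambda>x. f (u x))"
      by (rule uniformly_continuous_on_compose)
    show "f (u x) = 0" if "x \<notin> sphere 0 1" for x
      using that iso by (intro fD(2)) simp
  qed (rule M)
qed

lemma indicator_Cbu_sphere: "indicator (sphere 0 1) \<in> (Cbu_sphere :: ('h::complex_hilbert \<Rightarrow> complex) set)"
proof (rule Cbu_sphereI)
  show "uniformly_continuous_on (sphere 0 1) (indicator (sphere 0 1) :: 'h \<Rightarrow> complex)"
    unfolding uniformly_continuous_on_def by (auto simp: indicator_def intro: exI[of _ 1])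
qed (auto simp: indicator_def intro: order.refl)

lemma unitary_representationD:
  assumes "unitary_representation G \<pi>" "g \<in> carrier G"
  shows "unitary_operator (\<pi> g)"
  using assms by (auto simp: unitary_representation_def hom_def unitary_group_def)

section \<open>From an invariant mean to an invariant state\<close>

definition numerical_function :: "('h::complex_hilbert \<Rightarrow> 'h) \<Rightarrow> 'h \<Rightarrow> complex" where
  "numerical_function T x = (if x \<in> sphere 0 1 then cinner (T x) x else 0)"

lemma numerical_function_Cbu_sphere:
  assumes T: "T \<in> bounded_operators"
  shows "numerical_function T \<in> Cbu_sphere" "cmod (numerical_function T x) \<le> onorm T"
proof -
  note TD = bounded_operatorsD[OF T]
  have pos: "0 \<le> onorm T"
    using T by (simp add: bounded_operators_def onorm_pos_le)
  have le: "cmod (cinner (T x) y) \<le> onorm T * norm x * norm y" for x y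
    using order.trans[OF cinner_Cauchy_Schwarz mult_right_mono[OF TD(7) norm_ge_zero]] .
  show bound: "cmod (numerical_function T x) \<le> onorm T" for x
    using le[of x x] pos by (cases "norm x = 1") (simp_all add: numerical_function_def)
  have "(2 * onorm T)-lipschitz_on (sphere 0 1) (numerical_function T)"
  proof (rule lipschitz_onI)
    fix x y :: 'a assume xy: "x \<in> sphere 0 1" "y \<in> sphere 0 1"
    \<comment> \<open>Changing one argument at a time gives the Lipschitz constant
      \<open>2 * onorm T\<close>.\<close>
    have "cinner (T x) x - cinner (T y) y = cinner (T (x - y)) x + cinner (T y) (x - y)"
      by (simp add: TD cinner_simps)
    then have "cmod (cinner (T x) x - cinner (T y) y) \<le> onorm T * norm (x - y) * norm x + onorm T * norm y * norm (x - y)"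
      by (metis add_mono le norm_triangle_le)
    then show "dist (numerical_function T x) (numerical_function T y) \<le> 2 * onorm T * dist x y"
      using xy by (simp add: numerical_function_def dist_norm)
  qed (use pos in simp)
  then have "uniformly_continuous_on (sphere 0 1) (numerical_function T)"
    by (rule lipschitz_on_uniformly_continuous)
  then show "numerical_function T \<in> Cbu_sphere"
    by (rule Cbu_sphereI[OF _ _ bound]) (simp add: numerical_function_def)
qed

lemma amenable_if_invariant_mean:
  fixes \<pi> :: "'g \<Rightarrow> 'h::complex_hilbert \<Rightarrow> 'h"
  assumes rep: "unitary_representation G \<pi>" and mean: "invariant_mean G \<pi> \<psi>"
  shows "amenable_representation G \<pi>"
proof -
  have add: "\<And>f h. f \<in> Cbu_sphere \<Longrightarrow> h \<in> Cbu_sphere \<Longrightarrow> \<psi> (\<lambda>x. f x + h x) = \<psi> f + \<psi> h"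
    and scale: "\<And>c f. f \<in> Cbu_sphere \<Longrightarrow> \<psi> (\<lambda>x. c * f x) = c * \<psi> f"
    and pos: "\<And>f. f \<in> Cbu_sphere \<Longrightarrow> (\<forall>x\<in>sphere 0 1. f x \<in> \<real>\<^sub>\<ge>\<^sub>0) \<Longrightarrow> \<psi> f \<in> \<real>\<^sub>\<ge>\<^sub>0"
    and "\<exists>K. \<forall>f\<in>Cbu_sphere. cmod (\<psi> f) \<le> K * sup_norm f"
    and one: "\<psi> (indicator (sphere 0 1)) = 1"
    and inv: "\<And>g f. g \<in> carrier G \<Longrightarrow> f \<in> Cbu_sphere \<Longrightarrow> \<psi> (\<lambda>x. f (\<pi> g x)) = \<psi> f"
    using mean by (simp_all add: invariant_mean_def)
  then obtain K where K: "\<And>f. f \<in> Cbu_sphere \<Longrightarrow> cmod (\<psi> f) \<le> K * sup_norm f"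
    by blast
  let ?N = "numerical_function :: ('h \<Rightarrow> 'h) \<Rightarrow> 'h \<Rightarrow> complex"
  note N = numerical_function_Cbu_sphere
  show ?thesis
    unfolding amenable_representation_def
  proof (intro exI[of _ "\<lambda>T. \<psi> (?N T)"] conjI ballI allI impI)
    fix S T :: "'h \<Rightarrow> 'h" assume S: "S \<in> bounded_operators" and T: "T \<in> bounded_operators"
    have "?N (\<lambda>x. S x + T x) = (\<lambda>x. ?N S x + ?N T x)"
      by (simp add: numerical_function_def fun_eq_iff cinner_add_left)
    then show "\<psi> (?N (\<lambda>x. S x + T x)) = \<psi> (?N S) + \<psi> (?N T)"
      using add[OF N(1)[OF S] N(1)[OF T]] by simp
  next
    fix c and T :: "'h \<Rightarrow> 'h" assume T: "T \<in> bounded_operators"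
    have "?N (\<lambda>x. c *\<^sub>C T x) = (\<lambda>x. c * ?N T x)"
      by (simp add: numerical_function_def fun_eq_iff cinner_scaleC_left)
    then show "\<psi> (?N (\<lambda>x. c *\<^sub>C T x)) = c * \<psi> (?N T)"
      using scale[OF N(1)[OF T]] by simp
  next
    have "cmod (\<psi> (?N T)) \<le> \<bar>K\<bar> * onorm T" if T: "T \<in> bounded_operators" for T
    proof -
      have "cmod (\<psi> (?N T)) \<le> K * sup_norm (?N T)"
        by (rule K[OF N(1)[OF T]])
      also have "\<dots> \<le> \<bar>K\<bar> * onorm T"
        using sup_norm_le[of "?N T", OF N(2)[OF T]] order.trans[OF norm_ge_zero Cbu_sphereD(4)[OF N(1)[OF T]]]
        by (intro mult_mono) auto
      finally show ?thesis .
    qed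
    then show "\<exists>K. \<forall>T\<in>bounded_operators. cmod (\<psi> (?N T)) \<le> K * onorm T"
      by blast
  next
    fix T :: "'h \<Rightarrow> 'h" assume "positive_operator T"
    then show "\<psi> (?N T) \<in> \<real>\<^sub>\<ge>\<^sub>0"
      by (intro pos N(1)) (auto simp: positive_operator_def numerical_function_def)
  next
    have "?N id = indicator (sphere 0 1)"
      by (auto simp: numerical_function_def fun_eq_iff cinner_self)
    then show "\<psi> (?N id) = 1"
      using one by simp
  next
    fix g and T :: "'h \<Rightarrow> 'h" assume g: "g \<in> carrier G" and T: "T \<in> bounded_operators"
    let ?T = "\<pi> g \<circ> T \<circ> inv_into UNIV (\<pi> g)"
    note u = unitary_representationD[OF rep g]
    have "?T \<in> bounded_operators"
      using unitary_operatorD(1)[OF u] unitary_operatorD(1)[OF unitary_operator_inv[OF u]] T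
      by (intro bounded_operators_closed)
    then have "\<psi> (?N ?T) = \<psi> (\<lambda>x. ?N ?T (\<pi> g x))"
      using inv[OF g N(1)] by simp
    \<comment> \<open>Evaluated at \<open>\<pi> g x\<close>, the conjugate loses both unitaries: the
      inner one cancels with its inverse, the outer one in the inner product.\<close>
    also have "(\<lambda>x. ?N ?T (\<pi> g x)) = ?N T"
      using unitary_operatorD(2,3,5)[OF u] by (simp add: numerical_function_def fun_eq_iff)
    finally show "\<psi> (?N ?T) = \<psi> (?N T)" .
  qed
qed

text \<open>A mean is invariant iff it vanishes on these sums of functions \<open>h \<circ> \<pi> g - h\<close>.\<close>

inductive_set coboundaries ::
  "('g, 'b) monoid_scheme \<Rightarrow> ('g \<Rightarrow> 'h \<Rightarrow> 'h) \<Rightarrow> ('h \<Rightarrow> real) set \<Rightarrow> ('h \<Rightarrow> real) set"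
  for G \<pi> X where
    zero: "(\<lambda>x. 0) \<in> coboundaries G \<pi> X"
  | step: "c \<in> coboundaries G \<pi> X \<Longrightarrow> h \<in> X \<Longrightarrow> g \<in> carrier G \<Longrightarrow>
      (\<lambda>x. c x + (h (\<pi> g x) - h x)) \<in> coboundaries G \<pi> X"

lemma coboundaries_add:
  assumes "c \<in> coboundaries G \<pi> X" "d \<in> coboundaries G \<pi> X"
  shows "(\<lambda>x. c x + d x) \<in> coboundaries G \<pi> X"
  using assms(2)
proof (induction rule: coboundaries.induct)
  case (step d h g)
  then show ?case
    using coboundaries.step[OF step.IH step.hyps(2,3)] by (simp add: add.assoc)
qed (simp add: assms(1))

lemma coboundaries_scale:
  assumes X: "function_subspace X" and "c \<in> coboundaries G \<pi> X"
  shows "(\<lambda>x. r * c x) \<in> coboundaries G \<pi> X"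
  using assms(2)
proof (induction rule: coboundaries.induct)
  case (step d h g)
  then show ?case
    using coboundaries.step[OF step.IH function_subspaceD(3)[OF X step.hyps(2)] step.hyps(3), of r]
    by (simp add: algebra_simps)
qed (simp add: coboundaries.zero)

lemma coboundaries_sum:
  assumes "c \<in> coboundaries G \<pi> X"
  shows "\<exists>(m :: nat) h g. (\<forall>i<m. h i \<in> X \<and> g i \<in> carrier G) \<and> c = (\<lambda>x. \<Sum>i<m. h i (\<pi> (g i) x) - h i x)"
  using assms
proof (induction rule: coboundaries.induct)
  case zero
  show ?case
    by (rule exI[of _ 0]) simp
next
  case (step c h g)
  then obtain m :: nat and h' g' where c: "\<forall>i<m. h' i \<in> X \<and> g' i \<in> carrier G"
    "c = (\<lambda>x. \<Sum>i<m. h' i (\<pi> (g' i) x) - h' i x)"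
    by blast
  then show ?case
    using step.hyps(2,3)
    by (intro exI[of _ "Suc m"] exI[of _ "h'(m := h)"] exI[of _ "g'(m := g)"]) (auto simp: less_Suc_eq)
qed

text \<open>Separation takes place among real functions, where domination by the supremum encodes
  positivity and normalisation together. The complex mean is assembled from real and imaginary
  parts.\<close>

lemma invariant_mean_if_amenable:
  fixes \<pi> :: "'g \<Rightarrow> 'h::complex_hilbert \<Rightarrow> 'h"
  assumes rep: "unitary_representation G \<pi>" and amen: "amenable_representation G \<pi>"
  shows "\<exists>\<psi>. invariant_mean G \<pi> \<psi>"
proof -
  obtain \<phi> where \<phi>: "operator_state \<phi>"
    and \<phi>inv: "\<And>g T. g \<in> carrier G \<Longrightarrow> T \<in> bounded_operators \<Longrightarrow> \<phi> (\<pi> g \<circ> T \<circ> inv_into UNIV (\<pi> g)) = \<phi> T"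
    using amen unfolding amenable_representation_def operator_state_def by blast
  note \<pi> = unitary_representationD[OF rep]
  define X :: "('h \<Rightarrow> real) set" where "X = {f. (\<lambda>x. complex_of_real (f x)) \<in> Cbu_sphere}"
  have X: "function_subspace X"
    unfolding function_subspace_def
  proof (intro conjI ballI allI)
    show "(\<lambda>x. 0) \<in> X"
      using Cbu_sphere_closed(2)[OF indicator_Cbu_sphere, of 0] by (simp add: X_def)
    fix f assume f: "f \<in> X"
    then show "(\<lambda>x. c * f x) \<in> X" for c
      using Cbu_sphere_closed(2)[of "\<lambda>x. complex_of_real (f x)" "complex_of_real c"] by (simp add: X_def)
    fix h assume "h \<in> X"
    then show "(\<lambda>x. f x + h x) \<in> X"
      using f Cbu_sphere_closed(1)[of "\<lambda>x. complex_of_real (f x)" "\<lambda>x. complex_of_real (h x)"]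
      by (simp add: X_def)
  qed
  note Xc = function_subspaceD[OF X]
  have XRe: "(\<lambda>x. Re (f x)) \<in> X" and XIm: "(\<lambda>x. Im (f x)) \<in> X" if "f \<in> Cbu_sphere" for f
    using Cbu_sphere_closed(3,4)[OF that] by (simp_all add: X_def)
  have Xtr: "(\<lambda>x. f (\<pi> g x)) \<in> X" if "f \<in> X" "g \<in> carrier G" for f g
    using Cbu_sphere_closed(5)[OF _ \<pi>[OF that(2)], of "\<lambda>x. complex_of_real (f x)"] that(1) by (simp add: X_def)
  have Xbdd: "\<exists>M. \<forall>x. \<bar>f x\<bar> \<le> M" if "f \<in> X" for f
    using Cbu_sphereD(3)[of "\<lambda>x. complex_of_real (f x)"] that by (simp add: X_def)
  have Xuc: "uniformly_continuous_on (sphere 0 1) f" if "f \<in> X" for f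
    using bounded_linear.uniformly_continuous_on[OF bounded_linear_Re Cbu_sphereD(1),
        of "\<lambda>x. complex_of_real (f x)"] that by (simp add: X_def)
  \<comment> \<open>All demands are \<open>t = 0\<close>: a functional that is nonnegative on a
    linear subspace vanishes there.\<close>
  define C where "C = {(c, t :: real). c \<in> coboundaries G \<pi> X \<and> t = 0}"
  have coX: "c \<in> X" if "c \<in> coboundaries G \<pi> X" for c
    using that by induction (intro Xc Xtr | assumption)+
  let ?S = "sphere 0 1 :: 'h set"
  have co_le: "0 \<le> (SUP x\<in>?S. c x)" and ne: "?S \<noteq> {}" if c: "c \<in> coboundaries G \<pi> X" for c
  proof -
    obtain m :: nat and h g where hg: "\<And>i. i < m \<Longrightarrow> h i \<in> X" "\<And>i. i < m \<Longrightarrow> g i \<in> carrier G"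
      and c_eq: "c = (\<lambda>x. \<Sum>i<m. h i (\<pi> (g i) x) - h i x)"
      using coboundaries_sum[OF c] by blast
    have not_neg: "\<epsilon> \<le> 0" if "\<And>x. x \<in> ?S \<Longrightarrow> c x \<le> - \<epsilon>" for \<epsilon>
    proof (rule coboundary_not_negative[where u = "\<lambda>i. \<pi> (g i)" and h = h and m = m, OF \<phi>])
      show "\<exists>M. \<forall>x\<in>?S. \<bar>h i x\<bar> \<le> M" if "i < m" for i
        using Xbdd[OF hg(1)[OF that]] by blast
      show "(\<Sum>i<m. h i (\<pi> (g i) x) - h i x) \<le> - \<epsilon>" if "x \<in> ?S" for x
        using \<open>\<And>x. x \<in> ?S \<Longrightarrow> c x \<le> - \<epsilon>\<close>[OF that] by (simp add: c_eq)
    qed (use hg \<pi> \<phi>inv Xuc in auto)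
    show "?S \<noteq> {}"
    proof
      \<comment> \<open>On an empty sphere the upper bound is vacuous for every
        \<open>\<epsilon>\<close>, so even \<open>\<epsilon> = 1\<close> would have to be at most 0.
        Amenability thus excludes the zero space.\<close>
      assume "?S = {}"
      then have "(1 :: real) \<le> 0"
        by (intro not_neg) blast
      then show False
        by simp
    qed
    obtain M where M: "\<And>x. \<bar>c x\<bar> \<le> M"
      using Xbdd[OF coX[OF c]] by blast
    then have "bdd_above (c ` ?S)"
      by (intro bdd_aboveI2[of _ _ M]) (simp add: abs_le_iff)
    then have "c x \<le> - (- (SUP x\<in>?S. c x))" if "x \<in> ?S" for x
      using that by (simp add: cSUP_upper)
    then show "0 \<le> (SUP x\<in>?S. c x)"
      using not_neg by fastforce
  qed
  have ne: "?S \<noteq> {}"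
    by (rule ne[OF coboundaries.zero])
  have "\<exists>l. linear_functional_on X l \<and> (\<forall>f\<in>X. l f \<le> (SUP x\<in>?S. f x)) \<and> (\<forall>(c, t)\<in>C. t \<le> l c)"
  proof (rule cone_separation[OF X ne])
    show "\<exists>M. \<forall>x\<in>?S. \<bar>f x\<bar> \<le> M" if "f \<in> X" for f
      using Xbdd[OF that] by blast
  qed (auto simp: C_def coX co_le coboundaries_add coboundaries_scale[OF X] coboundaries.zero)
  then obtain l where l: "linear_functional_on X l" and l_le: "\<And>f. f \<in> X \<Longrightarrow> l f \<le> (SUP x\<in>?S. f x)"
    and lC: "\<forall>(c, t)\<in>C. t \<le> l c"
    by blast
  have l_co: "0 \<le> l c" if "c \<in> coboundaries G \<pi> X" for c
    using lC that by (auto simp: C_def)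
  note l_add = linear_functional_onD(1)[OF l] and l_scale = linear_functional_onD(2)[OF l]
  have l_bound: "l f \<le> M" if "f \<in> X" "\<And>x. x \<in> ?S \<Longrightarrow> f x \<le> M" for f M
    using l_le[OF that(1)] cSUP_least[OF ne that(2)] by (rule order.trans)
  have l_diff: "l (\<lambda>x. f x - h x) = l f - l h" if "f \<in> X" "h \<in> X" for f h
    using l_add[OF that(1) Xc(3)[OF that(2), of "-1"]] l_scale[OF that(2), of "-1"] by simp
  have l_zero: "l (\<lambda>x. 0) = 0"
    using l_diff[OF Xc(1) Xc(1)] by simp
  have l_inv: "l (\<lambda>x. f (\<pi> g x)) = l f" if f: "f \<in> X" and g: "g \<in> carrier G" for f g
  proof -
    let ?c = "\<lambda>x. 0 + (f (\<pi> g x) - f x)"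
    have c: "?c \<in> coboundaries G \<pi> X"
      using f g by (intro coboundaries.step coboundaries.zero)
    have "0 \<le> l ?c" "0 \<le> l (\<lambda>x. -1 * ?c x)"
      by (intro l_co c coboundaries_scale[OF X])+
    then have "l ?c = 0"
      using l_scale[OF coX[OF c], of "-1"] by simp
    then show ?thesis
      using l_diff[OF Xtr[OF f g] f] by simp
  qed
  define \<psi> where "\<psi> f = Complex (l (\<lambda>x. Re (f x))) (l (\<lambda>x. Im (f x)))" for f
  have \<psi>_add: "\<psi> (\<lambda>x. f x + h x) = \<psi> f + \<psi> h" if "f \<in> Cbu_sphere" "h \<in> Cbu_sphere" for f h
    using that by (simp add: \<psi>_def complex_eq_iff l_add XRe XIm)
  have \<psi>_scale: "\<psi> (\<lambda>x. c * f x) = c * \<psi> f" if f: "f \<in> Cbu_sphere" for c f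
  proof -
    have "l (\<lambda>x. Re c * Re (f x) - Im c * Im (f x)) = Re c * l (\<lambda>x. Re (f x)) - Im c * l (\<lambda>x. Im (f x))"
      "l (\<lambda>x. Re c * Im (f x) + Im c * Re (f x)) = Re c * l (\<lambda>x. Im (f x)) + Im c * l (\<lambda>x. Re (f x))"
      using XRe[OF f] XIm[OF f] by (simp_all add: l_diff l_add l_scale Xc)
    then show ?thesis
      by (simp add: \<psi>_def complex_eq_iff)
  qed
  have \<psi>_le: "cmod (\<psi> f) \<le> sup_norm f" if f: "f \<in> Cbu_sphere" for f
  proof (cases "\<psi> f = 0")
    case False
    \<comment> \<open>Rotation by a phase makes the value of the mean real and nonnegative, so the
      bound for the real functional \<open>l\<close> gives norm at most 1 without loss.\<close>
    define c where "c = cnj (\<psi> f) / cmod (\<psi> f)"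
    have c: "cmod c = 1"
      using False by (simp add: c_def norm_divide)
    have "c * \<psi> f = complex_of_real (cmod (\<psi> f))"
      using False by (simp add: c_def complex_norm_square[symmetric] mult.commute field_simps
          power2_eq_square flip: of_real_mult)
    then have "cmod (\<psi> f) = Re (\<psi> (\<lambda>x. c * f x))"
      by (simp add: \<psi>_scale[OF f])
    also have "\<dots> = l (\<lambda>x. Re (c * f x))"
      by (simp add: \<psi>_def)
    also have "\<dots> \<le> sup_norm f"
    proof (rule l_bound)
      show "(\<lambda>x. Re (c * f x)) \<in> X"
        by (rule XRe[OF Cbu_sphere_closed(2)[OF f]])
      show "Re (c * f x) \<le> sup_norm f" for x
        using order.trans[OF complex_Re_le_cmod, of "c * f x" "sup_norm f"] Cbu_sphereD(4)[OF f, of x] c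
        by (simp add: norm_mult)
    qed
    finally show ?thesis .
  next
    case True
    then show ?thesis
      using order.trans[OF norm_ge_zero Cbu_sphereD(4)[OF f]] by simp
  qed
  have one: "\<psi> (indicator ?S) = 1"
  proof -
    let ?i = "\<lambda>x. Re (indicator ?S x)"
    have i: "?i \<in> X"
      by (rule XRe[OF indicator_Cbu_sphere])
    have "l ?i \<le> 1"
      by (rule l_bound[OF i]) (simp add: indicator_def)
    \<comment> \<open>An upper bound at the negative function is the lower bound at the function
      itself; the indicator is constantly 1 on the sphere.\<close>
    moreover have "l (\<lambda>x. -1 * ?i x) \<le> -1"
      by (rule l_bound[OF Xc(3)[OF i]]) simp
    ultimately have "l ?i = 1"
      using l_scale[OF i, of "-1"] by simp
    moreover have "(\<lambda>x. Im (indicator ?S x)) = (\<lambda>x. 0)"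
      by (simp add: indicator_def fun_eq_iff)
    ultimately show ?thesis
      by (simp only: \<psi>_def l_zero) (simp add: complex_eq_iff)
  qed
  have "invariant_mean G \<pi> \<psi>"
    unfolding invariant_mean_def
  proof (intro conjI ballI allI impI)
    show "\<psi> f \<in> \<real>\<^sub>\<ge>\<^sub>0" if f: "f \<in> Cbu_sphere" and pos: "\<forall>x\<in>?S. f x \<in> \<real>\<^sub>\<ge>\<^sub>0" for f
    proof -
      \<comment> \<open>Off the sphere this uses the extension by 0, so that the imaginary part is
        the zero function on the whole space.\<close>
      have "Im (f x) = 0" for x
        using pos Cbu_sphereD(2)[OF f, of x] by (cases "x \<in> ?S") (auto simp: complex_nonneg_Reals_iff)
      then have "Im (\<psi> f) = 0"
        by (simp add: \<psi>_def l_zero)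
      moreover have "l (\<lambda>x. -1 * Re (f x)) \<le> 0"
        using pos by (intro l_bound Xc(3) XRe[OF f]) (simp add: complex_nonneg_Reals_iff)
      then have "0 \<le> Re (\<psi> f)"
        using l_scale[OF XRe[OF f], of "-1"] by (simp add: \<psi>_def)
      ultimately show ?thesis
        by (simp add: complex_nonneg_Reals_iff)
    qed
    show "\<exists>K. \<forall>f\<in>Cbu_sphere. cmod (\<psi> f) \<le> K * sup_norm f"
      using \<psi>_le by (intro exI[of _ 1]) simp
    have ind: "indicator ?S \<in> {f \<in> Cbu_sphere. sup_norm f \<le> 1}"
      using indicator_Cbu_sphere sup_norm_le[of "indicator ?S" 1] by (auto simp: indicator_def)
    show "(SUP f\<in>{f \<in> Cbu_sphere. sup_norm f \<le> 1}. cmod (\<psi> f)) = 1"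
    proof (rule antisym)
      show "(SUP f\<in>{f \<in> Cbu_sphere. sup_norm f \<le> 1}. cmod (\<psi> f)) \<le> 1"
        using ind \<psi>_le by (intro cSUP_least) (blast, force)
      show "1 \<le> (SUP f\<in>{f \<in> Cbu_sphere. sup_norm f \<le> 1}. cmod (\<psi> f))"
        using \<psi>_le by (intro cSUP_upper2[OF _ ind] bdd_aboveI2[of _ _ 1]) (force, simp add: one)
    qed
    show "\<psi> (\<lambda>x. f (\<pi> g x)) = \<psi> f" if "g \<in> carrier G" "f \<in> Cbu_sphere" for g f
      using l_inv[OF XRe[OF that(2)] that(1)] l_inv[OF XIm[OF that(2)] that(1)] by (simp add: \<psi>_def)
  qed (use \<psi>_add \<psi>_scale one in auto)
  then show ?thesis
    by blast
qed

theorem theorem7p6: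
  fixes G :: "('g, 'b) monoid_scheme"
    and \<pi> :: "'g \<Rightarrow> 'h::complex_hilbert \<Rightarrow> 'h"
  assumes "group G"
    and "unitary_representation G \<pi>"
  shows "(\<exists>\<psi>. invariant_mean G \<pi> \<psi>) \<longleftrightarrow> amenable_representation G \<pi>"
  using amenable_if_invariant_mean[OF assms(2)] invariant_mean_if_amenable[OF assms(2)] by blast

end
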